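(* Let $n>1$, $1\le k\le n$, and let $\Phi\in L^{\infty}(\mathbb{M}_{n})$ be an admissible very badly approximable matrix function. Suppose there is $\Psi\in\mathcal{A}_{k}^{n}$ such that \[\int_{\mathbb{T}}\operatorname{trace}(\Phi(\zeta)\Psi(\zeta))\,d\boldsymbol{m}(\zeta)=t_{0}(\Phi)+\ldots+t_{n}(\Phi).\] If $t_{k-1}(\Phi)>0$, then $\Phi$ has order $k$ and the zero matrix function is a best approximant to $\Phi$ in $H^\infty(\mathbb{M}_n)$ under the $L^{\infty}(\boldsymbol{S}_{1}^{n})$-norm.
   Context: $\mathbb{T}$ is the unit circle, $\boldsymbol{m}$ normalized Lebesgue measure. $\mathbb{M}_{n,k}$: complex $n\times k$ matrices with operator norm, $\mathbb{M}_n=\mathbb{M}_{n,n}$. For a matrix $A$, $s_j(A)=\inf\{\|A-B\|:\operatorname{rank}B\le j\}$ for all $j\ge0$ (so $s_j(A)=0$ for $j\ge n$ when $A$ is $n\times n$); $\boldsymbol{S}_1^{n,k}$ is $\mathbb{M}_{n,k}$ with trace norm $\sum_j s_j(A)$. For a function space $X$ on $\mathbb{T}$ ($L^p,H^p,H^p_0=\{f\in H^p:\hat f(0)=0\}$), $X(\mathbb{M}_{n,k})$ (resp. $X(\boldsymbol{S}_1^{n,k})$) consists of matrix functions with entries in $X$, normed by the $X$-norm of the pointwise operator (resp. trace) norm. For $1\le k\le n$: $\mathcal{A}_k^{n}=\{\Psi\in H^1_0(\mathbb{M}_{n}):\|\Psi\|_{L^1(\mathbb{M}_{n})}\le1,\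 \operatorname{rank}\Psi\le k\text{ a.e.}\}$, $\sigma_k(\Phi)=\sup_{\Psi\in\mathcal{A}_k^{n}}|\int_{\mathbb{T}}\operatorname{trace}(\Phi\Psi)\,d\boldsymbol{m}|$; $H_\Phi^{\{k\}}:H^2(\mathbb{M}_{n,k})\to L^2(\boldsymbol{S}_1^{n,k})/H^2(\boldsymbol{S}_1^{n,k})$ maps $F$ to the coset of $\Phi F$ (quotient norm); a maximizing vector of $T$ is a nonzero $x$ with $\|Tx\|=\|T\|\|x\|$. $\Phi$ has order $\ell$ if $\ell$ is the smallest number such that $H_\Phi^{\{\ell\}}$ has a maximizing vector and $\sigma_\ell(\Phi)=\inf_{F\in H^\infty(\mathbb{M}_n)}\|\Phi-F\|_{L^\infty(\boldsymbol{S}_1^n)}$. Superoptimal approximation: $\Omega_0(\Phi)$ is the set of $F\in H^\infty(\mathbb{M}_n)$ minimizing $\operatorname{ess\,sup}_\zeta\|\Phi(\zeta)-F(\zeta)\|$, $\Omega_j(\Phi)$ the set of $F\in\Omega_{j-1}(\Phi)$ minimizing $\operatorname{ess\,sup}_\zeta s_j(\Phi(\zeta)-F(\zeta))$; for $F\in\Omega_{n-1}(\Phi)$, $t_j(\Phi)=\operatorname{ess\,sup}_\zeta s_j((\Phi-F)(\zeta))$, $j\ge0$ (in particular $t_n(\Phi)=0$); $\Phi$ is very badly approximable if the zero function belongs to $\Omega_{n-1}(\Phi)$. The Hankel operator is $H_\Phi f=\mathbb{P}_-(\Phi f)$ on $H^2(\mathbb{C}^n)$; $\Phi$ is admissible if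 $\|H_\Phi\|_{\rm e}$ (distance to compact operators) is strictly less than the smallest nonzero superoptimal singular value of $\Phi$. *)

theory Defs
  imports "HOL-Probability.Probability" "Jordan_Normal_Form.DL_Rank"
begin

definition circle_m :: "complex measure" where
  "circle_m = distr (restrict_space lborel {0..1::real}) borel (\<lambda>t. cis (2 * pi * t))"

definition fourier_coeff :: "(complex \<Rightarrow> complex) \<Rightarrow> int \<Rightarrow> complex" where
  "fourier_coeff f j = integral\<^sup>L circle_m (\<lambda>\<zeta>. f \<zeta> * \<zeta> powi (- j))"

definition L1 :: "(complex \<Rightarrow> complex) \<Rightarrow> bool" where
  "L1 f \<longleftrightarrow> integrable circle_m f"

definition L2 :: "(complex \<Rightarrow> complex) \<Rightarrow> bool" where
  "L2 f \<longleftrightarrow> f \<in> borel_measurable circle_m \<and> integrable circle_m (\<lambda>\<zeta>. (cmod (f \<zeta>))\<^sup>2)"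

definition Linf :: "(complex \<Rightarrow> complex) \<Rightarrow> bool" where
  "Linf f \<longleftrightarrow> f \<in> borel_measurable circle_m \<and> esssup circle_m (\<lambda>\<zeta>. ereal (cmod (f \<zeta>))) < \<infinity>"

definition H1_0 :: "(complex \<Rightarrow> complex) \<Rightarrow> bool" where
  "H1_0 f \<longleftrightarrow> L1 f \<and> (\<forall>j\<le>0. fourier_coeff f j = 0)"

definition H2 :: "(complex \<Rightarrow> complex) \<Rightarrow> bool" where
  "H2 f \<longleftrightarrow> L2 f \<and> (\<forall>j<0. fourier_coeff f j = 0)"

definition H2_minus :: "(complex \<Rightarrow> complex) \<Rightarrow> bool" where
  "H2_minus f \<longleftrightarrow> L2 f \<and> (\<forall>j\<ge>0. fourier_coeff f j = 0)"

definition Hinf :: "(complex \<Rightarrow> complex) \<Rightarrow> bool" where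
  "Hinf f \<longleftrightarrow> Linf f \<and> (\<forall>j<0. fourier_coeff f j = 0)"

text \<open>Orthogonal projection \<open>\<bbbP>_-\<close> of \<open>L^2\<close> onto \<open>H^2_-\<close> (defined through Fourier coefficients).\<close>
definition P_minus :: "(complex \<Rightarrow> complex) \<Rightarrow> (complex \<Rightarrow> complex)" where
  "P_minus g = (SOME h. L2 h \<and> (\<forall>j. fourier_coeff h j = (if j < 0 then fourier_coeff g j else 0)))"

definition vnorm :: "complex vec \<Rightarrow> real" where
  "vnorm x = sqrt (\<Sum>i<dim_vec x. (cmod (x $ i))\<^sup>2)"

definition opnorm :: "complex mat \<Rightarrow> real" where
  "opnorm A = Sup {vnorm (A *\<^sub>v x) | x. x \<in> carrier_vec (dim_col A) \<and> vnorm x \<le> 1}"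

definition mtrace :: "complex mat \<Rightarrow> complex" where
  "mtrace A = (\<Sum>i<dim_row A. A $$ (i, i))"

definition mrank :: "complex mat \<Rightarrow> nat" where
  "mrank (A :: complex mat) = vec_space.rank (dim_row A) A"

definition sval :: "nat \<Rightarrow> complex mat \<Rightarrow> real" where
  "sval j A = Inf {opnorm (A - B) | B. B \<in> carrier_mat (dim_row A) (dim_col A) \<and> mrank B \<le> j}"

text \<open>Trace norm \<open>\<Sum>_j s_j(A)\<close> (all \<open>s_j\<close> with \<open>j \<ge> min(rows, cols)\<close> vanish).\<close>
definition tnorm :: "complex mat \<Rightarrow> real" where
  "tnorm A = (\<Sum>j<dim_row A + dim_col A. sval j A)"

definition mat_fun :: "((complex \<Rightarrow> complex) \<Rightarrow> bool) \<Rightarrow> nat \<Rightarrow> nat \<Rightarrow> (complex \<Rightarrow> complex mat) \<Rightarrow> bool" where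
  "mat_fun X n k F \<longleftrightarrow> (\<forall>\<zeta>. F \<zeta> \<in> carrier_mat n k) \<and> (\<forall>i<n. \<forall>j<k. X (\<lambda>\<zeta>. F \<zeta> $$ (i, j)))"

definition vec_fun :: "((complex \<Rightarrow> complex) \<Rightarrow> bool) \<Rightarrow> nat \<Rightarrow> (complex \<Rightarrow> complex vec) \<Rightarrow> bool" where
  "vec_fun X n f \<longleftrightarrow> (\<forall>\<zeta>. f \<zeta> \<in> carrier_vec n) \<and> (\<forall>i<n. X (\<lambda>\<zeta>. f \<zeta> $ i))"

definition Linf_S1_norm :: "(complex \<Rightarrow> complex mat) \<Rightarrow> ereal" where
  "Linf_S1_norm F = esssup circle_m (\<lambda>\<zeta>. ereal (tnorm (F \<zeta>)))"

definition L1_op_norm :: "(complex \<Rightarrow> complex mat) \<Rightarrow> ennreal" where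
  "L1_op_norm F = (\<integral>\<^sup>+\<zeta>. ennreal (opnorm (F \<zeta>)) \<partial>circle_m)"

definition L2_op_norm :: "(complex \<Rightarrow> complex mat) \<Rightarrow> real" where
  "L2_op_norm F = sqrt (\<integral>\<zeta>. (opnorm (F \<zeta>))\<^sup>2 \<partial>circle_m)"

definition L2_S1_norm :: "(complex \<Rightarrow> complex mat) \<Rightarrow> real" where
  "L2_S1_norm F = sqrt (\<integral>\<zeta>. (tnorm (F \<zeta>))\<^sup>2 \<partial>circle_m)"

definition L2_vec_norm :: "(complex \<Rightarrow> complex vec) \<Rightarrow> real" where
  "L2_vec_norm f = sqrt (\<integral>\<zeta>. (vnorm (f \<zeta>))\<^sup>2 \<partial>circle_m)"

definition A_set :: "nat \<Rightarrow> nat \<Rightarrow> (complex \<Rightarrow> complex mat) set" where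
  "A_set n k = {\<Psi>. mat_fun H1_0 n n \<Psi> \<and> L1_op_norm \<Psi> \<le> 1 \<and> (AE \<zeta> in circle_m. mrank (\<Psi> \<zeta>) \<le> k)}"

definition sigma :: "nat \<Rightarrow> nat \<Rightarrow> (complex \<Rightarrow> complex mat) \<Rightarrow> real" where
  "sigma n k \<Phi> = Sup {cmod (\<integral>\<zeta>. mtrace (\<Phi> \<zeta> * \<Psi> \<zeta>) \<partial>circle_m) | \<Psi>. \<Psi> \<in> A_set n k}"

definition dist_S1 :: "nat \<Rightarrow> (complex \<Rightarrow> complex mat) \<Rightarrow> ereal" where
  "dist_S1 n \<Phi> = (INF F \<in> {F. mat_fun Hinf n n F}. Linf_S1_norm (\<lambda>\<zeta>. \<Phi> \<zeta> - F \<zeta>))"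

text \<open>Norm of \<open>H_\<Phi>^{k} F\<close> in the quotient \<open>L^2(S_1^{n,k}) / H^2(S_1^{n,k})\<close>.\<close>
definition hankel_k_val :: "nat \<Rightarrow> nat \<Rightarrow> (complex \<Rightarrow> complex mat) \<Rightarrow> (complex \<Rightarrow> complex mat) \<Rightarrow> real" where
  "hankel_k_val n k \<Phi> F = Inf {L2_S1_norm (\<lambda>\<zeta>. \<Phi> \<zeta> * F \<zeta> - G \<zeta>) | G. mat_fun H2 n k G}"

definition hankel_k_norm :: "nat \<Rightarrow> nat \<Rightarrow> (complex \<Rightarrow> complex mat) \<Rightarrow> real" where
  "hankel_k_norm n k \<Phi> = Sup {hankel_k_val n k \<Phi> F | F. mat_fun H2 n k F \<and> L2_op_norm F \<le> 1}"

definition hankel_k_has_max_vec :: "nat \<Rightarrow> nat \<Rightarrow> (complex \<Rightarrow> complex mat) \<Rightarrow> bool" where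
  "hankel_k_has_max_vec n k \<Phi> \<longleftrightarrow>
     (\<exists>F. mat_fun H2 n k F \<and> L2_op_norm F \<noteq> 0 \<and>
          hankel_k_val n k \<Phi> F = hankel_k_norm n k \<Phi> * L2_op_norm F)"

definition order_prop :: "nat \<Rightarrow> (complex \<Rightarrow> complex mat) \<Rightarrow> nat \<Rightarrow> bool" where
  "order_prop n \<Phi> l \<longleftrightarrow> hankel_k_has_max_vec n l \<Phi> \<and> ereal (sigma n l \<Phi>) = dist_S1 n \<Phi>"

definition has_order :: "nat \<Rightarrow> (complex \<Rightarrow> complex mat) \<Rightarrow> nat \<Rightarrow> bool" where
  "has_order n \<Phi> l \<longleftrightarrow> order_prop n \<Phi> l \<and> (\<forall>l'<l. \<not> order_prop n \<Phi> l')"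

definition argmin_set :: "'a set \<Rightarrow> ('a \<Rightarrow> ereal) \<Rightarrow> 'a set" where
  "argmin_set S f = {x \<in> S. \<forall>y\<in>S. f x \<le> f y}"

definition ess_sval :: "nat \<Rightarrow> (complex \<Rightarrow> complex mat) \<Rightarrow> ereal" where
  "ess_sval j F = esssup circle_m (\<lambda>\<zeta>. ereal (sval j (F \<zeta>)))"

fun Omega :: "nat \<Rightarrow> (complex \<Rightarrow> complex mat) \<Rightarrow> nat \<Rightarrow> (complex \<Rightarrow> complex mat) set" where
  "Omega n \<Phi> 0 = argmin_set {F. mat_fun Hinf n n F} (\<lambda>F. ess_sval 0 (\<lambda>\<zeta>. \<Phi> \<zeta> - F \<zeta>))"
| "Omega n \<Phi> (Suc j) = argmin_set (Omega n \<Phi> j) (\<lambda>F. ess_sval (Suc j) (\<lambda>\<zeta>. \<Phi> \<zeta> - F \<zeta>))"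

definition t_sv :: "nat \<Rightarrow> (complex \<Rightarrow> complex mat) \<Rightarrow> nat \<Rightarrow> real" where
  "t_sv n \<Phi> j = real_of_ereal (ess_sval j (\<lambda>\<zeta>. \<Phi> \<zeta> - (SOME F. F \<in> Omega n \<Phi> (n - 1)) \<zeta>))"

definition very_badly_approximable :: "nat \<Rightarrow> (complex \<Rightarrow> complex mat) \<Rightarrow> bool" where
  "very_badly_approximable n \<Phi> \<longleftrightarrow> (\<lambda>\<zeta>. 0\<^sub>m n n) \<in> Omega n \<Phi> (n - 1)"

definition P_minus_vec :: "nat \<Rightarrow> (complex \<Rightarrow> complex vec) \<Rightarrow> (complex \<Rightarrow> complex vec)" where
  "P_minus_vec n g = (\<lambda>\<zeta>. Matrix.vec n (\<lambda>i. P_minus (\<lambda>z. g z $ i) \<zeta>))"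

definition hankel :: "nat \<Rightarrow> (complex \<Rightarrow> complex mat) \<Rightarrow> (complex \<Rightarrow> complex vec) \<Rightarrow> (complex \<Rightarrow> complex vec)" where
  "hankel n \<Phi> f = P_minus_vec n (\<lambda>\<zeta>. \<Phi> \<zeta> *\<^sub>v f \<zeta>)"

text \<open>Compact linear operators \<open>H^2(\<complex>^n) \<rightarrow> H^2_-(\<complex>^n)\<close> (acting on a.e.-classes): every bounded
  sequence has a subsequence whose image converges in \<open>L^2\<close>.\<close>
definition compact_op :: "nat \<Rightarrow> ((complex \<Rightarrow> complex vec) \<Rightarrow> (complex \<Rightarrow> complex vec)) \<Rightarrow> bool" where
  "compact_op n K \<longleftrightarrow>
     (\<forall>f. vec_fun H2 n f \<longrightarrow> vec_fun H2_minus n (K f)) \<and>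
     (\<forall>f g. vec_fun H2 n f \<longrightarrow> vec_fun H2 n g \<longrightarrow> (AE \<zeta> in circle_m. f \<zeta> = g \<zeta>) \<longrightarrow>
        (AE \<zeta> in circle_m. K f \<zeta> = K g \<zeta>)) \<and>
     (\<forall>f g (a::complex) (b::complex). vec_fun H2 n f \<longrightarrow> vec_fun H2 n g \<longrightarrow>
        (AE \<zeta> in circle_m. K (\<lambda>z. a \<cdot>\<^sub>v f z + b \<cdot>\<^sub>v g z) \<zeta> = a \<cdot>\<^sub>v K f \<zeta> + b \<cdot>\<^sub>v K g \<zeta>)) \<and>
     (\<forall>u :: nat \<Rightarrow> complex \<Rightarrow> complex Matrix.vec. (\<forall>i. vec_fun H2 n (u i) \<and> L2_vec_norm (u i) \<le> 1) \<longrightarrow>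
        (\<exists>(r :: nat \<Rightarrow> nat) g. strict_mono r \<and> vec_fun L2 n g \<and>
           (\<lambda>i. L2_vec_norm (\<lambda>\<zeta>. K (u (r i)) \<zeta> - g \<zeta>)) \<longlonglongrightarrow> 0))"

definition op_dist :: "nat \<Rightarrow> ((complex \<Rightarrow> complex vec) \<Rightarrow> (complex \<Rightarrow> complex vec))
     \<Rightarrow> ((complex \<Rightarrow> complex vec) \<Rightarrow> (complex \<Rightarrow> complex vec)) \<Rightarrow> real" where
  "op_dist n T K = Sup {L2_vec_norm (\<lambda>\<zeta>. T f \<zeta> - K f \<zeta>) | f. vec_fun H2 n f \<and> L2_vec_norm f \<le> 1}"

definition hankel_ess_norm :: "nat \<Rightarrow> (complex \<Rightarrow> complex mat) \<Rightarrow> real" where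
  "hankel_ess_norm n \<Phi> = Inf {op_dist n (hankel n \<Phi>) K | K. compact_op n K}"

text \<open>\<open>\<parallel>H_\<Phi>\<parallel>_e\<close> is strictly less than the smallest nonzero superoptimal singular value,
  i.e. less than every nonzero \<open>t_j(\<Phi>)\<close> (\<open>t_j = 0\<close> for \<open>j \<ge> n\<close>).\<close>
definition admissible :: "nat \<Rightarrow> (complex \<Rightarrow> complex mat) \<Rightarrow> bool" where
  "admissible n \<Phi> \<longleftrightarrow> (\<forall>j<n. t_sv n \<Phi> j \<noteq> 0 \<longrightarrow> hankel_ess_norm n \<Phi> < t_sv n \<Phi> j)"

end

theory Submission
  imports Defs
begin

text \<open>
  Since \<open>\<Phi>\<close> is very badly approximable, \<open>t\<^sub>j\<close> is the essential supremum of \<open>s\<^sub>j(\<Phi>)\<close>. A matrix \<open>B\<close> of rank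
  at most \<open>l\<close> satisfies \<open>|trace(A B)| \<le> (s\<^sub>0(A) + \<dots> + s\<^bsub>l-1\<^esub>(A)) \<parallel>B\<parallel>\<close>, hence
  \<open>\<sigma>\<^sub>l(\<Phi>) \<le> t\<^sub>0 + \<dots> + t\<^bsub>l-1\<^esub>\<close>. The extremal function \<open>\<Psi>\<close> therefore forces
  \<open>\<sigma>\<^sub>k(\<Phi>) = t\<^sub>0 + \<dots> + t\<^bsub>k-1\<^esub> = \<parallel>\<Phi>\<parallel>\<close>, and \<open>t\<^bsub>k-1\<^esub> > 0\<close> makes \<open>\<sigma>\<^sub>l(\<Phi>)\<close> strictly smaller for \<open>l < k\<close>.
  As \<open>\<Psi>\<close> annihilates \<open>H\<^sup>\<infinity>\<close>, zero is a best approximant.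

  For the maximizing vector, \<open>\<Psi>\<close> is factored as \<open>F G\<close> with \<open>F \<in> H\<^sup>2(\<M>\<^bsub>n,k\<^esub>)\<close>, \<open>G \<in> H\<^sup>2\<^sub>0(\<M>\<^bsub>k,n\<^esub>)\<close> and
  \<open>\<parallel>F\<parallel>\<^sup>2, \<parallel>G\<parallel>\<^sup>2 \<le> \<parallel>\<Psi>\<parallel>\<close> almost everywhere; then \<open>F\<close> is maximizing, with \<open>G\<close> as dual certificate. The
  factorization is a Beurling--Lax argument in the shift invariant subspace of all \<open>f \<in> L\<^sup>2(\<complex>\<^sup>n)\<close> with
  \<open>\<parallel>\<Psi>\<parallel>\<^bsup>1/2\<^esup> f\<close> analytic and values in the range of \<open>\<Psi>\<close>: a maximal family of wandering vectors
  is pointwise orthonormal, so it has at most \<open>k\<close> members.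
\<close>

subsection \<open>Fourier coefficients of integrable functions on the circle\<close>

text \<open>A pointwise splitting of \<open>\<Psi>\<close>, such as a polar decomposition, gives
  factors of the right size but destroys analyticity. Size and analyticity are therefore treated
  separately. Let \<open>w\<close> be the square root of the norm of \<open>\<Psi>\<close>, and let
  the vectors \<open>\<phi> l\<close> be orthonormal at almost every point. The columns of
  \<open>F\<close> are \<open>w \<phi> l\<close>, and the rows of \<open>G\<close> pair
  \<open>\<Psi> / w\<close> with \<open>\<phi> l\<close>. Orthonormality alone gives both norm
  bounds: \<open>F\<close> is \<open>w\<close> times an isometry, and Bessel's inequality bounds
  \<open>G\<close>. Analyticity of \<open>F\<close> is membership of \<open>\<phi> l\<close> in the
  invariant subspace; analyticity of \<open>G\<close> is orthogonality of \<open>\<phi> l\<close> to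
  \<open>z\<close> times that subspace. Since \<open>\<Psi>\<close> has vanishing mean, one factor
  \<open>z\<close> is split off beforehand and returned to \<open>G\<close>, which makes
  \<open>G\<close> annihilate \<open>H^2\<close>. The same factorization reduces the pairing of
  \<open>\<Psi>\<close> with \<open>H^\<infinity>\<close> to products of square integrable
  functions. The analytic input is uniqueness of Fourier coefficients and projection onto closed
  subspaces, both for functions rather than a.e. classes.\<close>

lemma measurable_cis_2pi [measurable]: "(\<lambda>t. cis (2 * pi * t)) \<in> borel \<rightarrow>\<^sub>M borel"
  by (intro borel_measurable_continuous_onI continuous_intros)

lemma space_circle_m [simp]: "space circle_m = UNIV"
  and sets_circle_m [simp, measurable_cong]: "sets circle_m = sets borel"
  by (auto simp: circle_m_def)

interpretation circle: prob_space circle_m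
proof -
  have "prob_space (restrict_space lborel {0..1::real})"
    by (rule prob_spaceI) (simp add: emeasure_restrict_space space_restrict_space)
  then show "prob_space circle_m"
    unfolding circle_m_def by (rule prob_space.prob_space_distr) (auto intro!: measurable_restrict_space1)
qed

lemma AE_circle_norm: "AE z in circle_m. cmod z = 1"
  unfolding circle_m_def
  by (subst AE_distr_iff) (auto intro!: measurable_restrict_space1)

lemma powi_measurable_circle [measurable]: "(\<lambda>z::complex. z powi j) \<in> borel_measurable borel"
  unfolding power_int_def by measurable

lemma integral_circle_powi:
  assumes "j \<noteq> 0"
  shows "(\<integral>z. z powi j \<partial>circle_m) = 0"
proof -
  let ?c = "2 * pi * real_of_int j"
  have powi: "cis (2 * pi * t) powi j = cis (?c * t)" for t :: real
    by (simp add: cis_power_int mult_ac)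
  have "(\<integral>z. z powi j \<partial>circle_m) = (\<integral>t. cis (2 * pi * t) powi j \<partial>restrict_space lborel {0..1})"
    unfolding circle_m_def
    by (rule integral_distr) (auto intro!: measurable_restrict_space1)
  also have "\<dots> = (\<integral>t\<in>{0..1}. cis (?c * t) \<partial>lborel)"
    unfolding powi by (simp add: integral_restrict_space set_lebesgue_integral_def)
  also have "\<dots> = (\<integral>t. indicator {0..1} t *\<^sub>R cis (?c * t) \<partial>lborel)"
    by (simp add: set_lebesgue_integral_def)
  also have "\<dots> = cis (?c * 1) / (\<i> * ?c) - cis (?c * 0) / (\<i> * ?c)"
  proof (rule integral_FTC_Icc)
    fix x :: real
    define w where "w = \<i> * complex_of_real ?c"
    have "w \<noteq> 0"
      using assms by (simp add: w_def)
    then have "((\<lambda>t. exp (w * of_real t) / w) has_vector_derivative exp (w * of_real x)) (at x within {0..1})"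
      by (intro has_vector_derivative_real_field) (auto intro!: derivative_eq_intros)
    then show "((\<lambda>t. cis (?c * t) / (\<i> * ?c)) has_vector_derivative cis (?c * x)) (at x within {0..1})"
      by (simp add: cis_conv_exp w_def mult_ac)
  qed (auto intro!: continuous_intros)
  also have "cis (?c * 1) = 1"
    using cis_multiple_2pi[of "real_of_int j"] by simp
  finally show ?thesis by simp
qed

lemma AE_circle_nonzero: "AE z in circle_m. z \<noteq> 0"
  using AE_circle_norm by eventually_elim auto

lemma AE_circle_norm_powi: "AE z in circle_m. cmod (z powi j) = 1"
  using AE_circle_norm by eventually_elim (simp add: norm_power_int)

lemma L1_mult_bounded:
  assumes "L1 f" "g \<in> borel_measurable borel" "AE z in circle_m. cmod (g z) \<le> C"
  shows "L1 (\<lambda>z. f z * g z)"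
  unfolding L1_def
proof (rule Bochner_Integration.integrable_bound)
  show "integrable circle_m (\<lambda>z. C * f z)"
    using assms(1) unfolding L1_def by simp
  show "(\<lambda>z. f z * g z) \<in> borel_measurable circle_m"
    using assms(1,2) unfolding L1_def by (auto dest: borel_measurable_integrable)
  show "AE z in circle_m. cmod (f z * g z) \<le> cmod (C * f z)"
    using assms(3)
  proof eventually_elim
    case (elim z)
    then show ?case
      by (simp add: norm_mult mult.commute[of _ "cmod (f z)"] mult_left_mono)
  qed
qed

lemma L1_mult_powi: "L1 f \<Longrightarrow> L1 (\<lambda>z. f z * z powi j)"
  by (rule L1_mult_bounded[where C = 1]) (use AE_circle_norm_powi[of j] in auto)

lemma fourier_coeff_mult_powi:
  assumes "f \<in> borel_measurable borel"
  shows "fourier_coeff (\<lambda>z. f z * z powi m) j = fourier_coeff f (j - m)"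
  unfolding fourier_coeff_def
proof (rule integral_cong_AE)
  show "AE z in circle_m. f z * z powi m * z powi - j = f z * z powi - (j - m)"
    using AE_circle_nonzero
  proof eventually_elim
    case (elim z)
    then show ?case
      by (simp add: power_int_add[symmetric] mult.assoc)
  qed
qed (use assms in measurable)

lemma fourier_coeff_add:
  "L1 f \<Longrightarrow> L1 g \<Longrightarrow> fourier_coeff (\<lambda>z. f z + g z) j = fourier_coeff f j + fourier_coeff g j"
  using L1_mult_powi[of f "-j"] L1_mult_powi[of g "-j"]
  by (simp add: fourier_coeff_def L1_def distrib_right)

lemma fourier_coeff_cmult: "fourier_coeff (\<lambda>z. c * f z) j = c * fourier_coeff f j"
  by (simp add: fourier_coeff_def mult.assoc)

lemma fourier_coeff_diff:
  "L1 f \<Longrightarrow> L1 g \<Longrightarrow> fourier_coeff (\<lambda>z. f z - g z) j = fourier_coeff f j - fourier_coeff g j"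
  using L1_mult_powi[of f "-j"] L1_mult_powi[of g "-j"]
  by (simp add: fourier_coeff_def L1_def left_diff_distrib)

lemma L1_measurable: "L1 f \<Longrightarrow> f \<in> borel_measurable borel"
  unfolding L1_def by (auto dest: borel_measurable_integrable)

lemma fourier_coeff_cong_AE:
  assumes "f \<in> borel_measurable borel" "g \<in> borel_measurable borel" "AE z in circle_m. f z = g z"
  shows "fourier_coeff f j = fourier_coeff g j"
  unfolding fourier_coeff_def
proof (rule integral_cong_AE)
  show "AE z in circle_m. f z * z powi - j = g z * z powi - j"
    using assms(3) by eventually_elim simp
qed (use assms in measurable)

lemma fourier_coeff_const: "fourier_coeff (\<lambda>_. c) j = (if j = 0 then c else 0)"
  using integral_circle_powi[of "-j"] circle.prob_space by (simp add: fourier_coeff_def)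

text \<open>On the circle a real linear form is a combination of z and 1/z, and multiplication by a
  power of z only shifts the coefficients. Quantifying over \<open>f\<close> lets the product case
  apply the two hypotheses in succession, to \<open>f\<close> and then to \<open>f p\<close>; this
  is also why integrability is part of the claim.\<close>

lemma fourier_zero_mult_real_polynomial:
  assumes "real_polynomial_function p" "L1 f" "\<forall>j. fourier_coeff f j = 0"
  shows "L1 (\<lambda>z. f z * of_real (p z)) \<and> (\<forall>j. fourier_coeff (\<lambda>z. f z * of_real (p z)) j = 0)"
  using assms
proof (induction p arbitrary: f rule: real_polynomial_function.induct)
  case (linear p)
  \<comment> \<open>From p(x + iy) = x p(1) + y p(i) with x = (z + 1/z)/2 and y = (z - 1/z)/(2i) on
    the unit circle.\<close>
  define a b where "a = (of_real (p 1) - \<i> * of_real (p \<i>)) / 2" "b = (of_real (p 1) + \<i> * of_real (p \<i>)) / 2"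
  have eq: "of_real (p z) = a * z powi 1 + b * z powi (-1)" if "cmod z = 1" for z
  proof -
    have "z = Re z *\<^sub>R 1 + Im z *\<^sub>R \<i>"
      by (simp add: complex_eq_iff)
    then have "p z = p (Re z *\<^sub>R 1 + Im z *\<^sub>R \<i>)"
      by (rule arg_cong)
    also have "\<dots> = Re z * p 1 + Im z * p \<i>"
      using linear.hyps by (simp add: bounded_linear.linear linear_add linear_cmul)
    finally have p: "p z = Re z * p 1 + Im z * p \<i>" .
    have "z * cnj z = 1"
      using that by (simp add: complex_norm_square[symmetric])
    then have inv: "z powi (-1) = cnj z"
      by (metis inverse_unique power_int_minus power_int_1_right)
    show ?thesis
      unfolding p a_b_def inv power_int_1_right
      by (simp add: complex_eq_iff field_simps)
  qed
  have f [measurable]: "f \<in> borel_measurable borel"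
    using linear.prems(1) by (rule L1_measurable)
  have p [measurable]: "p \<in> borel_measurable borel"
    using linear.hyps by (intro borel_measurable_continuous_onI) (simp add: linear_continuous_on)
  let ?g = "\<lambda>z. a * (f z * z powi 1) + b * (f z * z powi (-1))"
  have gint: "L1 (\<lambda>z. a * (f z * z powi 1))" "L1 (\<lambda>z. b * (f z * z powi (-1)))"
    using L1_mult_powi[OF linear.prems(1), of 1] L1_mult_powi[OF linear.prems(1), of "-1"]
    by (auto simp: L1_def)
  have ae: "AE z in circle_m. ?g z = f z * of_real (p z)"
    using AE_circle_norm by eventually_elim (simp add: eq distrib_left mult_ac)
  have g0: "fourier_coeff ?g j = 0" for j
    using fourier_coeff_mult_powi[OF f, of 1 j] fourier_coeff_mult_powi[OF f, of "-1" j] linear.prems(2)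
    by (subst fourier_coeff_add[OF gint]) (simp only: fourier_coeff_cmult, simp)
  have "L1 (\<lambda>z. f z * of_real (p z))"
    unfolding L1_def
    by (rule integrable_cong_AE_imp[where g = ?g])
       (use gint ae in \<open>auto simp: L1_def\<close>)
  moreover have "fourier_coeff (\<lambda>z. f z * of_real (p z)) j = fourier_coeff ?g j" for j
    by (rule fourier_coeff_cong_AE[symmetric]) (use ae in auto)
  ultimately show ?case using g0 by simp
next
  case (const c)
  then show ?case
    using fourier_coeff_cmult[of "of_real c" f] by (simp add: L1_def mult.commute)
next
  case (add p q)
  have "L1 (\<lambda>z. f z * of_real (p z))" "L1 (\<lambda>z. f z * of_real (q z))"
    using add by blast+
  then show ?case
    using add.IH[OF add.prems] fourier_coeff_add[of "\<lambda>z. f z * of_real (p z)" "\<lambda>z. f z * of_real (q z)"]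
    by (simp add: distrib_left L1_def)
next
  case (mult p q)
  have "L1 (\<lambda>z. f z * of_real (p z)) \<and> (\<forall>j. fourier_coeff (\<lambda>z. f z * of_real (p z)) j = 0)"
    using mult by blast
  then have "L1 (\<lambda>z. f z * of_real (p z) * of_real (q z)) \<and>
      (\<forall>j. fourier_coeff (\<lambda>z. f z * of_real (p z) * of_real (q z)) j = 0)"
    using mult.IH(2) by blast
  then show ?case
    by (simp add: mult.assoc)
qed

lemma fourier_zero_integral_continuous:
  assumes f: "L1 f" "\<forall>j. fourier_coeff f j = 0"
    and g: "continuous_on UNIV g"
  shows "(\<integral>z. f z * of_real (g z :: real) \<partial>circle_m) = 0"
proof (rule ccontr)
  assume "\<not> ?thesis"
  define I where "I = cmod (\<integral>z. f z * of_real (g z) \<partial>circle_m)"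
  \<comment> \<open>The summand 1 keeps \<open>N\<close> positive for f = 0 and makes the closing
    estimate \<open>I / N * (N - 1) < I\<close> strict.\<close>
  define N where "N = (\<integral>z. cmod (f z) \<partial>circle_m) + 1"
  have N: "N > 0"
    unfolding N_def by (rule add_nonneg_pos) auto
  have "I > 0" using \<open>\<not> _\<close> by (simp add: I_def)
  obtain p where p: "real_polynomial_function p" "\<And>z. z \<in> sphere 0 1 \<Longrightarrow> \<bar>g z - p z\<bar> < I / N"
    using Stone_Weierstrass_real_polynomial_function[of "sphere (0::complex) 1" g "I / N"]
      continuous_on_subset[OF g] \<open>I > 0\<close> N by auto
  have ae: "AE z in circle_m. \<bar>g z - p z\<bar> \<le> I / N"
    using AE_circle_norm by eventually_elim (use p(2) in \<open>force simp: less_imp_le\<close>)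
  have pc: "continuous_on UNIV p"
    using p(1) by (simp add: continuous_on_polymonial_function real_polynomial_function_eq)
  have m [measurable]: "g \<in> borel_measurable borel" "p \<in> borel_measurable borel" "f \<in> borel_measurable borel"
    using g pc f L1_measurable by (auto intro: borel_measurable_continuous_onI)
  have fp: "L1 (\<lambda>z. f z * of_real (p z))" "(\<integral>z. f z * of_real (p z) \<partial>circle_m) = 0"
    using fourier_zero_mult_real_polynomial[OF p(1) f]
    by (auto dest: spec[of _ 0] simp: fourier_coeff_def)
  have fd: "L1 (\<lambda>z. f z * of_real (g z - p z))"
    by (rule L1_mult_bounded[OF f(1), where C = "I / N"]) (use ae in \<open>auto simp del: of_real_diff\<close>)
  have "(\<integral>z. f z * of_real (g z) \<partial>circle_m) =
      (\<integral>z. f z * of_real (g z - p z) + f z * of_real (p z) \<partial>circle_m)"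
    by (simp add: algebra_simps)
  also have "\<dots> = (\<integral>z. f z * of_real (g z - p z) \<partial>circle_m)"
    using fd fp by (subst Bochner_Integration.integral_add) (auto simp: L1_def)
  finally have "I \<le> (\<integral>z. cmod (f z * of_real (g z - p z)) \<partial>circle_m)"
    unfolding I_def by (simp add: integral_norm_bound)
  also have "\<dots> \<le> (\<integral>z. I / N * cmod (f z) \<partial>circle_m)"
  proof (rule integral_mono_AE)
    show "AE z in circle_m. cmod (f z * of_real (g z - p z)) \<le> I / N * cmod (f z)"
      using ae
    proof eventually_elim
      case (elim z)
      have "cmod (f z * of_real (g z - p z)) = \<bar>g z - p z\<bar> * cmod (f z)"
        by (simp add: norm_mult del: of_real_diff)
      then show ?case
        using mult_right_mono[OF elim, of "cmod (f z)"] by simp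
    qed
  qed (use fd f in \<open>auto simp: L1_def\<close>)
  also have "\<dots> = I / N * (N - 1)"
    by (simp add: N_def)
  also have "\<dots> < I"
    using \<open>I > 0\<close> N by (simp add: field_simps)
  finally show False by simp
qed

text \<open>The cut-offs \<open>g m\<close>, continuous and equal to 1 on \<open>K\<close>, decrease
  to the indicator of \<open>K\<close>; dominated convergence carries the continuous case
  over.\<close>

lemma fourier_zero_integral_closed:
  assumes f: "L1 f" "\<forall>j. fourier_coeff f j = 0" and K: "closed K"
  shows "(\<integral>z\<in>K. f z \<partial>circle_m) = 0"
\<comment> \<open>The distance to the empty set is 0 by convention, so the cut-offs would be
  constantly 1 there.\<close>
proof (cases "K = {}")
  case False
  define g where "g m z = max 0 (1 - real m * infdist z K)" for m and z :: complex
  have [measurable]: "f \<in> borel_measurable borel" "K \<in> sets borel"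
    using L1_measurable[OF f(1)] K by auto
  have gc: "continuous_on UNIV (g m)" for m
    unfolding g_def by (intro continuous_intros)
  then have [measurable]: "g m \<in> borel_measurable borel" for m
    by (auto intro: borel_measurable_continuous_onI)
  have "(\<lambda>m. \<integral>z. f z * of_real (g m z) \<partial>circle_m) \<longlonglongrightarrow> (\<integral>z. indicat_real K z *\<^sub>R f z \<partial>circle_m)"
  proof (rule integral_dominated_convergence[where w = "\<lambda>z. cmod (f z)"])
    show "AE z in circle_m. (\<lambda>m. f z * of_real (g m z)) \<longlonglongrightarrow> indicat_real K z *\<^sub>R f z"
    proof (rule AE_I2)
      fix z
      have "(\<lambda>m. g m z) \<longlonglongrightarrow> indicat_real K z"
      proof (cases "z \<in> K")
        case True
        then show ?thesis by (simp add: g_def)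
      next
        case False
        then have d: "infdist z K > 0"
          using K \<open>K \<noteq> {}\<close> by (metis in_closed_iff_infdist_zero infdist_nonneg order_le_less)
        have "eventually (\<lambda>m. real m \<ge> 1 / infdist z K) sequentially"
          using filterlim_real_sequentially by (auto simp: filterlim_at_top)
        then have "eventually (\<lambda>m. g m z = 0) sequentially"
          by eventually_elim (use d in \<open>auto simp: g_def field_simps\<close>)
        then show ?thesis
          using False by (simp add: tendsto_eventually)
      qed
      then show "(\<lambda>m. f z * of_real (g m z)) \<longlonglongrightarrow> indicat_real K z *\<^sub>R f z"
        by (subst scaleR_conv_of_real, subst mult.commute) (intro tendsto_intros)
    qed
    show "AE z in circle_m. cmod (f z * of_real (g m z)) \<le> cmod (f z)" for m
      by (rule AE_I2) (auto simp: norm_mult g_def infdist_nonneg intro!: mult_left_le)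
  qed (use f(1) in \<open>auto simp: L1_def\<close>)
  then show ?thesis
    using fourier_zero_integral_continuous[OF f gc]
    by (simp add: set_lebesgue_integral_def LIMSEQ_const_iff)
qed (simp add: set_lebesgue_integral_def)

text \<open>Closed sets are stable under intersection and generate the Borel sets, so the integral
  of \<open>f\<close> over every Borel set vanishes; this determines the real and imaginary parts
  a.e.\<close>

theorem fourier_uniqueness:
  assumes f: "L1 f" "\<forall>j. fourier_coeff f j = 0"
  shows "AE z in circle_m. f z = 0"
proof -
  have fi: "integrable circle_m f"
    using f(1) by (simp add: L1_def)
  then have si: "set_integrable circle_m A f" if "A \<in> sets borel" for A
    unfolding set_integrable_def using that by (intro integrable_mult_indicator) auto
  have all: "(\<integral>z\<in>A. f z \<partial>circle_m) = 0" if "A \<in> sets borel" for A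
  proof -
    have "Int_stable (Collect closed :: complex set set)" "Collect closed \<subseteq> Pow (UNIV :: complex set)"
      "A \<in> sigma_sets UNIV (Collect closed)"
      using that by (auto simp: borel_eq_closed Int_stable_def)
    then show ?thesis
    proof (induction rule: sigma_sets_induct_disjoint)
      case (compl A)
      then have A: "A \<in> sets borel" by (simp add: borel_eq_closed)
      have "(\<integral>z\<in>A \<union> (UNIV - A). f z \<partial>circle_m) = (\<integral>z\<in>A. f z \<partial>circle_m) + (\<integral>z\<in>UNIV - A. f z \<partial>circle_m)"
        using A by (intro set_integral_Un si) auto
      then show ?case
        using compl fourier_zero_integral_closed[OF f, of UNIV] by simp
    next
      case (union A)
      then have A: "A i \<in> sets borel" for i by (auto simp: borel_eq_closed)
      then have "(\<integral>z\<in>(\<Union>i. A i). f z \<partial>circle_m) = (\<Sum>i. \<integral>z\<in>A i. f z \<partial>circle_m)"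
        using union(1) by (intro lebesgue_integral_countable_add si) (auto simp: disjoint_family_on_def)
      then show ?case using union by simp
    qed (use fourier_zero_integral_closed[OF f] in \<open>auto simp: set_lebesgue_integral_def\<close>)
  qed
  have "AE z in circle_m. Re (f z) = 0"
  proof (rule density_unique_real)
    fix A assume "A \<in> sets circle_m"
    then have "Re (\<integral>z\<in>A. f z \<partial>circle_m) = 0" "set_integrable circle_m A f" using all si by auto
    then show "(\<integral>z\<in>A. Re (f z) \<partial>circle_m) = (\<integral>z\<in>A. 0 \<partial>circle_m)"
      by (simp add: set_lebesgue_integral_def set_integrable_def integral_Re[symmetric] del: integral_Re)
  qed (use fi in auto)
  moreover have "AE z in circle_m. Im (f z) = 0"
  proof (rule density_unique_real)
    fix A assume "A \<in> sets circle_m"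
    then have "Im (\<integral>z\<in>A. f z \<partial>circle_m) = 0" "set_integrable circle_m A f" using all si by auto
    then show "(\<integral>z\<in>A. Im (f z) \<partial>circle_m) = (\<integral>z\<in>A. 0 \<partial>circle_m)"
      by (simp add: set_lebesgue_integral_def set_integrable_def integral_Im[symmetric] del: integral_Im)
  qed (use fi in auto)
  ultimately show ?thesis
    by eventually_elim (simp add: complex_eq_iff)
qed

subsection \<open>Square integrable functions\<close>

lemma L2_measurable: "L2 f \<Longrightarrow> f \<in> borel_measurable borel"
  by (simp add: L2_def measurable_def)

lemma L2_square_integrable: "L2 f \<Longrightarrow> integrable circle_m (\<lambda>z. (cmod (f z))\<^sup>2)"
  by (simp add: L2_def)

lemma L2_bound:
  assumes "L2 g" "f \<in> borel_measurable borel" "AE z in circle_m. cmod (f z) \<le> C * cmod (g z)"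
  shows "L2 f"
  unfolding L2_def
proof
  show "integrable circle_m (\<lambda>z. (cmod (f z))\<^sup>2)"
  proof (rule Bochner_Integration.integrable_bound)
    show "integrable circle_m (\<lambda>z. C\<^sup>2 * (cmod (g z))\<^sup>2)"
      using L2_square_integrable[OF assms(1)] by simp
    show "AE z in circle_m. norm ((cmod (f z))\<^sup>2) \<le> norm (C\<^sup>2 * (cmod (g z))\<^sup>2)"
      using assms(3)
    proof eventually_elim
      case (elim z)
      then show ?case
        using power_mono[OF elim, of 2] by (simp add: power_mult_distrib)
    qed
  qed (use assms(2) in measurable)
qed (use assms(2) in measurable)

lemma L2_cmult: "L2 f \<Longrightarrow> L2 (\<lambda>z. c * f z)"
  by (rule L2_bound[where C = "cmod c"]) (auto simp: norm_mult dest: L2_measurable)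

lemma L2_mult_bounded:
  assumes "L2 f" "g \<in> borel_measurable borel" "AE z in circle_m. cmod (g z) \<le> C"
  shows "L2 (\<lambda>z. g z * f z)"
proof (rule L2_bound[OF assms(1)])
  show "AE z in circle_m. cmod (g z * f z) \<le> C * cmod (f z)"
    using assms(3) by eventually_elim (simp add: norm_mult mult_right_mono)
qed (use L2_measurable[OF assms(1)] assms(2) in measurable)

lemma L2_mult_powi: "L2 f \<Longrightarrow> L2 (\<lambda>z. f z * z powi m)"
  using L2_mult_bounded[of f "\<lambda>z. z powi m" 1] eventually_mono[OF AE_circle_norm_powi[of m], of "\<lambda>z. cmod (z powi m) \<le> 1"]
  by (auto simp: mult.commute)

lemma measurable_cnj [measurable]: "cnj \<in> borel_measurable borel"
  by (intro borel_measurable_continuous_onI continuous_intros)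

lemma L2_cnj: "L2 f \<Longrightarrow> L2 (\<lambda>z. cnj (f z))"
  by (rule L2_bound[where C = 1]) (auto dest!: L2_measurable)

lemma L2_add:
  assumes "L2 f" "L2 g"
  shows "L2 (\<lambda>z. f z + g z)"
  unfolding L2_def
proof
  note [measurable] = assms[THEN L2_measurable]
  show "integrable circle_m (\<lambda>z. (cmod (f z + g z))\<^sup>2)"
  proof (rule Bochner_Integration.integrable_bound)
    show "integrable circle_m (\<lambda>z. 2 * (cmod (f z))\<^sup>2 + 2 * (cmod (g z))\<^sup>2)"
      using assms[THEN L2_square_integrable] by simp
    show "AE z in circle_m. norm ((cmod (f z + g z))\<^sup>2) \<le> norm (2 * (cmod (f z))\<^sup>2 + 2 * (cmod (g z))\<^sup>2)"
    proof (rule AE_I2)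
      fix z
      have "(cmod (f z + g z))\<^sup>2 \<le> (cmod (f z) + cmod (g z))\<^sup>2"
        by (intro power_mono norm_triangle_ineq) auto
      also have "\<dots> \<le> 2 * (cmod (f z))\<^sup>2 + 2 * (cmod (g z))\<^sup>2"
        using sum_squares_bound[of "cmod (f z)" "cmod (g z)"] by (simp add: power2_sum)
      finally show "norm ((cmod (f z + g z))\<^sup>2) \<le> norm (2 * (cmod (f z))\<^sup>2 + 2 * (cmod (g z))\<^sup>2)"
        by simp
    qed
  qed measurable
qed (use assms[THEN L2_measurable] in measurable)

lemma L2_diff: "L2 f \<Longrightarrow> L2 g \<Longrightarrow> L2 (\<lambda>z. f z - g z)"
  using L2_add[of f "\<lambda>z. - 1 * g z"] L2_cmult[of g "-1"] by simp

lemma L2_const [simp]: "L2 (\<lambda>_. c)"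
  by (simp add: L2_def)

lemma L2_sum: "(\<And>i. i \<in> I \<Longrightarrow> L2 (f i)) \<Longrightarrow> L2 (\<lambda>z. \<Sum>i\<in>I. f i z)"
  by (induction I rule: infinite_finite_induct) (auto intro: L2_add)

lemma L1_mult_L2:
  assumes "L2 f" "L2 g"
  shows "L1 (\<lambda>z. f z * g z)"
  unfolding L1_def
proof (rule Bochner_Integration.integrable_bound)
  note [measurable] = assms[THEN L2_measurable]
  show "integrable circle_m (\<lambda>z. (cmod (f z))\<^sup>2 + (cmod (g z))\<^sup>2)"
    using assms[THEN L2_square_integrable] by simp
  show "AE z in circle_m. norm (f z * g z) \<le> norm ((cmod (f z))\<^sup>2 + (cmod (g z))\<^sup>2)"
  proof (rule AE_I2)
    fix z
    have "cmod (f z) * cmod (g z) \<ge> 0" by simp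
    then have "cmod (f z) * cmod (g z) \<le> (cmod (f z))\<^sup>2 + (cmod (g z))\<^sup>2"
      using sum_squares_bound[of "cmod (f z)" "cmod (g z)"] by linarith
    then show "norm (f z * g z) \<le> norm ((cmod (f z))\<^sup>2 + (cmod (g z))\<^sup>2)"
      by (simp add: norm_mult)
  qed
qed (use assms[THEN L2_measurable] in measurable)

lemma L2_imp_L1: "L2 f \<Longrightarrow> L1 f"
  using L1_mult_L2[of f "\<lambda>_. 1"] by simp

lemma Cauchy_Schwarz_integral:
  fixes f g :: "'a \<Rightarrow> real"
  assumes [measurable]: "f \<in> borel_measurable M" "g \<in> borel_measurable M"
    and f: "integrable M (\<lambda>x. (f x)\<^sup>2)" and g: "integrable M (\<lambda>x. (g x)\<^sup>2)"
  shows "(\<integral>x. \<bar>f x * g x\<bar> \<partial>M) \<le> sqrt (\<integral>x. (f x)\<^sup>2 \<partial>M) * sqrt (\<integral>x. (g x)\<^sup>2 \<partial>M)"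
proof -
  have "integrable M (\<lambda>x. \<bar>f x * g x\<bar>)"
  proof (rule Bochner_Integration.integrable_bound)
    show "integrable M (\<lambda>x. (f x)\<^sup>2 + (g x)\<^sup>2)" using f g by simp
    show "AE x in M. norm \<bar>f x * g x\<bar> \<le> norm ((f x)\<^sup>2 + (g x)\<^sup>2)"
    proof (rule AE_I2)
      fix x
      have "\<bar>f x\<bar> * \<bar>g x\<bar> \<ge> 0" by simp
      then have "\<bar>f x\<bar> * \<bar>g x\<bar> \<le> \<bar>f x\<bar>\<^sup>2 + \<bar>g x\<bar>\<^sup>2"
        using sum_squares_bound[of "\<bar>f x\<bar>" "\<bar>g x\<bar>"] by linarith
      then show "norm \<bar>f x * g x\<bar> \<le> norm ((f x)\<^sup>2 + (g x)\<^sup>2)"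
        by (simp add: abs_mult)
    qed
  qed measurable
  then have "ennreal ((\<integral>x. \<bar>f x * g x\<bar> \<partial>M)\<^sup>2) = (\<integral>\<^sup>+x. ennreal \<bar>f x\<bar> * ennreal \<bar>g x\<bar> \<partial>M)\<^sup>2"
    by (simp add: nn_integral_eq_integral ennreal_mult[symmetric] abs_mult ennreal_power)
  also have "\<dots> \<le> (\<integral>\<^sup>+x. (ennreal \<bar>f x\<bar>)\<^sup>2 \<partial>M) * (\<integral>\<^sup>+x. (ennreal \<bar>g x\<bar>)\<^sup>2 \<partial>M)"
    by (rule Cauchy_Schwarz_nn_integral) measurable
  also have "\<dots> = ennreal ((\<integral>x. (f x)\<^sup>2 \<partial>M) * (\<integral>x. (g x)\<^sup>2 \<partial>M))"
    using f g by (simp add: ennreal_power nn_integral_eq_integral ennreal_mult)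
  finally have "(\<integral>x. \<bar>f x * g x\<bar> \<partial>M)\<^sup>2 \<le> (\<integral>x. (f x)\<^sup>2 \<partial>M) * (\<integral>x. (g x)\<^sup>2 \<partial>M)"
    by (simp add: mult_nonneg_nonneg)
  then show ?thesis
    by (metis real_le_rsqrt real_sqrt_mult)
qed

subsection \<open>Orthogonal projections in \<open>L\<^sup>2(\<complex>\<^sup>n)\<close>\<close>

definition L2v :: "nat \<Rightarrow> (nat \<Rightarrow> complex \<Rightarrow> complex) \<Rightarrow> bool" where
  "L2v n f \<longleftrightarrow> (\<forall>i<n. L2 (f i))"

definition inner_L2v :: "nat \<Rightarrow> (nat \<Rightarrow> complex \<Rightarrow> complex) \<Rightarrow> (nat \<Rightarrow> complex \<Rightarrow> complex) \<Rightarrow> complex" where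
  "inner_L2v n f g = (\<integral>z. (\<Sum>i<n. f i z * cnj (g i z)) \<partial>circle_m)"

definition normsq_L2v :: "nat \<Rightarrow> (nat \<Rightarrow> complex \<Rightarrow> complex) \<Rightarrow> real" where
  "normsq_L2v n f = (\<integral>z. (\<Sum>i<n. (cmod (f i z))\<^sup>2) \<partial>circle_m)"

text \<open>The closure clause only concerns sequences converging both a.e. and in norm. This is
  easier to verify for pointwise conditions, and it suffices because the minimizing sequences below
  are fast enough to converge in both senses. Elements are functions, not classes; closure under
  a.e. equality follows from constant sequences.\<close>

definition closed_subspace :: "nat \<Rightarrow> (nat \<Rightarrow> complex \<Rightarrow> complex) set \<Rightarrow> bool" where
  "closed_subspace n K \<longleftrightarrow>
     (\<forall>f\<in>K. L2v n f) \<and> (\<lambda>_ _. 0) \<in> K \<and>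
     (\<forall>f\<in>K. \<forall>g\<in>K. \<forall>c. (\<lambda>i z. f i z + c * g i z) \<in> K) \<and>
     (\<forall>p f. (\<forall>m. p m \<in> K) \<longrightarrow> L2v n f \<longrightarrow>
        (AE z in circle_m. \<forall>i<n. (\<lambda>m. p m i z) \<longlonglongrightarrow> f i z) \<longrightarrow>
        (\<lambda>m. normsq_L2v n (\<lambda>i z. p m i z - f i z)) \<longlonglongrightarrow> 0 \<longrightarrow> f \<in> K)"

lemma L2v_add_cmult: "L2v n f \<Longrightarrow> L2v n g \<Longrightarrow> L2v n (\<lambda>i z. f i z + c * g i z)"
  by (simp add: L2v_def L2_add L2_cmult)

lemma L2v_diff: "L2v n f \<Longrightarrow> L2v n g \<Longrightarrow> L2v n (\<lambda>i z. f i z - g i z)"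
  by (simp add: L2v_def L2_diff)

lemma integrable_normsq_L2v: "L2v n f \<Longrightarrow> integrable circle_m (\<lambda>z. \<Sum>i<n. (cmod (f i z))\<^sup>2)"
  by (auto simp: L2v_def intro!: Bochner_Integration.integrable_sum L2_square_integrable)

lemma integrable_inner_L2v:
  assumes "L2v n f" "L2v n g"
  shows "integrable circle_m (\<lambda>z. \<Sum>i<n. f i z * cnj (g i z))"
  using assms L1_mult_L2[OF _ L2_cnj]
  by (auto simp: L2v_def L1_def intro!: Bochner_Integration.integrable_sum)

lemma normsq_L2v_nonneg: "0 \<le> normsq_L2v n f"
  unfolding normsq_L2v_def by (rule Bochner_Integration.integral_nonneg) (simp add: sum_nonneg)

lemma norm_add_cmult_sq:
  "(cmod (a + c * b))\<^sup>2 = (cmod a)\<^sup>2 + 2 * Re (cnj c * (a * cnj b)) + (cmod c)\<^sup>2 * (cmod b)\<^sup>2"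
proof -
  have "complex_of_real ((cmod (a + c * b))\<^sup>2) =
      complex_of_real ((cmod a)\<^sup>2 + 2 * Re (cnj c * (a * cnj b)) + (cmod c)\<^sup>2 * (cmod b)\<^sup>2)"
    unfolding of_real_add of_real_mult complex_norm_square
    using complex_add_cnj[of "cnj c * (a * cnj b)"] by (simp add: algebra_simps)
  then show ?thesis by (simp only: of_real_eq_iff)
qed

lemma normsq_L2v_add_cmult:
  assumes "L2v n f" "L2v n g"
  shows "normsq_L2v n (\<lambda>i z. f i z + c * g i z) =
    normsq_L2v n f + 2 * Re (cnj c * inner_L2v n f g) + (cmod c)\<^sup>2 * normsq_L2v n g"
proof -
  note int = integrable_normsq_L2v[OF assms(1)] integrable_normsq_L2v[OF assms(2)] integrable_inner_L2v[OF assms]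
  have "normsq_L2v n (\<lambda>i z. f i z + c * g i z) =
      (\<integral>z. (\<Sum>i<n. (cmod (f i z))\<^sup>2) + 2 * Re (cnj c * (\<Sum>i<n. f i z * cnj (g i z)))
         + (cmod c)\<^sup>2 * (\<Sum>i<n. (cmod (g i z))\<^sup>2) \<partial>circle_m)"
    unfolding normsq_L2v_def norm_add_cmult_sq sum.distrib sum_distrib_left Re_sum ..
  also have "\<dots> = (\<integral>z. (\<Sum>i<n. (cmod (f i z))\<^sup>2) \<partial>circle_m)
      + 2 * (\<integral>z. Re (cnj c * (\<Sum>i<n. f i z * cnj (g i z))) \<partial>circle_m)
      + (cmod c)\<^sup>2 * (\<integral>z. (\<Sum>i<n. (cmod (g i z))\<^sup>2) \<partial>circle_m)"
    using int by (subst Bochner_Integration.integral_add Bochner_Integration.integrable_add;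
        auto intro!: integrable_Re Bochner_Integration.integrable_add simp del: times_complex.sel)+
  also have "(\<integral>z. Re (cnj c * (\<Sum>i<n. f i z * cnj (g i z))) \<partial>circle_m) = Re (cnj c * inner_L2v n f g)"
    unfolding inner_L2v_def using int(3) by (subst integral_Re) auto
  finally show ?thesis by (simp add: normsq_L2v_def)
qed

lemma normsq_L2v_parallelogram:
  assumes "L2v n f" "L2v n g"
  shows "normsq_L2v n (\<lambda>i z. f i z + g i z) + normsq_L2v n (\<lambda>i z. f i z - g i z) =
    2 * normsq_L2v n f + 2 * normsq_L2v n g"
  using normsq_L2v_add_cmult[OF assms, of 1] normsq_L2v_add_cmult[OF assms, of "-1"] by simp

lemma normsq_L2v_cmult: "normsq_L2v n (\<lambda>i z. c * f i z) = (cmod c)\<^sup>2 * normsq_L2v n f"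
  by (simp add: normsq_L2v_def norm_mult power_mult_distrib sum_distrib_left[symmetric])

lemma normsq_L2v_coord:
  assumes "L2v n f" "i < n"
  shows "(\<integral>z. (cmod (f i z))\<^sup>2 \<partial>circle_m) \<le> normsq_L2v n f"
  unfolding normsq_L2v_def
proof (rule integral_mono)
  show "(cmod (f i z))\<^sup>2 \<le> (\<Sum>i<n. (cmod (f i z))\<^sup>2)" for z
    using assms(2) by (intro member_le_sum) auto
qed (use assms integrable_normsq_L2v L2_square_integrable in \<open>auto simp: L2v_def\<close>)

text \<open>Stands in for completeness of L^2: the limit \<open>f\<close> is known only pointwise,
  and Fatou's lemma supplies both its square integrability and its norm bound.\<close>

lemma L2v_Fatou:
  assumes g: "\<And>m. L2v n (g m)" and f: "\<And>i. i < n \<Longrightarrow> f i \<in> borel_measurable borel"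
    and lim: "AE z in circle_m. \<forall>i<n. (\<lambda>m. g m i z) \<longlonglongrightarrow> f i z"
    and bound: "\<forall>\<^sub>F m in sequentially. normsq_L2v n (g m) \<le> B"
  shows "L2v n f \<and> normsq_L2v n f \<le> B"
proof -
  have gm [measurable]: "g m i \<in> borel_measurable borel" if "i < n" for m i
    using g that by (auto simp: L2v_def dest: L2_measurable)
  note f[measurable]
  have "B \<ge> 0"
    using eventually_happens[OF bound] by (auto intro: order_trans[OF normsq_L2v_nonneg])
  have "(\<integral>\<^sup>+z. ennreal (\<Sum>i<n. (cmod (f i z))\<^sup>2) \<partial>circle_m) =
      (\<integral>\<^sup>+z. liminf (\<lambda>m. ennreal (\<Sum>i<n. (cmod (g m i z))\<^sup>2)) \<partial>circle_m)"
  proof (rule nn_integral_cong_AE)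
    show "AE z in circle_m. ennreal (\<Sum>i<n. (cmod (f i z))\<^sup>2) =
        liminf (\<lambda>m. ennreal (\<Sum>i<n. (cmod (g m i z))\<^sup>2))"
      using lim
    proof eventually_elim
      case (elim z)
      have "(\<lambda>m. ennreal (\<Sum>i<n. (cmod (g m i z))\<^sup>2)) \<longlonglongrightarrow> ennreal (\<Sum>i<n. (cmod (f i z))\<^sup>2)"
        using elim by (intro tendsto_intros) auto
      then show ?case
        by (intro lim_imp_Liminf[symmetric]) auto
    qed
  qed
  also have "\<dots> \<le> liminf (\<lambda>m. \<integral>\<^sup>+z. ennreal (\<Sum>i<n. (cmod (g m i z))\<^sup>2) \<partial>circle_m)"
    by (rule nn_integral_liminf) measurable
  also have "\<dots> = liminf (\<lambda>m. ennreal (normsq_L2v n (g m)))"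
    using integrable_normsq_L2v[OF g]
    by (simp add: nn_integral_eq_integral normsq_L2v_def sum_nonneg)
  also have "\<dots> \<le> liminf (\<lambda>m. ennreal B)"
    by (rule Liminf_mono) (use bound in \<open>auto elim!: eventually_mono intro: ennreal_leI\<close>)
  finally have le: "(\<integral>\<^sup>+z. ennreal (\<Sum>i<n. (cmod (f i z))\<^sup>2) \<partial>circle_m) \<le> ennreal B"
    by (simp add: Liminf_const)
  have int: "integrable circle_m (\<lambda>z. \<Sum>i<n. (cmod (f i z))\<^sup>2)"
    by (rule integrableI_nonneg) (use le in \<open>auto simp: sum_nonneg le_less_trans\<close>)
  have "L2 (f i)" if "i < n" for i
    unfolding L2_def
  proof
    show "integrable circle_m (\<lambda>z. (cmod (f i z))\<^sup>2)"
    proof (rule Bochner_Integration.integrable_bound[OF int])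
      show "AE z in circle_m. norm ((cmod (f i z))\<^sup>2) \<le> norm (\<Sum>i<n. (cmod (f i z))\<^sup>2)"
        using that by (intro AE_I2) (auto simp: sum_nonneg intro!: member_le_sum)
    qed (use that in measurable)
  qed (use that in measurable)
  moreover have "normsq_L2v n f \<le> B"
    using le int \<open>B \<ge> 0\<close>
    by (simp add: nn_integral_eq_integral normsq_L2v_def sum_nonneg)
  ultimately show ?thesis by (simp add: L2v_def)
qed

text \<open>On a probability space the L^1 norm of an increment is at most its L^2 norm, here
  \<open>sqrt C / 2^m\<close>. The sum of the increments thus has finite integral, and the
  telescoping series converges absolutely a.e.\<close>

lemma AE_convergent_fast_Cauchy:
  assumes p: "\<And>m. L2 (p m)"
    and fast: "\<And>m. (\<integral>z. (cmod (p (Suc m) z - p m z))\<^sup>2 \<partial>circle_m) \<le> C / 4 ^ m"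
  shows "AE z in circle_m. convergent (\<lambda>m. p m z)"
proof -
  have [measurable]: "p m \<in> borel_measurable borel" for m
    using L2_measurable[OF p] .
  have dL2: "L2 (\<lambda>z. p (Suc m) z - p m z)" for m
    by (intro L2_diff p)
  have int: "integrable circle_m (\<lambda>z. cmod (p (Suc m) z - p m z))" for m
    using L2_imp_L1[OF dL2[of m]] by (simp add: L1_def)
  have le: "(\<integral>z. cmod (p (Suc m) z - p m z) \<partial>circle_m) \<le> sqrt C * (1/2) ^ m" for m
  proof -
    have "(\<integral>z. \<bar>cmod (p (Suc m) z - p m z) * 1\<bar> \<partial>circle_m) \<le>
        sqrt (\<integral>z. (cmod (p (Suc m) z - p m z))\<^sup>2 \<partial>circle_m) * sqrt (\<integral>z. 1\<^sup>2 \<partial>circle_m)"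
      by (rule Cauchy_Schwarz_integral) (use L2_square_integrable[OF dL2[of m]] in auto)
    also have "\<dots> \<le> sqrt (C / 4 ^ m)"
      using fast[of m] circle.prob_space by simp
    also have "\<dots> = sqrt C * (1/2) ^ m"
      by (simp add: real_sqrt_divide real_sqrt_power power_divide)
    finally show ?thesis by simp
  qed
  have "AE z in circle_m. summable (\<lambda>m. cmod (p (Suc m) z - p m z))"
  proof -
    have "(\<integral>\<^sup>+z. (\<Sum>m. ennreal (cmod (p (Suc m) z - p m z))) \<partial>circle_m) =
        (\<Sum>m. \<integral>\<^sup>+z. ennreal (cmod (p (Suc m) z - p m z)) \<partial>circle_m)"
      by (rule nn_integral_suminf) measurable
    also have "\<dots> \<le> (\<Sum>m. ennreal (sqrt C * (1/2) ^ m))"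
      by (rule suminf_le) (use int le in \<open>auto simp: nn_integral_eq_integral intro!: ennreal_leI\<close>)
    also have "\<dots> < \<infinity>"
    proof -
      have "0 \<le> sqrt C"
        using order_trans[OF Bochner_Integration.integral_nonneg le[of 0]] by simp
      then show ?thesis
        by (subst suminf_ennreal2) (auto intro!: summable_mult summable_geometric)
    qed
    finally have "AE z in circle_m. (\<Sum>m. ennreal (cmod (p (Suc m) z - p m z))) \<noteq> \<infinity>"
      by (intro nn_integral_noteq_infinite) auto
    then show ?thesis
      by eventually_elim (auto intro: summable_suminf_not_top)
  qed
  then show ?thesis
  proof eventually_elim
    case (elim z)
    then have "summable (\<lambda>m. p (Suc m) z - p m z)"
      by (rule summable_norm_cancel)
    then have "convergent (\<lambda>k. \<Sum>m<k. p (Suc m) z - p m z)"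
      by (simp add: summable_iff_convergent)
    then have "convergent (\<lambda>k. p k z - p 0 z)"
      by (simp only: sum_lessThan_telescope[of "\<lambda>m. p m z"])
    then have "convergent (\<lambda>k. (p k z - p 0 z) + p 0 z)"
      by (rule convergent_add[OF _ convergent_const])
    then show ?case by simp
  qed
qed

text \<open>The parallelogram identity makes a minimizing sequence Cauchy. Its prescribed rate gives
  a.e. convergence without passing to subsequences; Fatou then shows that the pointwise limit is
  also the norm limit and a minimizer.\<close>

theorem closed_subspace_projection:
  assumes K: "closed_subspace n K" and f: "L2v n f"
  obtains p where "p \<in> K" "\<And>w. w \<in> K \<Longrightarrow> inner_L2v n (\<lambda>i z. f i z - p i z) w = 0"
proof -
  have KL2: "L2v n g" if "g \<in> K" for g
    using K that by (auto simp: closed_subspace_def)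
  have K0: "(\<lambda>_ _. 0) \<in> K"
    using K by (auto simp: closed_subspace_def)
  have Kadd: "(\<lambda>i z. g i z + c * h i z) \<in> K" if "g \<in> K" "h \<in> K" for g h c
    using K that by (auto simp: closed_subspace_def)
  define D where "D g = normsq_L2v n (\<lambda>i z. f i z - g i z)" for g
  define d where "d = Inf (D ` K)"
  have bdd: "bdd_below (D ` K)"
    by (rule bdd_belowI[of _ 0]) (auto simp: D_def normsq_L2v_nonneg)
  have dle: "d \<le> D g" if "g \<in> K" for g
    unfolding d_def using bdd that by (intro cInf_lower) auto
  \<comment> \<open>Excess 4^-m gives increments of norm of order 2^-m, which is summable.\<close>
  have "\<exists>g\<in>K. D g < d + 1 / 4 ^ m" for m :: nat
  proof -
    have "Inf (D ` K) < d + 1 / 4 ^ m" by (simp add: d_def)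
    then show ?thesis
      using K0 bdd by (subst (asm) cInf_less_iff) auto
  qed
  then obtain q where q: "\<And>m. q m \<in> K" "\<And>m. D (q m) < d + 1 / 4 ^ m"
    by metis
  note qL2 = KL2[OF q(1)]
  have cauchy: "normsq_L2v n (\<lambda>i z. q m i z - q l i z) \<le> 4 / 4 ^ m" if "m \<le> l" for m l
  proof -
    let ?mid = "\<lambda>i z. (1/2) * q m i z + (1/2) * q l i z"
    have "(\<lambda>i z. 0 + (1/2) * q m i z) \<in> K"
      by (rule Kadd[OF K0 q(1)])
    then have mid: "?mid \<in> K"
      using Kadd[of "\<lambda>i z. (1/2) * q m i z" "q l" "1/2"] q(1) by simp
    have "normsq_L2v n (\<lambda>i z. (f i z - q l i z) + (f i z - q m i z)) +
        normsq_L2v n (\<lambda>i z. (f i z - q l i z) - (f i z - q m i z)) = 2 * D (q l) + 2 * D (q m)"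
      unfolding D_def by (intro normsq_L2v_parallelogram L2v_diff f qL2)
    moreover have "normsq_L2v n (\<lambda>i z. (f i z - q l i z) + (f i z - q m i z)) = 4 * D ?mid"
      using normsq_L2v_cmult[of n 2 "\<lambda>i z. f i z - ?mid i z"]
      by (simp add: D_def algebra_simps)
    moreover have "(\<lambda>i z. (f i z - q l i z) - (f i z - q m i z)) = (\<lambda>i z. q m i z - q l i z)"
      by auto
    ultimately have "normsq_L2v n (\<lambda>i z. q m i z - q l i z) \<le> 2 / 4 ^ l + 2 / 4 ^ m"
      using q(2)[of l] q(2)[of m] dle[OF mid] by simp
    also have "2 / 4 ^ l \<le> (2 / 4 ^ m :: real)"
      using that by (intro divide_left_mono power_increasing) auto
    finally show ?thesis by simp
  qed
  \<comment> \<open>\<open>lim\<close> takes an arbitrary value where the sequence diverges; that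
    set turns out to be null.\<close>
  define p where "p i z = lim (\<lambda>m. q m i z)" for i z
  have qm [measurable]: "q m i \<in> borel_measurable borel" if "i < n" for m i
    using qL2 that by (auto simp: L2v_def dest: L2_measurable)
  have pm: "p i \<in> borel_measurable borel" if "i < n" for i
    unfolding p_def using that by (intro borel_measurable_lim_metric) auto
  have "AE z in circle_m. \<forall>i\<in>{..<n}. (\<lambda>m. q m i z) \<longlonglongrightarrow> p i z"
  proof (rule AE_finite_allI)
    fix i assume "i \<in> {..<n}"
    then have i: "i < n" by simp
    have "AE z in circle_m. convergent (\<lambda>m. q m i z)"
    proof (rule AE_convergent_fast_Cauchy[where C = 4])
      show "L2 (q m i)" for m
        using qL2 i by (auto simp: L2v_def)
      show "(\<integral>z. (cmod (q (Suc m) i z - q m i z))\<^sup>2 \<partial>circle_m) \<le> 4 / 4 ^ m" for m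
        using order_trans[OF normsq_L2v_coord[OF L2v_diff[OF qL2[of m] qL2[of "Suc m"]] i] cauchy[of m "Suc m"]]
        by (simp add: norm_minus_commute)
    qed
    then show "AE z in circle_m. (\<lambda>m. q m i z) \<longlonglongrightarrow> p i z"
      by eventually_elim (simp add: p_def convergent_LIMSEQ_iff)
  qed simp
  then have lim: "AE z in circle_m. \<forall>i<n. (\<lambda>m. q m i z) \<longlonglongrightarrow> p i z"
    by eventually_elim auto
  \<comment> \<open>Fix m and let the second index of the Cauchy estimate tend to infinity.\<close>
  have near: "L2v n (\<lambda>i z. q m i z - p i z) \<and> normsq_L2v n (\<lambda>i z. q m i z - p i z) \<le> 4 / 4 ^ m" for m
  proof (rule L2v_Fatou[where g = "\<lambda>l i z. q m i z - q l i z"])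
    show "AE z in circle_m. \<forall>i<n. (\<lambda>l. q m i z - q l i z) \<longlonglongrightarrow> q m i z - p i z"
      using lim by eventually_elim (auto intro!: tendsto_intros)
    show "\<forall>\<^sub>F l in sequentially. normsq_L2v n (\<lambda>i z. q m i z - q l i z) \<le> 4 / 4 ^ m"
      using eventually_ge_at_top[of m] by eventually_elim (rule cauchy)
  qed (use pm qm in \<open>auto intro: L2v_diff qL2\<close>)
  have pL2: "L2v n p"
    using L2v_diff[OF qL2[of 0] conjunct1[OF near[of 0]]] by simp
  have "(\<lambda>m. 4 / 4 ^ m :: real) \<longlonglongrightarrow> 0"
    using LIMSEQ_power_zero[of "1/4::real"] by (auto simp: power_divide intro: tendsto_eq_intros dest: tendsto_mult_left[of _ _ _ 4])
  then have "(\<lambda>m. normsq_L2v n (\<lambda>i z. q m i z - p i z)) \<longlonglongrightarrow> 0"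
    by (rule tendsto_sandwich[OF _ _ tendsto_const, rotated 2]) (use near normsq_L2v_nonneg in auto)
  then have pK: "p \<in> K"
    using K q(1) pL2 lim unfolding closed_subspace_def by blast
  have "D p \<le> d + 1 / 4 ^ k" for k :: nat
  proof -
    have "L2v n (\<lambda>i z. f i z - p i z) \<and> normsq_L2v n (\<lambda>i z. f i z - p i z) \<le> d + 1 / 4 ^ k"
    proof (rule L2v_Fatou[where g = "\<lambda>l i z. f i z - q l i z"])
      show "AE z in circle_m. \<forall>i<n. (\<lambda>l. f i z - q l i z) \<longlonglongrightarrow> f i z - p i z"
        using lim by eventually_elim (auto intro!: tendsto_intros)
      have "normsq_L2v n (\<lambda>i z. f i z - q l i z) \<le> d + 1 / 4 ^ k" if "k \<le> l" for l
      proof -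
        have "1 / 4 ^ l \<le> (1 / 4 ^ k :: real)"
          using that by (intro divide_left_mono power_increasing) auto
        then show ?thesis
          using q(2)[of l] by (simp add: D_def)
      qed
      then show "\<forall>\<^sub>F l in sequentially. normsq_L2v n (\<lambda>i z. f i z - q l i z) \<le> d + 1 / 4 ^ k"
        by (rule eventually_sequentiallyI)
      show "(\<lambda>z. f i z - p i z) \<in> borel_measurable borel" if "i < n" for i
        using L2v_diff[OF f pL2] that by (auto simp: L2v_def intro: L2_measurable)
    qed (intro L2v_diff f qL2)
    then show ?thesis by (simp add: D_def)
  qed
  moreover have "(\<lambda>k. d + 1 / 4 ^ k) \<longlonglongrightarrow> d + 0"
    using LIMSEQ_power_zero[of "1/4::real"] by (intro tendsto_intros) (auto simp: power_divide)
  ultimately have "D p \<le> d + 0"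
    by (intro LIMSEQ_le_const) auto
  then have min: "D p \<le> D g" if "g \<in> K" for g
    using dle[OF that] by simp
  have "inner_L2v n (\<lambda>i z. f i z - p i z) w = 0" if w: "w \<in> K" for w
  proof -
    define a where "a = inner_L2v n (\<lambda>i z. f i z - p i z) w"
    define W where "W = normsq_L2v n w"
    \<comment> \<open>The optimal coefficient would be \<open>- a / W\<close>; with
      \<open>W + 1\<close> the case of a vanishing \<open>w\<close> needs no separate
      treatment.\<close>
    define c where "c = - a / of_real (W + 1)"
    have W: "W \<ge> 0" by (simp add: W_def normsq_L2v_nonneg)
    have "(\<lambda>i z. p i z + (- c) * w i z) \<in> K"
      by (rule Kadd[OF pK w])
    from min[OF this] have "D p \<le> normsq_L2v n (\<lambda>i z. (f i z - p i z) + c * w i z)"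
      by (simp add: D_def algebra_simps)
    also have "\<dots> = D p + 2 * Re (cnj c * a) + (cmod c)\<^sup>2 * W"
      unfolding a_def W_def D_def by (rule normsq_L2v_add_cmult[OF L2v_diff[OF f pL2] KL2[OF w]])
    finally have "0 \<le> 2 * Re (cnj c * a) + (cmod c)\<^sup>2 * W" by simp
    also have "cnj c * a = - of_real ((cmod a)\<^sup>2 / (W + 1))"
      unfolding of_real_divide complex_norm_square by (simp add: c_def)
    also have "(cmod c)\<^sup>2 = (cmod a)\<^sup>2 / (W + 1)\<^sup>2"
      using W by (simp add: c_def norm_divide power_divide del: of_real_add)
    finally have "2 * ((cmod a)\<^sup>2 / (W + 1)) \<le> (cmod a)\<^sup>2 / (W + 1)\<^sup>2 * W"
      by simp
    then have "2 * (cmod a)\<^sup>2 * (W + 1) \<le> (cmod a)\<^sup>2 * W"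
      using W by (simp add: divide_simps power2_eq_square split: if_splits) (simp add: algebra_simps)?
    then have "(cmod a)\<^sup>2 * (W + 2) \<le> 0"
      by (simp add: algebra_simps)
    then have "(cmod a)\<^sup>2 \<le> 0"
      using W by (simp add: mult_le_0_iff)
    then show ?thesis by (simp add: a_def)
  qed
  then show ?thesis using that pK by blast
qed

subsection \<open>Products of functions in \<open>H\<^sup>2\<close>\<close>

lemma integral_mult_tendsto_L2:
  assumes p: "\<And>m. L2 (p m)" and f: "L2 f" and g: "L2 g"
    and lim: "(\<lambda>m. \<integral>z. (cmod (p m z - f z))\<^sup>2 \<partial>circle_m) \<longlonglongrightarrow> 0"
  shows "(\<lambda>m. \<integral>z. p m z * g z \<partial>circle_m) \<longlonglongrightarrow> (\<integral>z. f z * g z \<partial>circle_m)"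
proof (rule LIM_zero_cancel, rule tendsto_norm_zero_cancel)
  let ?B = "\<lambda>m. sqrt (\<integral>z. (cmod (p m z - f z))\<^sup>2 \<partial>circle_m) * sqrt (\<integral>z. (cmod (g z))\<^sup>2 \<partial>circle_m)"
  have B: "?B \<longlonglongrightarrow> 0"
    using tendsto_mult_right[OF tendsto_real_sqrt[OF lim]] by simp
  have le: "cmod ((\<integral>z. p m z * g z \<partial>circle_m) - (\<integral>z. f z * g z \<partial>circle_m)) \<le> ?B m" for m
  proof -
    note [measurable] = L2_measurable[OF p] L2_measurable[OF f] L2_measurable[OF g]
    have "(\<integral>z. p m z * g z \<partial>circle_m) - (\<integral>z. f z * g z \<partial>circle_m) =
        (\<integral>z. (p m z - f z) * g z \<partial>circle_m)"
      using L1_mult_L2[OF p g, of m] L1_mult_L2[OF f g] by (simp add: L1_def left_diff_distrib)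
    then have "cmod ((\<integral>z. p m z * g z \<partial>circle_m) - (\<integral>z. f z * g z \<partial>circle_m)) \<le>
        (\<integral>z. cmod ((p m z - f z) * g z) \<partial>circle_m)"
      by (simp add: integral_norm_bound)
    also have "\<dots> = (\<integral>z. \<bar>cmod (p m z - f z) * cmod (g z)\<bar> \<partial>circle_m)"
      by (simp add: norm_mult)
    also have "\<dots> \<le> ?B m"
      using L2_square_integrable[OF L2_diff[OF p f]] L2_square_integrable[OF g]
      by (intro Cauchy_Schwarz_integral) auto
    finally show ?thesis .
  qed
  show "(\<lambda>m. cmod ((\<integral>z. p m z * g z \<partial>circle_m) - (\<integral>z. f z * g z \<partial>circle_m))) \<longlonglongrightarrow> 0"
    by (rule tendsto_sandwich[OF _ _ tendsto_const B]) (use le in auto)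
qed

lemma L2_powi: "L2 (\<lambda>z. z powi j)"
  using L2_mult_powi[of "\<lambda>_. 1" j] by simp

lemma fourier_coeff_powi: "fourier_coeff (\<lambda>z. z powi m) j = (if j = m then 1 else 0)"
  using fourier_coeff_mult_powi[of "\<lambda>_. 1" m j] by (simp add: fourier_coeff_const)

lemma cnj_powi:
  assumes "cmod (z powi m) = 1"
  shows "cnj (z powi m) = z powi - m"
proof -
  have "z powi m * cnj (z powi m) = 1"
    unfolding complex_norm_square[symmetric] assms by simp
  then show ?thesis
    by (metis inverse_unique power_int_minus)
qed

lemma H2_L2: "H2 f \<Longrightarrow> L2 f"
  by (simp add: H2_def)

text \<open>The projection \<open>p\<close> of \<open>f\<close> onto the annihilator of \<open>H\<^sup>2\<^sub>0\<close> is again in \<open>H\<^sup>2\<close>, and \<open>f - p\<close> is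
  orthogonal to all \<open>z\<^sup>j\<close> with \<open>j \<ge> 0\<close>; so all Fourier coefficients of \<open>f - p\<close> vanish.\<close>
lemma integral_H2_mult_H2_0:
  assumes f: "H2 f" and g: "L2 g" "\<And>j. j \<le> 0 \<Longrightarrow> fourier_coeff g j = 0"
  shows "(\<integral>z. f z * g z \<partial>circle_m) = 0"
proof -
  \<comment> \<open>Scalar functions sit in component 0, so that the projection theorem applies with
    n = 1.\<close>
  define K where "K = {F :: nat \<Rightarrow> complex \<Rightarrow> complex. L2 (F 0) \<and>
    (\<forall>g. L2 g \<longrightarrow> (\<forall>j\<le>0. fourier_coeff g j = 0) \<longrightarrow> (\<integral>z. F 0 z * g z \<partial>circle_m) = 0)}"
  have K: "closed_subspace 1 K"
    unfolding closed_subspace_def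
  proof (intro conjI ballI allI impI)
    fix F G :: "nat \<Rightarrow> complex \<Rightarrow> complex" and c
    assume F: "F \<in> K" and G: "G \<in> K"
    have "(\<integral>z. (F 0 z + c * G 0 z) * h z \<partial>circle_m) = 0"
      if h: "L2 h" "\<forall>j\<le>0. fourier_coeff h j = 0" for h
    proof -
      have "(\<integral>z. (F 0 z + c * G 0 z) * h z \<partial>circle_m) = (\<integral>z. F 0 z * h z + c * (G 0 z * h z) \<partial>circle_m)"
        by (simp add: algebra_simps)
      also have "\<dots> = (\<integral>z. F 0 z * h z \<partial>circle_m) + c * (\<integral>z. G 0 z * h z \<partial>circle_m)"
        using F G L1_mult_L2[of "F 0" h] L1_mult_L2[of "G 0" h] h by (simp add: K_def L1_def)
      finally show ?thesis using F G h by (simp add: K_def)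
    qed
    then show "(\<lambda>i z. F i z + c * G i z) \<in> K"
      using F G by (simp add: K_def L2_add L2_cmult)
  next
    fix p F
    assume p: "\<forall>m. p m \<in> K" and F: "L2v 1 F"
      and lim: "(\<lambda>m. normsq_L2v 1 (\<lambda>i z. p m i z - F i z)) \<longlonglongrightarrow> 0"
    have "(\<integral>z. F 0 z * h z \<partial>circle_m) = 0"
      if h: "L2 h" "\<forall>j\<le>0. fourier_coeff h j = 0" for h
    proof (rule LIMSEQ_unique)
      show "(\<lambda>m. \<integral>z. p m 0 z * h z \<partial>circle_m) \<longlonglongrightarrow> (\<integral>z. F 0 z * h z \<partial>circle_m)"
        by (rule integral_mult_tendsto_L2) (use p F lim h in \<open>auto simp: K_def L2v_def normsq_L2v_def\<close>)
      show "(\<lambda>m. \<integral>z. p m 0 z * h z \<partial>circle_m) \<longlonglongrightarrow> 0"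
        using p h by (simp add: K_def)
    qed
    then show "F \<in> K" using F by (simp add: K_def L2v_def)
  qed (auto simp: K_def L2v_def)
  have "L2v 1 (\<lambda>_. f)" using f by (simp add: L2v_def H2_def)
  from closed_subspace_projection[OF K this] obtain p where p: "p \<in> K"
    "\<And>w. w \<in> K \<Longrightarrow> inner_L2v 1 (\<lambda>i z. f z - p i z) w = 0"
    by blast
  have pL2: "L2 (p 0)" using p(1) by (simp add: K_def)
  define e where "e z = f z - p 0 z" for z
  have eL2: "L2 e" unfolding e_def by (intro L2_diff H2_L2 f pL2)
  note [measurable] = L2_measurable[OF eL2] L2_measurable[OF pL2] L2_measurable[OF H2_L2[OF f]] L2_measurable[OF g(1)]
  have "fourier_coeff e j = 0" for j
  proof (cases "j < 0")
    case True
    \<comment> \<open>The power z^(-j) is one of the test functions in \<open>K\<close>, since its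
      only nonzero coefficient has the positive index -j.\<close>
    have "(\<integral>z. p 0 z * z powi (- j) \<partial>circle_m) = 0"
      using p(1) True L2_powi[of "-j"] by (auto simp: K_def fourier_coeff_powi)
    then have "fourier_coeff (p 0) j = 0" by (simp add: fourier_coeff_def)
    then show ?thesis
      using f True unfolding e_def
      by (subst fourier_coeff_diff) (auto simp: H2_def L2_imp_L1 pL2)
  next
    case False
    \<comment> \<open>For nonnegative j the power z^j itself belongs to \<open>K\<close>, hence the
      error is orthogonal to it.\<close>
    have "(\<lambda>_ z. z powi j) \<in> K"
    proof -
      have "(\<integral>z. z powi j * h z \<partial>circle_m) = 0" if "\<forall>j\<le>0. fourier_coeff h j = 0" for h
        using that False by (auto simp: fourier_coeff_def mult.commute dest: spec[of _ "-j"])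
      then show ?thesis by (auto simp: K_def L2_powi)
    qed
    then have "(\<integral>z. e z * cnj (z powi j) \<partial>circle_m) = 0"
      using p(2)[of "\<lambda>_ z. z powi j"] by (simp add: inner_L2v_def e_def)
    moreover have "(\<integral>z. e z * cnj (z powi j) \<partial>circle_m) = fourier_coeff e j"
      unfolding fourier_coeff_def
    proof (rule integral_cong_AE)
      show "AE z in circle_m. e z * cnj (z powi j) = e z * z powi - j"
        using AE_circle_norm_powi[of j]
        by eventually_elim (simp only: cnj_powi)
    qed measurable
    ultimately show ?thesis by simp
  qed
  then have "AE z in circle_m. e z = 0"
    using eL2 L2_imp_L1 by (intro fourier_uniqueness) auto
  then have "(\<integral>z. f z * g z \<partial>circle_m) = (\<integral>z. p 0 z * g z \<partial>circle_m)"
    by (intro integral_cong_AE) (auto simp: e_def)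
  then show ?thesis
    using p(1) g by (simp add: K_def)
qed

text \<open>For j < 0 the factor z^(-j) moves \<open>g\<close> into the part of \<open>H^2\<close>
  with vanishing mean, so the coefficient becomes an integral covered by
  \<open>integral_H2_mult_H2_0\<close>.\<close>

lemma fourier_coeff_H2_mult_H2:
  assumes "H2 f" "H2 g" "j < 0"
  shows "fourier_coeff (\<lambda>z. f z * g z) j = 0"
proof -
  have "(\<integral>z. f z * (g z * z powi (- j)) \<partial>circle_m) = 0"
    using assms by (intro integral_H2_mult_H2_0 L2_mult_powi)
      (auto simp: H2_def fourier_coeff_mult_powi L2_measurable)
  then show ?thesis by (simp add: fourier_coeff_def mult.assoc)
qed

section \<open>Bounded functions as multipliers\<close>

lemma Linf_AE_bounded:
  assumes "Linf f"
  obtains C where "AE z in circle_m. cmod (f z) \<le> C"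
proof -
  have "esssup circle_m (\<lambda>z. ereal (cmod (f z))) < \<infinity>"
    using assms by (simp add: Linf_def)
  then obtain C where C: "esssup circle_m (\<lambda>z. ereal (cmod (f z))) < ereal C"
    using less_PInf_Ex_of_nat ereal_dense2 by blast
  have "AE z in circle_m. cmod (f z) \<le> C"
    using esssup_AE[of "\<lambda>z. ereal (cmod (f z))" circle_m]
  proof eventually_elim
    case (elim z)
    then have "ereal (cmod (f z)) \<le> ereal C" using C by (meson less_imp_le order_trans)
    then show ?case by simp
  qed
  then show ?thesis using that by blast
qed

lemma Linf_measurable: "Linf f \<Longrightarrow> f \<in> borel_measurable borel"
  by (simp add: Linf_def measurable_def)

lemma Linf_mult_L2: "Linf f \<Longrightarrow> L2 g \<Longrightarrow> L2 (\<lambda>z. f z * g z)"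
  by (metis L2_mult_bounded Linf_AE_bounded Linf_measurable)

lemma Linf_mult_L1: "Linf f \<Longrightarrow> L1 g \<Longrightarrow> L1 (\<lambda>z. f z * g z)"
  using L1_mult_bounded[of g f] by (metis (no_types, lifting) Linf_AE_bounded Linf_measurable mult.commute ext)

lemma Hinf_H2: "Hinf f \<Longrightarrow> H2 f"
  using Linf_mult_L2[of f "\<lambda>_. 1"] by (simp add: Hinf_def H2_def)

lemma Hinf_mult_H2: "Hinf f \<Longrightarrow> H2 g \<Longrightarrow> H2 (\<lambda>z. f z * g z)"
  using Linf_mult_L2[of f g] fourier_coeff_H2_mult_H2[OF Hinf_H2] by (simp add: H2_def Hinf_def)

subsection \<open>Closed and shift invariant subspaces\<close>

lemma closed_subspace_L2v: "closed_subspace n K \<Longrightarrow> f \<in> K \<Longrightarrow> L2v n f"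
  by (auto simp: closed_subspace_def)

lemma closed_subspace_zero: "closed_subspace n K \<Longrightarrow> (\<lambda>_ _. 0) \<in> K"
  by (auto simp: closed_subspace_def)

lemma closed_subspace_add_cmult:
  "closed_subspace n K \<Longrightarrow> f \<in> K \<Longrightarrow> g \<in> K \<Longrightarrow> (\<lambda>i z. f i z + c * g i z) \<in> K"
  by (auto simp: closed_subspace_def)

lemma closed_subspace_diff:
  "closed_subspace n K \<Longrightarrow> f \<in> K \<Longrightarrow> g \<in> K \<Longrightarrow> (\<lambda>i z. f i z - g i z) \<in> K"
  using closed_subspace_add_cmult[of n K f g "-1"] by simp

lemma closed_subspace_cmult:
  "closed_subspace n K \<Longrightarrow> f \<in> K \<Longrightarrow> (\<lambda>i z. c * f i z) \<in> K"
  using closed_subspace_add_cmult[of n K "\<lambda>_ _. 0" f c] closed_subspace_zero by simp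

lemma closed_subspace_sum:
  assumes "closed_subspace n K" "\<And>l. l \<in> A \<Longrightarrow> f l \<in> K"
  shows "(\<lambda>i z. \<Sum>l\<in>A. f l i z) \<in> K"
  using assms(2)
proof (induction A rule: infinite_finite_induct)
  case (insert l A)
  have "(\<lambda>i z. f l i z + 1 * (\<Sum>l\<in>A. f l i z)) \<in> K"
    by (rule closed_subspace_add_cmult[OF assms(1)]) (use insert in auto)
  then show ?case using insert by simp
qed (use closed_subspace_zero[OF assms(1)] in auto)

lemma closed_subspace_limit:
  "closed_subspace n K \<Longrightarrow> (\<And>m. p m \<in> K) \<Longrightarrow> L2v n f \<Longrightarrow>
    (AE z in circle_m. \<forall>i<n. (\<lambda>m. p m i z) \<longlonglongrightarrow> f i z) \<Longrightarrow>
    (\<lambda>m. normsq_L2v n (\<lambda>i z. p m i z - f i z)) \<longlonglongrightarrow> 0 \<Longrightarrow> f \<in> K"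
  unfolding closed_subspace_def by blast

lemma normsq_L2v_eq_0_AE:
  assumes "AE z in circle_m. \<forall>i<n. f i z = 0"
  shows "normsq_L2v n f = 0"
  unfolding normsq_L2v_def by (rule integral_eq_zero_AE) (use assms in eventually_elim, auto)

lemma normsq_L2v_eq_0D:
  assumes "L2v n f" "normsq_L2v n f = 0"
  shows "AE z in circle_m. \<forall>i<n. f i z = 0"
proof -
  have "AE z in circle_m. (\<Sum>i<n. (cmod (f i z))\<^sup>2) = 0"
    using assms integrable_normsq_L2v[OF assms(1)] unfolding normsq_L2v_def
    by (subst (asm) integral_nonneg_eq_0_iff_AE) (auto simp: sum_nonneg)
  then show ?thesis
    by eventually_elim (auto simp: sum_nonneg_eq_0_iff)
qed

lemma closed_subspace_cong_AE:
  assumes "closed_subspace n K" "f \<in> K" "L2v n g" "AE z in circle_m. \<forall>i<n. f i z = g i z"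
  shows "g \<in> K"
proof (rule closed_subspace_limit[OF assms(1), of "\<lambda>_. f"])
  show "AE z in circle_m. \<forall>i<n. (\<lambda>m. f i z) \<longlonglongrightarrow> g i z"
    using assms(4) by eventually_elim simp
  have "normsq_L2v n (\<lambda>i z. f i z - g i z) = 0"
    by (rule normsq_L2v_eq_0_AE) (use assms(4) in eventually_elim, auto)
  then show "(\<lambda>m. normsq_L2v n (\<lambda>i z. f i z - g i z)) \<longlonglongrightarrow> 0" by simp
qed (use assms in auto)

lemma L2v_mult_powi: "L2v n f \<Longrightarrow> L2v n (\<lambda>i z. f i z * z powi m)"
  by (simp add: L2v_def L2_mult_powi)

lemma sum_mult_cnj: "(\<Sum>i\<in>A. a i * cnj (a i)) = complex_of_real (\<Sum>i\<in>A. (cmod (a i))\<^sup>2)"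
  unfolding of_real_sum complex_norm_square ..

lemma AE_mult_powi_cancel:
  "AE z in circle_m. \<forall>i<n. f i z * z powi m * z powi (-m) = f i z"
  using AE_circle_nonzero
  by eventually_elim (simp add: power_int_minus mult.assoc)

lemma normsq_L2v_mult_powi:
  assumes "L2v n f"
  shows "normsq_L2v n (\<lambda>i z. f i z * z powi m) = normsq_L2v n f"
  unfolding normsq_L2v_def
proof (rule integral_cong_AE)
  show "AE z in circle_m. (\<Sum>i<n. (cmod (f i z * z powi m))\<^sup>2) = (\<Sum>i<n. (cmod (f i z))\<^sup>2)"
    using AE_circle_norm_powi[of m] by eventually_elim (simp add: norm_mult)
qed (use integrable_normsq_L2v[OF assms] integrable_normsq_L2v[OF L2v_mult_powi[OF assms]] in auto)

text \<open>For m = -1 and a shift invariant \<open>K\<close> this is z K up to null sets, the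
  subspace to which a new wandering vector has to be orthogonal. Multiplication by a power of z is
  isometric and preserves a.e. convergence.\<close>

lemma closed_subspace_Int_shift:
  assumes "closed_subspace n K"
  shows "closed_subspace n {f \<in> K. (\<lambda>i z. f i z * z powi m) \<in> K}" 
  unfolding closed_subspace_def
proof (intro conjI ballI allI impI)
  fix f g c assume "f \<in> {f \<in> K. (\<lambda>i z. f i z * z powi m) \<in> K}" "g \<in> {f \<in> K. (\<lambda>i z. f i z * z powi m) \<in> K}"
  then show "(\<lambda>i z. f i z + c * g i z) \<in> {f \<in> K. (\<lambda>i z. f i z * z powi m) \<in> K}"
    using closed_subspace_add_cmult[OF assms, of f g c]
      closed_subspace_add_cmult[OF assms, of "\<lambda>i z. f i z * z powi m" "\<lambda>i z. g i z * z powi m" c]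
    by (simp add: algebra_simps)
next
  fix p :: "nat \<Rightarrow> nat \<Rightarrow> complex \<Rightarrow> complex" and f
  assume p: "\<forall>l. p l \<in> {f \<in> K. (\<lambda>i z. f i z * z powi m) \<in> K}" and f: "L2v n f"
    and ae: "AE z in circle_m. \<forall>i<n. (\<lambda>l. p l i z) \<longlonglongrightarrow> f i z"
    and lim: "(\<lambda>l. normsq_L2v n (\<lambda>i z. p l i z - f i z)) \<longlonglongrightarrow> 0"
  have pL2: "L2v n (p l)" for l
    using p closed_subspace_L2v[OF assms] by auto
  have "f \<in> K"
    by (rule closed_subspace_limit[OF assms, of p]) (use p f ae lim in auto)
  moreover have "(\<lambda>i z. f i z * z powi m) \<in> K"
  proof (rule closed_subspace_limit[OF assms, of "\<lambda>l i z. p l i z * z powi m"])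
    show "AE z in circle_m. \<forall>i<n. (\<lambda>l. p l i z * z powi m) \<longlonglongrightarrow> f i z * z powi m"
      using ae by eventually_elim (auto intro: tendsto_mult_right)
    show "(\<lambda>l. normsq_L2v n (\<lambda>i z. p l i z * z powi m - f i z * z powi m)) \<longlonglongrightarrow> 0"
      using lim normsq_L2v_mult_powi[OF L2v_diff[OF pL2 f], where m = m] by (simp add: left_diff_distrib)
  qed (use p L2v_mult_powi[OF f] in auto)
  ultimately show "f \<in> {f \<in> K. (\<lambda>i z. f i z * z powi m) \<in> K}" by simp
qed (use assms in \<open>auto simp: closed_subspace_def\<close>)

lemma inner_L2v_cnj: "inner_L2v n g f = cnj (inner_L2v n f g)"
  unfolding inner_L2v_def by (subst Bochner_Integration.integral_cnj[symmetric]) (simp add: mult.commute)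

text \<open>Turns orthogonality in L^2 to shifted vectors into vanishing coefficients of a scalar
  function, from which pointwise information can be recovered.\<close>

lemma inner_L2v_shift:
  assumes "L2v n f" "L2v n g"
  shows "inner_L2v n f (\<lambda>i z. g i z * z powi m) = fourier_coeff (\<lambda>z. \<Sum>i<n. f i z * cnj (g i z)) m"
  unfolding inner_L2v_def fourier_coeff_def
proof (rule integral_cong_AE)
  show "AE z in circle_m. (\<Sum>i<n. f i z * cnj (g i z * z powi m)) = (\<Sum>i<n. f i z * cnj (g i z)) * z powi - m"
    using AE_circle_norm_powi[of m]
  proof eventually_elim
    case (elim z)
    note cnj_powi[OF this]
    then show ?case by (simp add: sum_distrib_right mult.assoc)
  qed
  show "(\<lambda>z. \<Sum>i<n. f i z * cnj (g i z * z powi m)) \<in> borel_measurable circle_m"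
    using integrable_inner_L2v[OF assms(1) L2v_mult_powi[OF assms(2)]] by (rule borel_measurable_integrable)
  show "(\<lambda>z. (\<Sum>i<n. f i z * cnj (g i z)) * z powi - m) \<in> borel_measurable circle_m"
    using borel_measurable_integrable[OF integrable_inner_L2v[OF assms]] by measurable
qed

subsection \<open>Factorization of matrix functions of class \<open>H\<^sup>1\<close> and rank at most \<open>k\<close>\<close>

text \<open>More unknowns than equations. Of two nonzero solutions of the first k equations, one is
  nonzero at \<open>l0\<close> and the other vanishes there; the combination that satisfies the last
  equation as well cannot vanish identically.\<close>

lemma exists_kernel_vector:
  fixes T :: "nat \<Rightarrow> 'b \<Rightarrow> 'a::field"
  assumes "finite J" "k < card J"
  obtains a where "\<exists>l\<in>J. a l \<noteq> 0" "\<And>q. q < k \<Longrightarrow> (\<Sum>l\<in>J. T q l * a l) = 0"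
proof -
  have "\<exists>a. (\<exists>l\<in>J. a l \<noteq> 0) \<and> (\<forall>q<k. (\<Sum>l\<in>J. T q l * a l) = 0)"
    using assms
  proof (induction k arbitrary: J)
    case 0
    then obtain j where "j \<in> J" by fastforce
    then show ?case by (intro exI[of _ "\<lambda>_. 1"]) auto
  next
    case (Suc k)
    define row where "row a = (\<Sum>l\<in>J. T k l * a l)" for a
    obtain a where a: "\<exists>l\<in>J. a l \<noteq> 0" "\<forall>q<k. (\<Sum>l\<in>J. T q l * a l) = 0"
      using Suc.IH[of J] Suc.prems by auto
    show ?case
    proof (cases "row a = 0")
      case True
      then show ?thesis
        using a by (intro exI[of _ a]) (auto simp: row_def less_Suc_eq)
    next
      case False
      obtain l0 where l0: "l0 \<in> J" "a l0 \<noteq> 0" using a by auto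
      obtain b where b: "\<exists>l\<in>J - {l0}. b l \<noteq> 0" "\<forall>q<k. (\<Sum>l\<in>J - {l0}. T q l * b l) = 0"
        using Suc.IH[of "J - {l0}"] Suc.prems l0 by (auto simp: card_Diff_singleton less_diff_conv)
      define b' where "b' l = (if l = l0 then 0 else b l)" for l
      have b': "(\<Sum>l\<in>J. T q l * b' l) = (\<Sum>l\<in>J - {l0}. T q l * b l)" for q
        by (rule sum.mono_neutral_cong_right) (use Suc.prems in \<open>auto simp: b'_def\<close>)
      define c where "c l = row b' * a l - row a * b' l" for l
      have lin: "(\<Sum>l\<in>J. T q l * c l) = row b' * (\<Sum>l\<in>J. T q l * a l) - row a * (\<Sum>l\<in>J. T q l * b' l)" for q
        by (simp add: c_def right_diff_distrib sum_subtractf sum_distrib_left mult_ac)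
      have "\<exists>l\<in>J. c l \<noteq> 0"
      proof (cases "row b' = 0")
        case True
        obtain l where "l \<in> J" "l \<noteq> l0" "b l \<noteq> 0" using b by auto
        then show ?thesis using True False by (intro bexI[of _ l]) (auto simp: c_def b'_def)
      next
        case nz: False
        then show ?thesis using l0 by (intro bexI[of _ l0]) (auto simp: c_def b'_def)
      qed
      moreover have "(\<Sum>l\<in>J. T q l * c l) = 0" if "q < Suc k" for q
      proof (cases "q = k")
        case True
        then show ?thesis unfolding lin by (simp add: row_def mult.commute)
      next
        case False
        then show ?thesis unfolding lin b' using a b that by (simp add: less_Suc_eq)
      qed
      ultimately show ?thesis by blast
    qed
  qed
  then show ?thesis using that by blast
qed

text \<open>\<open>P\<close> is an \<open>n \<times> c\<close> matrix function and \<open>w\<^sup>2\<close> dominates its entries; later \<open>w\<^sup>2 = \<parallel>P\<parallel>\<close>.\<close>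
locale H1_matrix =
  fixes n c k :: nat and P :: "nat \<Rightarrow> nat \<Rightarrow> complex \<Rightarrow> complex" and w :: "complex \<Rightarrow> real"
  assumes P_L1: "\<And>i j. i < n \<Longrightarrow> j < c \<Longrightarrow> L1 (P i j)"
    and P_coeff: "\<And>i j m. i < n \<Longrightarrow> j < c \<Longrightarrow> m < 0 \<Longrightarrow> fourier_coeff (P i j) m = 0"
    and w_L2: "L2 (\<lambda>z. of_real (w z))"
    and P_bound: "AE z in circle_m. \<forall>i<n. \<forall>j<c. cmod (P i j z) \<le> (w z)\<^sup>2"
    and P_rank: "AE z in circle_m. \<exists>X Y. \<forall>i<n. \<forall>j<c. P i j z = (\<Sum>l<k. X i l * Y l j)"
begin

text \<open>Membership of the value of \<open>f\<close> at \<open>z\<close> in the column space of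
  \<open>P\<close>, expressed by orthogonality to its orthogonal complement. In this form it passes
  to sums, multiples and pointwise limits without any choice of coefficients.\<close>

definition in_range :: "(nat \<Rightarrow> complex \<Rightarrow> complex) \<Rightarrow> complex \<Rightarrow> bool" where
  "in_range f z \<longleftrightarrow> (\<forall>y. (\<forall>j<c. (\<Sum>i<n. cnj (y i) * P i j z) = 0) \<longrightarrow> (\<Sum>i<n. cnj (y i) * f i z) = 0)"

text \<open>The shift invariant subspace whose inner function yields the factorization. Weighting by \<open>w\<close>
  makes outer functions unnecessary: \<open>w f\<close> is analytic although \<open>f\<close> need not be.\<close>
definition M :: "(nat \<Rightarrow> complex \<Rightarrow> complex) set" where
  "M = {f. L2v n f \<and> (\<forall>i<n. \<forall>j<0. fourier_coeff (\<lambda>z. of_real (w z) * f i z) j = 0) \<and>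
           (AE z in circle_m. in_range f z)}"

text \<open>Orthogonality at almost every point, and not just in L^2, is what multiplication by z
  preserves.\<close>

definition N :: "(nat \<Rightarrow> nat \<Rightarrow> complex \<Rightarrow> complex) \<Rightarrow> nat \<Rightarrow> (nat \<Rightarrow> complex \<Rightarrow> complex) set" where
  "N \<phi> r = {f \<in> M. AE z in circle_m. \<forall>l<r. (\<Sum>i<n. f i z * cnj (\<phi> l i z)) = 0}"

text \<open>The last clause demands orthogonality to z M for the whole of \<open>M\<close>. With z
  times the remaining part \<open>N\<close> only, the coefficients of a general element of
  \<open>M\<close> would not be seen to be analytic.\<close>

definition wandering :: "(nat \<Rightarrow> nat \<Rightarrow> complex \<Rightarrow> complex) \<Rightarrow> nat \<Rightarrow> bool" where
  "wandering \<phi> r \<longleftrightarrow> (\<forall>l<r. \<phi> l \<in> M) \<and>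
     (AE z in circle_m. \<forall>l<r. \<forall>l'<r. (\<Sum>i<n. \<phi> l i z * cnj (\<phi> l' i z)) = (if l = l' then 1 else 0)) \<and>
     (\<forall>l<r. \<forall>u\<in>M. inner_L2v n (\<lambda>i z. u i z * z powi 1) (\<phi> l) = 0)"

section \<open>Closedness and shift invariance of \<open>M\<close> and \<open>N\<close>\<close>

lemma w_measurable [measurable]: "w \<in> borel_measurable borel"
proof -
  have "(\<lambda>z. Re (complex_of_real (w z))) \<in> borel_measurable borel"
    using L2_measurable[OF w_L2] by measurable
  then show ?thesis by simp
qed

lemma in_range_add_cmult: "in_range f z \<Longrightarrow> in_range g z \<Longrightarrow> in_range (\<lambda>i z. f i z + a * g i z) z"
proof -
  have "(\<Sum>i<n. cnj (y i) * (f i z + a * g i z)) =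
     (\<Sum>i<n. cnj (y i) * f i z) + a * (\<Sum>i<n. cnj (y i) * g i z)" for y
    by (simp add: algebra_simps sum.distrib sum_distrib_left)
  then show "in_range f z \<Longrightarrow> in_range g z \<Longrightarrow> ?thesis" by (simp add: in_range_def)
qed

lemma in_range_mult: "in_range f z \<Longrightarrow> in_range (\<lambda>i z. f i z * G z) z"
proof -
  have "(\<Sum>i<n. cnj (y i) * (f i z * G z)) = (\<Sum>i<n. cnj (y i) * f i z) * G z" for y
    by (simp add: sum_distrib_right mult.assoc)
  then show "in_range f z \<Longrightarrow> ?thesis" by (simp add: in_range_def)
qed

lemma in_range_limit:
  assumes "\<And>m. in_range (p m) z" "\<forall>i<n. (\<lambda>m. p m i z) \<longlonglongrightarrow> f i z"
  shows "in_range f z"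
  unfolding in_range_def
proof (intro allI impI)
  fix y assume y: "\<forall>j<c. (\<Sum>i<n. cnj (y i) * P i j z) = 0"
  have "(\<lambda>m. \<Sum>i<n. cnj (y i) * p m i z) \<longlonglongrightarrow> (\<Sum>i<n. cnj (y i) * f i z)"
    using assms(2) by (intro tendsto_intros) auto
  moreover have "(\<Sum>i<n. cnj (y i) * p m i z) = 0" for m
    using assms(1) y by (simp add: in_range_def)
  ultimately show "(\<Sum>i<n. cnj (y i) * f i z) = 0"
    by (simp add: LIMSEQ_const_iff)
qed

lemma M_L2v: "f \<in> M \<Longrightarrow> L2v n f"
  and M_coeff: "f \<in> M \<Longrightarrow> i < n \<Longrightarrow> j < 0 \<Longrightarrow> fourier_coeff (\<lambda>z. of_real (w z) * f i z) j = 0"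
  and M_range: "f \<in> M \<Longrightarrow> AE z in circle_m. in_range f z"
  by (auto simp: M_def)

lemma L1_w_mult: "L2v n f \<Longrightarrow> i < n \<Longrightarrow> L1 (\<lambda>z. of_real (w z) * f i z)"
  by (intro L1_mult_L2 w_L2) (simp add: L2v_def)

text \<open>Both modes of convergence are used: norm convergence for the Fourier coefficients, a.e.
  convergence for the range condition.\<close>

lemma closed_subspace_M: "closed_subspace n M"
  unfolding closed_subspace_def
proof (intro conjI ballI allI impI)
  show "(\<lambda>_ _. 0) \<in> M"
    by (simp add: M_def L2v_def in_range_def fourier_coeff_def)
next
  fix f g a assume f: "f \<in> M" and g: "g \<in> M"
  have "fourier_coeff (\<lambda>z. of_real (w z) * (f i z + a * g i z)) j = 0" if "i < n" "j < 0" for i j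
  proof -
    have "(\<lambda>z. of_real (w z) * (f i z + a * g i z)) =
        (\<lambda>z. of_real (w z) * f i z + a * (of_real (w z) * g i z))"
      by (simp add: algebra_simps)
    moreover have "L1 (\<lambda>z. a * (of_real (w z) * g i z))"
      using L1_w_mult[OF M_L2v[OF g] that(1)] by (simp add: L1_def)
    ultimately show ?thesis
      using M_coeff[OF f that] M_coeff[OF g that] L1_w_mult[OF M_L2v[OF f] that(1)]
      by (simp add: fourier_coeff_add fourier_coeff_cmult)
  qed
  moreover have "AE z in circle_m. in_range (\<lambda>i z. f i z + a * g i z) z"
    using M_range[OF f] M_range[OF g] by eventually_elim (rule in_range_add_cmult)
  ultimately show "(\<lambda>i z. f i z + a * g i z) \<in> M"
    using L2v_add_cmult[OF M_L2v[OF f] M_L2v[OF g]] by (simp add: M_def)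
next
  fix p f
  assume p: "\<forall>m. p m \<in> M" and f: "L2v n f"
    and ae: "AE z in circle_m. \<forall>i<n. (\<lambda>m. p m i z) \<longlonglongrightarrow> f i z"
    and lim: "(\<lambda>m. normsq_L2v n (\<lambda>i z. p m i z - f i z)) \<longlonglongrightarrow> 0"
  have pL2: "L2v n (p m)" for m using p M_L2v by auto
  have "fourier_coeff (\<lambda>z. of_real (w z) * f i z) j = 0" if "i < n" "j < 0" for i j
  proof (rule LIMSEQ_unique)
    \<comment> \<open>The weight goes into the test function, which is in L^2; the product of
      \<open>w\<close> with \<open>p m\<close> is only known to be in L^1.\<close>
    let ?g = "\<lambda>z. of_real (w z) * z powi (-j)"
    have "(\<lambda>m. \<integral>z. (cmod (p m i z - f i z))\<^sup>2 \<partial>circle_m) \<longlonglongrightarrow> 0"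
      by (rule tendsto_sandwich[OF _ _ tendsto_const lim])
         (use normsq_L2v_coord[OF L2v_diff[OF pL2 f] that(1)] in auto)
    then have "(\<lambda>m. \<integral>z. p m i z * ?g z \<partial>circle_m) \<longlonglongrightarrow> (\<integral>z. f i z * ?g z \<partial>circle_m)"
      by (intro integral_mult_tendsto_L2 L2_mult_powi w_L2) (use pL2 f that in \<open>auto simp: L2v_def\<close>)
    then show "(\<lambda>m. fourier_coeff (\<lambda>z. of_real (w z) * p m i z) j) \<longlonglongrightarrow> fourier_coeff (\<lambda>z. of_real (w z) * f i z) j"
      by (simp add: fourier_coeff_def mult_ac)
    show "(\<lambda>m. fourier_coeff (\<lambda>z. of_real (w z) * p m i z) j) \<longlonglongrightarrow> 0"
      using M_coeff p that by simp
  qed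
  moreover have "AE z in circle_m. in_range f z"
  proof -
    have "AE z in circle_m. \<forall>m. in_range (p m) z"
      using p M_range by (simp add: AE_all_countable)
    with ae show ?thesis by eventually_elim (rule in_range_limit, auto)
  qed
  ultimately show "f \<in> M" using f by (simp add: M_def)
qed (rule M_L2v)

lemma closed_subspace_N: "closed_subspace n (N \<phi> r)"
  unfolding closed_subspace_def
proof (intro conjI ballI allI impI)
  fix f g a assume f: "f \<in> N \<phi> r" and g: "g \<in> N \<phi> r"
  have "AE z in circle_m. \<forall>l<r. (\<Sum>i<n. f i z * cnj (\<phi> l i z)) = 0"
    "AE z in circle_m. \<forall>l<r. (\<Sum>i<n. g i z * cnj (\<phi> l i z)) = 0"
    using f g by (auto simp: N_def)
  then have "AE z in circle_m. \<forall>l<r. (\<Sum>i<n. (f i z + a * g i z) * cnj (\<phi> l i z)) = 0"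
  proof eventually_elim
    case (elim z)
    have "(\<Sum>i<n. (f i z + a * g i z) * cnj (\<phi> l i z)) =
      (\<Sum>i<n. f i z * cnj (\<phi> l i z)) + a * (\<Sum>i<n. g i z * cnj (\<phi> l i z))" for l
      by (simp add: algebra_simps sum.distrib sum_distrib_left)
    then show ?case using elim by simp
  qed
  then show "(\<lambda>i z. f i z + a * g i z) \<in> N \<phi> r"
    using closed_subspace_add_cmult[OF closed_subspace_M] f g by (simp add: N_def)
next
  fix p f
  assume p: "\<forall>m. p m \<in> N \<phi> r" and f: "L2v n f"
    and ae: "AE z in circle_m. \<forall>i<n. (\<lambda>m. p m i z) \<longlonglongrightarrow> f i z"
    and lim: "(\<lambda>m. normsq_L2v n (\<lambda>i z. p m i z - f i z)) \<longlonglongrightarrow> 0"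
  have "f \<in> M"
    by (rule closed_subspace_limit[OF closed_subspace_M, of p]) (use p f ae lim in \<open>auto simp: N_def\<close>)
  have "AE z in circle_m. \<forall>m. \<forall>l<r. (\<Sum>i<n. p m i z * cnj (\<phi> l i z)) = 0"
    using p by (simp add: AE_all_countable N_def)
  with ae have "AE z in circle_m. \<forall>l<r. (\<Sum>i<n. f i z * cnj (\<phi> l i z)) = 0"
  proof eventually_elim
    case (elim z)
    show ?case
    proof (intro allI impI)
      fix l assume "l < r"
      have "(\<lambda>m. \<Sum>i<n. p m i z * cnj (\<phi> l i z)) \<longlonglongrightarrow> (\<Sum>i<n. f i z * cnj (\<phi> l i z))"
        using elim(1) by (intro tendsto_intros) auto
      then show "(\<Sum>i<n. f i z * cnj (\<phi> l i z)) = 0"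
        using elim(2) \<open>l < r\<close> by (simp add: LIMSEQ_const_iff)
    qed
  qed
  then show "f \<in> N \<phi> r" using \<open>f \<in> M\<close> by (simp add: N_def)
qed (use closed_subspace_M in \<open>auto simp: N_def closed_subspace_def\<close>)

lemma M_mult_powi:
  assumes f: "f \<in> M" and m: "m \<ge> 0"
  shows "(\<lambda>i z. f i z * z powi m) \<in> M"
proof -
  have "fourier_coeff (\<lambda>z. of_real (w z) * (f i z * z powi m)) j = 0" if "i < n" "j < 0" for i j
    using fourier_coeff_mult_powi[OF L1_measurable[OF L1_w_mult[OF M_L2v[OF f] that(1)]], of m j]
      M_coeff[OF f that(1), of "j - m"] that m by (simp add: mult.assoc)
  moreover have "AE z in circle_m. in_range (\<lambda>i z. f i z * z powi m) z"
    using M_range[OF f] by eventually_elim (rule in_range_mult)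
  ultimately show ?thesis
    using L2v_mult_powi[OF M_L2v[OF f]] by (simp add: M_def)
qed

lemma N_mult_powi:
  assumes f: "f \<in> N \<phi> r" and m: "m \<ge> 0"
  shows "(\<lambda>i z. f i z * z powi m) \<in> N \<phi> r"
proof -
  have "AE z in circle_m. \<forall>l<r. (\<Sum>i<n. f i z * cnj (\<phi> l i z)) = 0"
    using f by (simp add: N_def)
  then have "AE z in circle_m. \<forall>l<r. (\<Sum>i<n. f i z * z powi m * cnj (\<phi> l i z)) = 0"
  proof eventually_elim
    case (elim z)
    have "(\<Sum>i<n. f i z * z powi m * cnj (\<phi> l i z)) = z powi m * (\<Sum>i<n. f i z * cnj (\<phi> l i z))" for l
      by (simp add: sum_distrib_left mult_ac)
    then show ?case using elim by simp
  qed
  then show ?thesis using M_mult_powi f m by (simp add: N_def)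
qed

lemma H2_w_mult_bounded:
  assumes f: "f \<in> M" and b: "AE z in circle_m. cmod (f i z) \<le> 1" and i: "i < n"
  shows "H2 (\<lambda>z. of_real (w z) * f i z)"
proof -
  have "f i \<in> borel_measurable borel"
    using M_L2v[OF f] i by (auto simp: L2v_def intro: L2_measurable)
  then have "L2 (\<lambda>z. f i z * of_real (w z))"
    by (rule L2_mult_bounded[OF w_L2 _ b])
  then show ?thesis
    using M_coeff[OF f i] by (simp add: H2_def mult.commute)
qed

text \<open>A bounded \<open>f\<close> makes \<open>w f\<close> an \<open>H^2\<close> function, and
  a product of two \<open>H^2\<close> functions has no negative coefficients.\<close>

lemma M_mult_H2:
  assumes f: "f \<in> M" and b: "AE z in circle_m. \<forall>i<n. cmod (f i z) \<le> 1" and G: "H2 G"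
  shows "(\<lambda>i z. f i z * G z) \<in> M"
proof -
  have b': "AE z in circle_m. cmod (f i z) \<le> 1" if "i < n" for i
    using b that by (auto elim: eventually_mono)
  have m: "f i \<in> borel_measurable borel" if "i < n" for i
    using M_L2v[OF f] that by (auto simp: L2v_def intro: L2_measurable)
  have "L2v n (\<lambda>i z. f i z * G z)"
    unfolding L2v_def using L2_mult_bounded[OF H2_L2[OF G] m b'] by simp
  moreover have "fourier_coeff (\<lambda>z. of_real (w z) * (f i z * G z)) j = 0" if "i < n" "j < 0" for i j
    using fourier_coeff_H2_mult_H2[OF H2_w_mult_bounded[OF f b'[OF that(1)] that(1)] G that(2)]
    by (simp add: mult.assoc)
  moreover have "AE z in circle_m. in_range (\<lambda>i z. f i z * G z) z"
    using M_range[OF f] by eventually_elim (rule in_range_mult)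
  ultimately show ?thesis by (simp add: M_def)
qed

section \<open>Wandering vectors\<close>

lemma wandering_orthonormal:
  "wandering \<phi> r \<Longrightarrow> AE z in circle_m. \<forall>l<r. \<forall>l'<r.
    (\<Sum>i<n. \<phi> l i z * cnj (\<phi> l' i z)) = (if l = l' then 1 else 0)"
  by (simp add: wandering_def)

lemma wandering_bounded:
  assumes "wandering \<phi> r" "l < r"
  shows "AE z in circle_m. \<forall>i<n. cmod (\<phi> l i z) \<le> 1"
proof -
  from wandering_orthonormal[OF assms(1)] show ?thesis
  proof eventually_elim
    case (elim z)
    then have "(\<Sum>i<n. \<phi> l i z * cnj (\<phi> l i z)) = 1" using assms(2) by simp
    then have "complex_of_real (\<Sum>i<n. (cmod (\<phi> l i z))\<^sup>2) = of_real 1"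
      unfolding sum_mult_cnj by (simp only: of_real_1)
    then have s: "(\<Sum>i<n. (cmod (\<phi> l i z))\<^sup>2) = 1" by (simp only: of_real_eq_iff)
    show ?case
    proof (intro allI impI)
      fix i assume "i < n"
      then have "(cmod (\<phi> l i z))\<^sup>2 \<le> 1"
        unfolding s[symmetric] by (intro member_le_sum) auto
      then show "cmod (\<phi> l i z) \<le> 1" by (simp add: power_le_one_iff)
    qed
  qed
qed

text \<open>At almost every point there are r orthonormal vectors in a column space of dimension at
  most k. If r > k, some nontrivial combination \<open>y\<close> of them is orthogonal to that
  space, hence by \<open>in_range\<close> to each of them, which kills its coefficients. The circle
  has measure one, so a contradiction a.e. is a contradiction.\<close>

lemma wandering_le_rank:
  assumes \<phi>: "wandering \<phi> r"
  shows "r \<le> k"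
proof (rule ccontr)
  assume "\<not> r \<le> k"
  have "AE z in circle_m. \<forall>l\<in>{..<r}. in_range (\<phi> l) z"
    using \<phi> by (intro AE_finite_allI M_range) (auto simp: wandering_def)
  with wandering_orthonormal[OF \<phi>] have "AE z in circle_m. False"
    using P_rank
  proof eventually_elim
    case (elim z)
    then obtain X Y where XY: "\<And>i j. i < n \<Longrightarrow> j < c \<Longrightarrow> P i j z = (\<Sum>l<k. X i l * Y l j)" by metis
    obtain a where a: "\<exists>l\<in>{..<r}. a l \<noteq> 0"
      "\<And>q. q < k \<Longrightarrow> (\<Sum>l<r. (\<Sum>i<n. cnj (X i q) * \<phi> l i z) * a l) = 0"
      using exists_kernel_vector[of "{..<r}" k "\<lambda>q l. \<Sum>i<n. cnj (X i q) * \<phi> l i z"] \<open>\<not> r \<le> k\<close> by auto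
    define y where "y i = (\<Sum>l<r. a l * \<phi> l i z)" for i
    have Xy: "(\<Sum>i<n. cnj (y i) * X i q) = 0" if "q < k" for q
    proof -
      have "cnj (\<Sum>i<n. cnj (y i) * X i q) = (\<Sum>i<n. \<Sum>l<r. cnj (X i q) * \<phi> l i z * a l)"
        by (simp add: y_def sum_distrib_left sum_distrib_right mult_ac)
      also have "\<dots> = (\<Sum>l<r. (\<Sum>i<n. cnj (X i q) * \<phi> l i z) * a l)"
        by (subst sum.swap) (simp add: sum_distrib_right)
      finally show ?thesis using a(2)[OF that] by (metis complex_cnj_zero_iff)
    qed
    have "(\<Sum>i<n. cnj (y i) * P i j z) = 0" if "j < c" for j
    proof -
      have "(\<Sum>i<n. cnj (y i) * P i j z) = (\<Sum>i<n. \<Sum>q<k. cnj (y i) * X i q * Y q j)"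
        using that by (simp add: XY sum_distrib_left mult_ac)
      also have "\<dots> = (\<Sum>q<k. (\<Sum>i<n. cnj (y i) * X i q) * Y q j)"
        by (subst sum.swap) (simp add: sum_distrib_right)
      finally show ?thesis using Xy by simp
    qed
    then have orth: "(\<Sum>i<n. cnj (y i) * \<phi> l i z) = 0" if "l < r" for l
      using elim(2) that by (simp add: in_range_def)
    obtain l where l: "l < r" "a l \<noteq> 0" using a(1) by auto
    have "(\<Sum>i<n. cnj (y i) * \<phi> l i z) = (\<Sum>i<n. \<Sum>l'<r. cnj (a l') * (\<phi> l i z * cnj (\<phi> l' i z)))"
      by (simp add: y_def sum_distrib_left sum_distrib_right mult_ac)
    also have "\<dots> = (\<Sum>l'<r. cnj (a l') * (\<Sum>i<n. \<phi> l i z * cnj (\<phi> l' i z)))"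
      by (subst sum.swap) (simp add: sum_distrib_left)
    also have "\<dots> = (\<Sum>l'<r. if l' = l then cnj (a l) else 0)"
      using elim(1) l(1) by (intro sum.cong) auto
    also have "\<dots> = cnj (a l)" using l(1) by simp
    finally show False using orth[OF l(1)] l(2) by simp
  qed
  then show False by simp
qed

text \<open>A coefficient of index j < 0 is the inner product of z times z^(-j-1) f with
  \<open>\<phi> l\<close>. As -j-1 is nonnegative, this is a pairing with z M and vanishes.\<close>

lemma wandering_coefficient_H2:
  assumes \<phi>: "wandering \<phi> r" and l: "l < r" and f: "f \<in> M"
  shows "H2 (\<lambda>z. \<Sum>i<n. f i z * cnj (\<phi> l i z))"
proof -
  have \<phi>M: "\<phi> l \<in> M" using \<phi> l by (simp add: wandering_def)
  have "L2 (\<lambda>z. cnj (\<phi> l i z) * f i z)" if "i < n" for i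
  proof (rule L2_mult_bounded)
    show "L2 (f i)" using M_L2v[OF f] that by (simp add: L2v_def)
    show "(\<lambda>z. cnj (\<phi> l i z)) \<in> borel_measurable borel"
      using M_L2v[OF \<phi>M] that by (intro L2_measurable L2_cnj) (simp add: L2v_def)
    show "AE z in circle_m. cmod (cnj (\<phi> l i z)) \<le> 1"
      using wandering_bounded[OF \<phi> l] by eventually_elim (use that in simp)
  qed
  then have L2: "L2 (\<lambda>z. \<Sum>i<n. f i z * cnj (\<phi> l i z))"
    by (intro L2_sum) (simp add: mult.commute)
  have "fourier_coeff (\<lambda>z. \<Sum>i<n. f i z * cnj (\<phi> l i z)) j = 0" if "j < 0" for j
  proof -
    let ?u = "\<lambda>i z. f i z * z powi (- j - 1)"
    have u: "?u \<in> M" by (rule M_mult_powi[OF f]) (use that in simp)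
    then have "inner_L2v n (\<lambda>i z. ?u i z * z powi 1) (\<phi> l) = 0"
      using \<phi> l by (simp only: wandering_def)
    moreover have "inner_L2v n (\<lambda>i z. ?u i z * z powi 1) (\<phi> l) = fourier_coeff (\<lambda>z. \<Sum>i<n. f i z * cnj (\<phi> l i z)) j"
      unfolding inner_L2v_def fourier_coeff_def
    proof (rule integral_cong_AE)
      show "AE z in circle_m. (\<Sum>i<n. ?u i z * z powi 1 * cnj (\<phi> l i z)) = (\<Sum>i<n. f i z * cnj (\<phi> l i z)) * z powi - j"
        using AE_circle_nonzero
      proof eventually_elim
        case (elim z)
        then have "z powi (- j - 1) * z powi 1 = z powi - j"
          by (subst power_int_add[symmetric]) auto
        then show ?case
          by (simp only: sum_distrib_right) (intro sum.cong refl, simp only: mult_ac, metis mult.assoc mult.commute)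
      qed
      show "(\<lambda>z. \<Sum>i<n. ?u i z * z powi 1 * cnj (\<phi> l i z)) \<in> borel_measurable circle_m"
        using integrable_inner_L2v[OF L2v_mult_powi[OF M_L2v[OF u]] M_L2v[OF \<phi>M]] by (rule borel_measurable_integrable)
    qed (use L2_measurable[OF L2] in measurable)
    ultimately show ?thesis by simp
  qed
  with L2 show ?thesis by (simp add: H2_def)
qed

text \<open>Subtracting the pointwise projection stays inside \<open>M\<close> because its
  coefficients are in \<open>H^2\<close> and the vectors \<open>\<phi> l\<close> are bounded, as
  \<open>M_mult_H2\<close> requires.\<close>

lemma wandering_remainder:
  assumes \<phi>: "wandering \<phi> r" and f: "f \<in> M"
  shows "(\<lambda>i z. f i z - (\<Sum>l<r. \<phi> l i z * (\<Sum>i<n. f i z * cnj (\<phi> l i z)))) \<in> N \<phi> r"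
proof -
  let ?G = "\<lambda>l z. \<Sum>i<n. f i z * cnj (\<phi> l i z)"
  have "(\<lambda>i z. \<Sum>l<r. \<phi> l i z * ?G l z) \<in> M"
  proof (rule closed_subspace_sum[OF closed_subspace_M])
    fix l assume l: "l \<in> {..<r}"
    then show "(\<lambda>i z. \<phi> l i z * ?G l z) \<in> M"
      using \<phi> by (intro M_mult_H2 wandering_bounded[OF \<phi>] wandering_coefficient_H2[OF \<phi> _ f]) (auto simp: wandering_def)
  qed
  then have "(\<lambda>i z. f i z - (\<Sum>l<r. \<phi> l i z * ?G l z)) \<in> M"
    by (rule closed_subspace_diff[OF closed_subspace_M f])
  moreover have "AE z in circle_m. \<forall>l<r. (\<Sum>i<n. (f i z - (\<Sum>l<r. \<phi> l i z * ?G l z)) * cnj (\<phi> l i z)) = 0"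
  proof -
    from wandering_orthonormal[OF \<phi>] show ?thesis
    proof eventually_elim
      case (elim z)
      show ?case
      proof (intro allI impI)
        fix l assume l: "l < r"
        have "(\<Sum>i<n. (\<Sum>l'<r. \<phi> l' i z * ?G l' z) * cnj (\<phi> l i z)) =
            (\<Sum>i<n. \<Sum>l'<r. ?G l' z * (\<phi> l' i z * cnj (\<phi> l i z)))"
          by (intro sum.cong refl, subst sum_distrib_right, intro sum.cong refl) (simp only: mult_ac)
        also have "\<dots> = (\<Sum>l'<r. ?G l' z * (\<Sum>i<n. \<phi> l' i z * cnj (\<phi> l i z)))"
          by (subst sum.swap) (simp only: sum_distrib_left)
        also have "\<dots> = (\<Sum>l'<r. if l' = l then ?G l z else 0)"
          using elim l by (intro sum.cong) auto
        also have "\<dots> = ?G l z" using l by simp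
        finally show "(\<Sum>i<n. (f i z - (\<Sum>l<r. \<phi> l i z * ?G l z)) * cnj (\<phi> l i z)) = 0"
          by (simp add: left_diff_distrib sum_subtractf)
      qed
    qed
  qed
  ultimately show ?thesis by (simp add: N_def)
qed

text \<open>If \<open>g\<close> is divisible by all powers of z within \<open>M\<close>, every
  Fourier coefficient of \<open>w g\<close> vanishes. Where \<open>w\<close> is zero this says
  nothing about \<open>g\<close>; there the range condition decides, since \<open>P\<close> vanishes
  too.\<close>

lemma M_zero_if_all_shifts:
  assumes g: "\<And>m::nat. (\<lambda>i z. g i z * z powi (- int m)) \<in> M"
  shows "AE z in circle_m. \<forall>i<n. g i z = 0"
proof -
  have gM: "g \<in> M" using g[of 0] by simp
  have "AE z in circle_m. \<forall>i\<in>{..<n}. of_real (w z) * g i z = 0"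
  proof (rule AE_finite_allI)
    fix i assume "i \<in> {..<n}"
    then have i: "i < n" by simp
    have "fourier_coeff (\<lambda>z. of_real (w z) * g i z) j = 0" for j
    proof -
      \<comment> \<open>The least shift that makes \<open>j - m\<close> negative.\<close>
      define m where "m = nat (j + 1)"
      have "fourier_coeff (\<lambda>z. of_real (w z) * g i z * z powi (- int m)) (j - int m) = 0"
        using M_coeff[OF g[of m] i, of "j - int m"] by (simp add: m_def mult.assoc)
      then show ?thesis
        using fourier_coeff_mult_powi[OF L1_measurable[OF L1_w_mult[OF M_L2v[OF gM] i]], of "- int m" "j - int m"]
        by simp
    qed
    then show "AE z in circle_m. of_real (w z) * g i z = 0"
      using L1_w_mult[OF M_L2v[OF gM] i] by (intro fourier_uniqueness) auto
  qed simp
  with M_range[OF gM] P_bound show ?thesis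
  proof eventually_elim
    case (elim z)
    show ?case
    proof (cases "w z = 0")
      case True
      then have "P i j z = 0" if "i < n" "j < c" for i j
        using elim(2) that by simp
      then have "(\<Sum>i<n. cnj (g i z) * g i z) = 0"
        using elim(1) by (simp add: in_range_def)
      then have "complex_of_real (\<Sum>i<n. (cmod (g i z))\<^sup>2) = of_real 0"
        unfolding sum_mult_cnj[symmetric] by (simp add: mult.commute)
      then have "(\<Sum>i<n. (cmod (g i z))\<^sup>2) = 0" by (simp only: of_real_eq_iff)
      then show ?thesis by (auto simp: sum_nonneg_eq_0_iff)
    next
      case False
      then show ?thesis using elim(3) by auto
    qed
  qed
qed

text \<open>The Wold step. \<open>N\<close> is strictly larger than z N, and a vector of
  \<open>N\<close> orthogonal to z N is orthogonal to all its own positive shifts. Its squared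
  pointwise norm therefore has no Fourier coefficient except the one of index 0, so it is constant
  a.e. and the vector can be normalized.\<close>

lemma wandering_extend:
  assumes \<phi>: "wandering \<phi> r" and g: "g \<in> N \<phi> r" and nz: "\<not> (AE z in circle_m. \<forall>i<n. g i z = 0)"
  shows "\<exists>\<phi>'. wandering \<phi>' (Suc r)"
proof -
  define K where "K = {f \<in> N \<phi> r. (\<lambda>i z. f i z * z powi (-1)) \<in> N \<phi> r}"
  have K: "closed_subspace n K"
    unfolding K_def by (rule closed_subspace_Int_shift[OF closed_subspace_N])
  have NL2: "L2v n f" if "f \<in> N \<phi> r" for f
    using closed_subspace_L2v[OF closed_subspace_N that] .
  \<comment> \<open>Otherwise every element of \<open>N\<close> could be divided by z within
    \<open>N\<close>, so \<open>g\<close> could be divided arbitrarily often.\<close>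
  have "\<exists>f. f \<in> N \<phi> r \<and> f \<notin> K"
  proof (rule ccontr)
    assume *: "\<nexists>f. f \<in> N \<phi> r \<and> f \<notin> K"
    have "(\<lambda>i z. g i z * z powi (- int m)) \<in> N \<phi> r" for m
    proof (induction m)
      case (Suc m)
      then have "(\<lambda>i z. g i z * z powi (- int m) * z powi (-1)) \<in> N \<phi> r"
        using * by (auto simp: K_def)
      then show ?case
      proof (rule closed_subspace_cong_AE[OF closed_subspace_N])
        show "L2v n (\<lambda>i z. g i z * z powi (- int (Suc m)))"
          by (intro L2v_mult_powi NL2 g)
        show "AE z in circle_m. \<forall>i<n. g i z * z powi (- int m) * z powi (-1) = g i z * z powi (- int (Suc m))"
          using AE_circle_nonzero
        proof eventually_elim
          case (elim z)
          then have "z powi (- int m) * z powi (-1) = z powi (- int (Suc m))"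
            by (subst power_int_add[symmetric]) (auto simp: algebra_simps)
          then show ?case by (simp only: mult.assoc) simp
        qed
      qed
    qed (use g in simp)
    then have "AE z in circle_m. \<forall>i<n. g i z = 0"
      by (intro M_zero_if_all_shifts) (simp add: N_def)
    with nz show False by simp
  qed
  then obtain f where f: "f \<in> N \<phi> r" "f \<notin> K" by auto
  obtain p where p: "p \<in> K" "\<And>v. v \<in> K \<Longrightarrow> inner_L2v n (\<lambda>i z. f i z - p i z) v = 0"
    using closed_subspace_projection[OF K NL2[OF f(1)]] by blast
  define \<psi> where "\<psi> = (\<lambda>i z. f i z - p i z)"
  have \<psi>N: "\<psi> \<in> N \<phi> r"
    unfolding \<psi>_def by (rule closed_subspace_diff[OF closed_subspace_N f(1)]) (use p(1) in \<open>simp add: K_def\<close>)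
  note \<psi>L2 = NL2[OF \<psi>N]
  have shift: "(\<lambda>i z. u i z * z powi 1) \<in> K" if u: "u \<in> N \<phi> r" for u
  proof -
    have "(\<lambda>i z. u i z * z powi 1 * z powi (-1)) \<in> N \<phi> r"
    proof (rule closed_subspace_cong_AE[OF closed_subspace_N u])
      show "L2v n (\<lambda>i z. u i z * z powi 1 * z powi (-1))"
        by (intro L2v_mult_powi NL2 u)
      show "AE z in circle_m. \<forall>i<n. u i z = u i z * z powi 1 * z powi (-1)"
        using AE_mult_powi_cancel[of n u 1] by eventually_elim auto
    qed
    then show ?thesis using N_mult_powi[OF u, of 1] by (simp add: K_def)
  qed
  have orth: "inner_L2v n \<psi> (\<lambda>i z. u i z * z powi 1) = 0" if "u \<in> N \<phi> r" for u
    using p(2)[OF shift[OF that]] by (simp add: \<psi>_def)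
  define q where "q z = (\<Sum>i<n. \<psi> i z * cnj (\<psi> i z))" for z
  have qL1: "L1 q"
    unfolding q_def L1_def by (rule integrable_inner_L2v[OF \<psi>L2 \<psi>L2])
  define C where "C = normsq_L2v n \<psi>"
  have q_real: "q z = of_real (\<Sum>i<n. (cmod (\<psi> i z))\<^sup>2)" for z
    unfolding q_def sum_mult_cnj ..
  have q0: "fourier_coeff q 0 = of_real C"
    unfolding fourier_coeff_def q_real C_def normsq_L2v_def by (simp del: of_real_sum of_real_power)
  \<comment> \<open>The coefficient of index m > 0 pairs \<open>\<psi>\<close> with z times z^(m-1)
    \<open>\<psi>\<close>, an element of z N.\<close>
  have qpos: "fourier_coeff q m = 0" if "m > 0" for m
  proof -
    let ?u = "\<lambda>i z. \<psi> i z * z powi (m - 1)"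
    have u: "?u \<in> N \<phi> r" by (rule N_mult_powi[OF \<psi>N]) (use that in simp)
    have "fourier_coeff q m = fourier_coeff (\<lambda>z. \<Sum>i<n. \<psi> i z * cnj (?u i z)) 1"
    proof -
      have "fourier_coeff (\<lambda>z. \<Sum>i<n. \<psi> i z * cnj (?u i z)) 1 = fourier_coeff (\<lambda>z. q z * z powi (1 - m)) 1"
      proof (rule fourier_coeff_cong_AE)
        show "AE z in circle_m. (\<Sum>i<n. \<psi> i z * cnj (?u i z)) = q z * z powi (1 - m)"
          using AE_circle_norm_powi[of "m - 1"]
        proof eventually_elim
          case (elim z)
          note cnj_powi[OF this]
          then show ?case by (simp add: q_def sum_distrib_right mult.assoc)
        qed
        show "(\<lambda>z. \<Sum>i<n. \<psi> i z * cnj (?u i z)) \<in> borel_measurable borel"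
          using borel_measurable_integrable[OF integrable_inner_L2v[OF \<psi>L2 NL2[OF u]]] by simp
        show "(\<lambda>z. q z * z powi (1 - m)) \<in> borel_measurable borel"
          using L1_measurable[OF qL1] by measurable
      qed
      also have "\<dots> = fourier_coeff q m"
        by (subst fourier_coeff_mult_powi[OF L1_measurable[OF qL1]]) simp
      finally show ?thesis by simp
    qed
    also have "\<dots> = 0"
      using orth[OF u] inner_L2v_shift[OF \<psi>L2 NL2[OF u], of 1] by simp
    finally show ?thesis .
  qed
  \<comment> \<open>\<open>q\<close> is real valued, so its coefficients of opposite index are
    conjugate.\<close>
  have qneg: "fourier_coeff q m = 0" if "m < 0" for m
  proof -
    have "fourier_coeff q m = cnj (fourier_coeff q (- m))"
      unfolding fourier_coeff_def
    proof (subst Bochner_Integration.integral_cnj[symmetric], rule integral_cong_AE)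
      show "AE z in circle_m. q z * z powi - m = cnj (q z * z powi - (- m))"
        using AE_circle_norm_powi[of m]
      proof eventually_elim
        case (elim z)
        note cnj_powi[OF this]
        then show ?case by (simp add: q_real)
      qed
    qed (use L1_measurable[OF qL1] in measurable)
    then show ?thesis using qpos[of "-m"] that by simp
  qed
  have "AE z in circle_m. q z - of_real C = 0"
  proof (rule fourier_uniqueness)
    show "L1 (\<lambda>z. q z - of_real C)"
      using qL1 by (simp add: L1_def)
    show "\<forall>j. fourier_coeff (\<lambda>z. q z - of_real C) j = 0"
    proof
      fix j :: int
      have "fourier_coeff (\<lambda>z. q z - of_real C) j = fourier_coeff q j - fourier_coeff (\<lambda>_. of_real C) j"
        by (rule fourier_coeff_diff[OF qL1]) (simp add: L1_def)
      also have "\<dots> = 0"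
        using q0 qpos[of j] qneg[of j] by (cases "j = 0"; cases "j < 0") (simp_all add: fourier_coeff_const)
      finally show "fourier_coeff (\<lambda>z. q z - of_real C) j = 0" .
    qed
  qed
  then have qC: "AE z in circle_m. q z = of_real C" by eventually_elim simp
  have "C > 0"
  proof -
    have "C \<noteq> 0"
    proof
      assume "C = 0"
      then have "AE z in circle_m. \<forall>i<n. \<psi> i z = 0"
        using normsq_L2v_eq_0D[OF \<psi>L2] by (simp add: C_def)
      then have "AE z in circle_m. \<forall>i<n. p i z = f i z"
        by eventually_elim (simp add: \<psi>_def)
      then have "f \<in> K"
        by (rule closed_subspace_cong_AE[OF K p(1) NL2[OF f(1)]])
      with f(2) show False by simp
    qed
    then show ?thesis using normsq_L2v_nonneg[of n \<psi>] by (simp add: C_def)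
  qed
  define \<eta> where "\<eta> = (\<lambda>i z. of_real (1 / sqrt C) * \<psi> i z)"
  have \<eta>N: "\<eta> \<in> N \<phi> r"
    unfolding \<eta>_def by (rule closed_subspace_cmult[OF closed_subspace_N \<psi>N])
  note \<eta>L2 = NL2[OF \<eta>N]
  have \<phi>M: "\<phi> l \<in> M" if "l < r" for l
    using \<phi> that by (simp add: wandering_def)
  have \<eta>orth: "AE z in circle_m. \<forall>l<r. (\<Sum>i<n. \<eta> i z * cnj (\<phi> l i z)) = 0"
    using \<eta>N by (simp add: N_def)
  then have \<eta>orth': "AE z in circle_m. \<forall>l<r. (\<Sum>i<n. \<phi> l i z * cnj (\<eta> i z)) = 0"
  proof eventually_elim
    case (elim z)
    have eq: "(\<Sum>i<n. \<phi> l i z * cnj (\<eta> i z)) = cnj (\<Sum>i<n. \<eta> i z * cnj (\<phi> l i z))" for l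
      by (simp add: mult.commute)
    show ?case unfolding eq complex_cnj_zero_iff by (rule elim)
  qed
  have \<eta>1: "AE z in circle_m. (\<Sum>i<n. \<eta> i z * cnj (\<eta> i z)) = 1"
    using qC
  proof eventually_elim
    case (elim z)
    have "(\<Sum>i<n. \<eta> i z * cnj (\<eta> i z)) = of_real (1 / sqrt C) * of_real (1 / sqrt C) * q z"
      by (simp add: \<eta>_def q_def sum_distrib_left mult_ac)
    also have "\<dots> = of_real (1 / sqrt C * (1 / sqrt C) * C)"
      unfolding elim of_real_mult ..
    also have "1 / sqrt C * (1 / sqrt C) * C = 1"
      using \<open>C > 0\<close> by simp
    finally show ?case by simp
  qed
  define \<phi>' where "\<phi>' = \<phi>(r := \<eta>)"
  have "wandering \<phi>' (Suc r)"
    unfolding wandering_def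
  proof (intro conjI allI impI ballI)
    fix l assume "l < Suc r"
    then show "\<phi>' l \<in> M"
      using \<phi>M \<eta>N by (auto simp: \<phi>'_def N_def less_Suc_eq)
  next
    from wandering_orthonormal[OF \<phi>] \<eta>orth \<eta>orth' \<eta>1 show "AE z in circle_m. \<forall>l<Suc r. \<forall>l'<Suc r. (\<Sum>i<n. \<phi>' l i z * cnj (\<phi>' l' i z)) = (if l = l' then 1 else 0)"
    proof eventually_elim
      case (elim z)
      then show ?case
        by (auto simp: \<phi>'_def less_Suc_eq)
    qed
  next
    fix l u assume l: "l < Suc r" and u: "u \<in> M"
    show "inner_L2v n (\<lambda>i z. u i z * z powi 1) (\<phi>' l) = 0"
    proof (cases "l < r")
      case True
      then show ?thesis using \<phi> u by (simp add: wandering_def \<phi>'_def)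
    next
      case False
      then have l: "\<phi>' l = \<eta>" using l by (simp add: \<phi>'_def)
      \<comment> \<open>\<open>\<eta>\<close> is orthogonal to z N by construction. The part of
        \<open>u\<close> removed here is a combination of the \<open>\<phi> l\<close> and pointwise
        orthogonal to \<open>\<eta>\<close>, which extends the orthogonality to z M.\<close>
      define u' where "u' = (\<lambda>i z. u i z - (\<Sum>l<r. \<phi> l i z * (\<Sum>i<n. u i z * cnj (\<phi> l i z))))"
      have u'N: "u' \<in> N \<phi> r"
        unfolding u'_def by (rule wandering_remainder[OF \<phi> u])
      have "inner_L2v n (\<lambda>i z. u i z * z powi 1) \<eta> = inner_L2v n (\<lambda>i z. u' i z * z powi 1) \<eta>"
        unfolding inner_L2v_def
      proof (rule integral_cong_AE)
        show "AE z in circle_m. (\<Sum>i<n. u i z * z powi 1 * cnj (\<eta> i z)) = (\<Sum>i<n. u' i z * z powi 1 * cnj (\<eta> i z))"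
          using \<eta>orth'
        proof eventually_elim
          case (elim z)
          define G where "G l = (\<Sum>i<n. u i z * cnj (\<phi> l i z))" for l
          have diff: "u i z - u' i z = (\<Sum>l<r. \<phi> l i z * G l)" for i
            by (simp add: u'_def G_def)
          have "(\<Sum>i<n. (u i z - u' i z) * z powi 1 * cnj (\<eta> i z)) =
              (\<Sum>i<n. \<Sum>l<r. z powi 1 * G l * (\<phi> l i z * cnj (\<eta> i z)))"
            by (simp add: diff sum_distrib_left sum_distrib_right mult_ac)
          also have "\<dots> = (\<Sum>l<r. z powi 1 * G l * (\<Sum>i<n. \<phi> l i z * cnj (\<eta> i z)))"
            by (subst sum.swap) (simp only: sum_distrib_left)
          also have "\<dots> = 0" using elim by simp
          finally show ?case by (simp add: left_diff_distrib sum_subtractf)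
        qed
        show "(\<lambda>z. \<Sum>i<n. u i z * z powi 1 * cnj (\<eta> i z)) \<in> borel_measurable circle_m"
          by (rule borel_measurable_integrable[OF integrable_inner_L2v[OF L2v_mult_powi[OF M_L2v[OF u]] \<eta>L2]])
        show "(\<lambda>z. \<Sum>i<n. u' i z * z powi 1 * cnj (\<eta> i z)) \<in> borel_measurable circle_m"
          by (rule borel_measurable_integrable[OF integrable_inner_L2v[OF L2v_mult_powi[OF NL2[OF u'N]] \<eta>L2]])
      qed
      also have "\<dots> = cnj (inner_L2v n \<eta> (\<lambda>i z. u' i z * z powi 1))"
        by (rule inner_L2v_cnj)
      also have "inner_L2v n \<eta> (\<lambda>i z. u' i z * z powi 1) = of_real (1 / sqrt C) * inner_L2v n \<psi> (\<lambda>i z. u' i z * z powi 1)"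
        unfolding inner_L2v_def \<eta>_def mult.assoc sum_distrib_left[symmetric] by simp
      finally show ?thesis using orth[OF u'N] l by simp
    qed
  qed
  then show ?thesis by blast
qed

text \<open>A family of greatest length exists by \<open>wandering_le_rank\<close>. A nonzero
  remainder would allow one more vector, so \<open>f\<close> coincides a.e. with its pointwise
  projection.\<close>

lemma M_complete_system:
  obtains r \<phi> where "wandering \<phi> r"
    "\<And>f. f \<in> M \<Longrightarrow> AE z in circle_m. \<forall>i<n. f i z = (\<Sum>l<r. \<phi> l i z * (\<Sum>i<n. f i z * cnj (\<phi> l i z)))"
proof -
  have "\<exists>r. (\<exists>\<phi>. wandering \<phi> r) \<and> (\<forall>r'. (\<exists>\<phi>. wandering \<phi> r') \<longrightarrow> r' \<le> r)"
  proof (rule Nat.ex_has_greatest_nat[where b = k and k = 0])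
    show "\<exists>\<phi>. wandering \<phi> 0" by (simp add: wandering_def)
    show "\<forall>r. (\<exists>\<phi>. wandering \<phi> r) \<longrightarrow> r \<le> k" using wandering_le_rank by blast
  qed
  then obtain r where r: "\<exists>\<phi>. wandering \<phi> r" and max: "\<forall>r'. (\<exists>\<phi>. wandering \<phi> r') \<longrightarrow> r' \<le> r"
    by blast
  from r obtain \<phi> where \<phi>: "wandering \<phi> r" by blast
  have "AE z in circle_m. \<forall>i<n. f i z = (\<Sum>l<r. \<phi> l i z * (\<Sum>i<n. f i z * cnj (\<phi> l i z)))" if "f \<in> M" for f
  proof -
    have "AE z in circle_m. \<forall>i<n. f i z - (\<Sum>l<r. \<phi> l i z * (\<Sum>i<n. f i z * cnj (\<phi> l i z))) = 0"
      using wandering_extend[OF \<phi> wandering_remainder[OF \<phi> that]] spec[OF max, of "Suc r"] by auto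
    then show ?thesis
      by eventually_elim (intro allI impI, rule eq_iff_diff_eq_0[THEN iffD2], blast)
  qed
  with \<phi> show ?thesis using that by blast
qed

text \<open>The expansion of \<open>M_complete_system\<close> is applied to the columns of
  \<open>P / w\<close>; they lie in \<open>M\<close> because \<open>w\<close> times such a column is
  a column of \<open>P\<close> again.\<close>

theorem H1_factorization:
  obtains r \<phi> where "r \<le> k"
    "AE z in circle_m. \<forall>l<r. \<forall>l'<r. (\<Sum>i<n. \<phi> l i z * cnj (\<phi> l' i z)) = (if l = l' then 1 else 0)"
    "\<And>l i. l < r \<Longrightarrow> i < n \<Longrightarrow> H2 (\<lambda>z. of_real (w z) * \<phi> l i z)"
    "\<And>l j. l < r \<Longrightarrow> j < c \<Longrightarrow> H2 (\<lambda>z. \<Sum>i<n. P i j z / of_real (w z) * cnj (\<phi> l i z))"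
    "AE z in circle_m. \<forall>i<n. \<forall>j<c. P i j z =
       (\<Sum>l<r. of_real (w z) * \<phi> l i z * (\<Sum>i<n. P i j z / of_real (w z) * cnj (\<phi> l i z)))"
proof -
  obtain r \<phi> where \<phi>: "wandering \<phi> r" and compl:
    "\<And>f. f \<in> M \<Longrightarrow> AE z in circle_m. \<forall>i<n. f i z = (\<Sum>l<r. \<phi> l i z * (\<Sum>i<n. f i z * cnj (\<phi> l i z)))"
    by (rule M_complete_system) (erule that, blast)
  \<comment> \<open>Where \<open>w\<close> vanishes the quotient is 0 by convention. This is the
    right value, since the bound by \<open>w^2\<close> makes \<open>P\<close> vanish there too, up
    to a null set.\<close>
  define f where "f j i z = P i j z / of_real (w z)" for i j z
  have [measurable]: "P i j \<in> borel_measurable borel" if "i < n" "j < c" for i j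
    using L1_measurable[OF P_L1[OF that]] .
  have wf: "AE z in circle_m. \<forall>i<n. \<forall>j<c. of_real (w z) * f j i z = P i j z"
    using P_bound by eventually_elim (auto simp: f_def)
  have fM: "f j \<in> M" if j: "j < c" for j
  proof -
    have "L2 (f j i)" if i: "i < n" for i
    proof (rule L2_bound[OF w_L2])
      show "f j i \<in> borel_measurable borel"
        unfolding f_def using i j by measurable
      show "AE z in circle_m. cmod (f j i z) \<le> 1 * cmod (of_real (w z))"
        using P_bound
      proof eventually_elim
        case (elim z)
        then have "cmod (P i j z) \<le> \<bar>w z\<bar> * \<bar>w z\<bar>"
          using i j by (simp add: power2_eq_square abs_mult[symmetric])
        then show ?case
          by (cases "w z = 0") (auto simp: f_def norm_divide divide_le_eq)
      qed
    qed
    then have L2: "L2v n (f j)" by (simp add: L2v_def)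
    have "fourier_coeff (\<lambda>z. of_real (w z) * f j i z) m = 0" if i: "i < n" and "m < 0" for i m
    proof -
      have "fourier_coeff (\<lambda>z. of_real (w z) * f j i z) m = fourier_coeff (P i j) m"
      proof (rule fourier_coeff_cong_AE)
        show "(\<lambda>z. of_real (w z) * f j i z) \<in> borel_measurable borel"
          by (rule L1_measurable[OF L1_w_mult[OF L2 i]])
        show "AE z in circle_m. of_real (w z) * f j i z = P i j z"
          using wf by eventually_elim (use i j in auto)
      qed (use i j in measurable)
      then show ?thesis using P_coeff[OF i j \<open>m < 0\<close>] by simp
    qed
    moreover have "in_range (f j) z" for z
      unfolding in_range_def
    proof (intro allI impI)
      fix y assume "\<forall>j<c. (\<Sum>i<n. cnj (y i) * P i j z) = 0"
      then have "(\<Sum>i<n. cnj (y i) * P i j z) / of_real (w z) = 0" using j by simp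
      then show "(\<Sum>i<n. cnj (y i) * f j i z) = 0" by (simp add: f_def sum_divide_distrib)
    qed
    ultimately show ?thesis using L2 by (simp add: M_def)
  qed
  have "AE z in circle_m. \<forall>j\<in>{..<c}. \<forall>i<n. f j i z = (\<Sum>l<r. \<phi> l i z * (\<Sum>i<n. f j i z * cnj (\<phi> l i z)))"
    by (rule AE_finite_allI) (use compl fM in auto)
  with wf have fact: "AE z in circle_m. \<forall>i<n. \<forall>j<c. P i j z =
       (\<Sum>l<r. of_real (w z) * \<phi> l i z * (\<Sum>i<n. f j i z * cnj (\<phi> l i z)))"
  proof eventually_elim
    case (elim z)
    show ?case
    proof (intro allI impI)
      fix i j assume ij: "i < n" "j < c"
      have "P i j z = of_real (w z) * f j i z" using elim(1) ij by simp
      also have "f j i z = (\<Sum>l<r. \<phi> l i z * (\<Sum>i<n. f j i z * cnj (\<phi> l i z)))"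
        using elim(2) ij by blast
      finally show "P i j z = (\<Sum>l<r. of_real (w z) * \<phi> l i z * (\<Sum>i<n. f j i z * cnj (\<phi> l i z)))"
        by (simp only: sum_distrib_left mult.assoc)
    qed
  qed
  show ?thesis
  proof (rule that[OF wandering_le_rank[OF \<phi>]])
    show "AE z in circle_m. \<forall>l<r. \<forall>l'<r. (\<Sum>i<n. \<phi> l i z * cnj (\<phi> l' i z)) = (if l = l' then 1 else 0)"
      by (rule wandering_orthonormal[OF \<phi>])
    show "H2 (\<lambda>z. of_real (w z) * \<phi> l i z)" if "l < r" "i < n" for l i
    proof (rule H2_w_mult_bounded)
      show "\<phi> l \<in> M" using \<phi> that by (simp add: wandering_def)
      show "AE z in circle_m. cmod (\<phi> l i z) \<le> 1"
        using wandering_bounded[OF \<phi> that(1)] by eventually_elim (use that in simp)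
    qed (rule that)
    show "H2 (\<lambda>z. \<Sum>i<n. P i j z / of_real (w z) * cnj (\<phi> l i z))" if "l < r" "j < c" for l j
      using wandering_coefficient_H2[OF \<phi> that(1) fM[OF that(2)]] by (simp add: f_def)
    show "AE z in circle_m. \<forall>i<n. \<forall>j<c. P i j z =
       (\<Sum>l<r. of_real (w z) * \<phi> l i z * (\<Sum>i<n. P i j z / of_real (w z) * cnj (\<phi> l i z)))"
      using fact by (simp add: f_def)
  qed
qed

end

subsection \<open>Rank factorizations\<close>

text \<open>Passes from the rank of vector space theory to coordinate sums. A maximal independent
  set of columns serves two purposes: that it spans yields factorizations, that it is independent
  yields upper bounds for the rank.\<close>

lemma mrank_maximal:
  assumes "A \<in> carrier_mat n m"
  obtains S :: "complex Matrix.vec set"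
  where "S \<subseteq> set (cols A)" "finite S" "card S = mrank A"
    "\<And>a. (\<And>i. i < n \<Longrightarrow> (\<Sum>v\<in>S. a v * v $ i) = 0) \<Longrightarrow> \<forall>v\<in>S. a v = 0"
    "\<And>v. v \<in> set (cols A) \<Longrightarrow> \<exists>a. \<forall>i<n. v $ i = (\<Sum>u\<in>S. a u * u $ i)"
proof -
  interpret vec_space "TYPE(complex)" n .
  let ?P = "\<lambda>T. T \<subseteq> set (cols A) \<and> lin_indpt T"
  have cols: "set (cols A) \<subseteq> carrier_vec n"
    using assms cols_dim by blast
  obtain S where S: "maximal S ?P"
    using maximal_exists[of ?P "card (set (cols A))" "{}"]
    by (meson List.finite_set card_mono empty_iff empty_subsetI finite_lin_indpt2 rev_finite_subset)
  then have Ssub: "S \<subseteq> set (cols A)" and Sind: "lin_indpt S"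
    by (auto simp: maximal_def)
  have finS: "finite S" using Ssub finite_subset by auto
  have Scar: "S \<subseteq> carrier_vec n" using Ssub cols by auto
  have "card S = mrank A"
    using rank_card_indpt[OF assms S] assms by (simp add: mrank_def)
  moreover have "\<forall>v\<in>S. a v = 0" if a: "\<And>i. i < n \<Longrightarrow> (\<Sum>v\<in>S. a v * v $ i) = 0" for a
  proof (rule ccontr)
    assume "\<not> (\<forall>v\<in>S. a v = 0)"
    then obtain v where v: "v \<in> S" "a v \<noteq> 0" by auto
    have "lincomb a S = 0\<^sub>v n"
    proof (rule eq_vecI)
      show "dim_vec (lincomb a S) = dim_vec (0\<^sub>v n)"
        using lincomb_dim[OF finS Scar] by simp
      show "lincomb a S $ i = 0\<^sub>v n $ i" if "i < dim_vec (0\<^sub>v n)" for i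
        using lincomb_index[of i S a] Scar a that by simp
    qed
    then have "lin_dep S"
      using lin_dep_crit[OF finS subset_refl, where a = a and v = v] v by auto
    with Sind show False by simp
  qed
  moreover have "\<exists>a. \<forall>i<n. v $ i = (\<Sum>u\<in>S. a u * u $ i)" if v: "v \<in> set (cols A)" for v
  proof -
    have "v \<in> span S"
    proof (rule ccontr)
      assume nv: "v \<notin> span S"
      then have "v \<notin> S" using span_mem[OF Scar] by auto
      have "lin_indpt (insert v S)"
        using lin_dep_iff_in_span[OF Scar Sind _ \<open>v \<notin> S\<close>] cols v nv by auto
      then have "?P (insert v S)" using v Ssub by auto
      then have "S = insert v S"
        using S unfolding maximal_def by blast
      then show False using \<open>v \<notin> S\<close> by auto
    qed
    then obtain a where "v = lincomb a S"
      using finite_span[OF finS] Scar by auto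
    then show ?thesis
      using lincomb_index[of _ S a] Scar by auto
  qed
  ultimately show ?thesis using that Ssub finS by blast
qed

lemma mrank_factorization:
  assumes A: "A \<in> carrier_mat n m" and l: "mrank A \<le> l"
  obtains X Y where "\<And>i j. i < n \<Longrightarrow> j < m \<Longrightarrow> A $$ (i, j) = (\<Sum>q<l. X i q * Y q j)"
proof -
  obtain S :: "complex Matrix.vec set" where S: "S \<subseteq> set (cols A)" "finite S" "card S = mrank A"
    "\<And>v. v \<in> set (cols A) \<Longrightarrow> \<exists>a. \<forall>i<n. v $ i = (\<Sum>u\<in>S. a u * u $ i)"
    using mrank_maximal[OF A] by metis
  from S(4) obtain a where a: "\<And>(v :: complex Matrix.vec) i. v \<in> set (cols A) \<Longrightarrow> i < n \<Longrightarrow> v $ i = (\<Sum>u\<in>S. a v u * u $ i)"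
    by metis
  obtain e where e: "bij_betw e {..<card S} S"
    using ex_bij_betw_nat_finite[OF S(2)] by (auto simp: atLeast0LessThan)
  \<comment> \<open>Padding with zeros allows any inner dimension from the rank upwards.\<close>
  define X where "X i q = (if q < card S then e q $ i else 0)" for i q
  define Y where "Y q j = a (col A j) (e q)" for q j
  have "A $$ (i, j) = (\<Sum>q<l. X i q * Y q j)" if ij: "i < n" "j < m" for i j
  proof -
    have "col A j \<in> set (cols A)"
      using A ij by (auto simp: cols_def)
    then have "A $$ (i, j) = (\<Sum>u\<in>S. a (col A j) u * u $ i)"
      using a[of "col A j" i] A ij by simp
    also have "\<dots> = (\<Sum>q<card S. a (col A j) (e q) * e q $ i)"
      by (rule sum.reindex_bij_betw[OF e, symmetric])
    also have "\<dots> = (\<Sum>q<card S. X i q * Y q j)"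
      by (intro sum.cong) (auto simp: X_def Y_def)
    also have "\<dots> = (\<Sum>q<l. X i q * Y q j)"
      by (rule sum.mono_neutral_left) (use S(3) l in \<open>auto simp: X_def\<close>)
    finally show ?thesis .
  qed
  then show ?thesis using that by blast
qed

text \<open>If the rank exceeded l, there would be more than l independent columns, and a solution
  of the l equations given by the matching columns of \<open>Y\<close> would be a nontrivial
  relation between them.\<close>

lemma mrank_leI:
  assumes A: "A \<in> carrier_mat n m"
    and XY: "\<And>i j. i < n \<Longrightarrow> j < m \<Longrightarrow> A $$ (i, j) = (\<Sum>q<l. X i q * Y q j)"
  shows "mrank A \<le> l"
proof (rule ccontr)
  assume "\<not> mrank A \<le> l"
  obtain S :: "complex Matrix.vec set" where S: "S \<subseteq> set (cols A)" "finite S" "card S = mrank A"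
    "\<And>a. (\<And>i. i < n \<Longrightarrow> (\<Sum>v\<in>S. a v * v $ i) = 0) \<Longrightarrow> \<forall>v\<in>S. a v = 0"
    using mrank_maximal[OF A] by metis
  have "\<forall>v\<in>S. \<exists>j<m. v = col A j"
    using S(1) A by (fastforce simp: cols_def)
  then obtain J where J: "\<And>v. v \<in> S \<Longrightarrow> J v < m" "\<And>v. v \<in> S \<Longrightarrow> v = col A (J v)"
    by metis
  obtain a where a: "\<exists>v\<in>S. a v \<noteq> 0" "\<And>q. q < l \<Longrightarrow> (\<Sum>v\<in>S. Y q (J v) * a v) = 0"
    using exists_kernel_vector[OF S(2), of l "\<lambda>q v. Y q (J v)"] S(3) \<open>\<not> mrank A \<le> l\<close> by auto
  have "(\<Sum>v\<in>S. a v * v $ i) = 0" if i: "i < n" for i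
  proof -
    have "v $ i = (\<Sum>q<l. X i q * Y q (J v))" if "v \<in> S" for v
    proof -
      have "v $ i = col A (J v) $ i" using J(2)[OF that] by simp
      also have "\<dots> = A $$ (i, J v)" using A i J(1)[OF that] by simp
      finally show ?thesis using XY[OF i J(1)[OF that]] by simp
    qed
    then have "(\<Sum>v\<in>S. a v * v $ i) = (\<Sum>v\<in>S. \<Sum>q<l. X i q * (Y q (J v) * a v))"
      by (intro sum.cong) (auto simp: sum_distrib_left mult_ac)
    also have "\<dots> = (\<Sum>q<l. X i q * (\<Sum>v\<in>S. Y q (J v) * a v))"
      by (subst sum.swap) (simp add: sum_distrib_left)
    finally show ?thesis using a(2) by simp
  qed
  then have "\<forall>v\<in>S. a v = 0" using S(4) by blast
  with a(1) show False by auto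
qed

lemma mrank_zero: "mrank (0\<^sub>m n m) = 0"
  by (simp add: mrank_def vec_space.rank_0I)

lemma mat_mult_entry:
  assumes "A \<in> carrier_mat n m" "B \<in> carrier_mat m p" "i < n" "j < p"
  shows "(A * B) $$ (i, j) = (\<Sum>q<m. A $$ (i, q) * B $$ (q, j))"
  using assms by (simp add: scalar_prod_def atLeast0LessThan)

lemma mat_vec_entry:
  assumes "A \<in> carrier_mat n m" "x \<in> carrier_vec m" "i < n"
  shows "(A *\<^sub>v x) $ i = (\<Sum>q<m. A $$ (i, q) * x $ q)"
  using assms by (simp add: scalar_prod_def atLeast0LessThan)

lemma mrank_mult_le:
  assumes A: "A \<in> carrier_mat n m" and B: "B \<in> carrier_mat m p"
  shows "mrank (A * B) \<le> mrank A"
proof -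
  obtain X Y where XY: "\<And>i j. i < n \<Longrightarrow> j < m \<Longrightarrow> A $$ (i, j) = (\<Sum>q<mrank A. X i q * Y q j)"
    using mrank_factorization[OF A order_refl] by blast
  show ?thesis
  proof (rule mrank_leI)
    show "A * B \<in> carrier_mat n p" using A B by simp
    fix i j assume ij: "i < n" "j < p"
    have "(A * B) $$ (i, j) = (\<Sum>s<m. \<Sum>q<mrank A. X i q * (Y q s * B $$ (s, j)))"
      unfolding mat_mult_entry[OF A B ij] using ij
      by (intro sum.cong) (auto simp: XY sum_distrib_left sum_distrib_right mult_ac)
    also have "\<dots> = (\<Sum>q<mrank A. X i q * (\<Sum>s<m. Y q s * B $$ (s, j)))"
      by (subst sum.swap) (simp add: sum_distrib_left)
    finally show "(A * B) $$ (i, j) = (\<Sum>q<mrank A. X i q * (\<Sum>s<m. Y q s * B $$ (s, j)))" .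
  qed
qed

lemma mrank_le_rows:
  assumes A: "A \<in> carrier_mat n m"
  shows "mrank A \<le> n"
proof (rule mrank_leI[OF A, where l = n and X = "\<lambda>i q. if i = q then 1 else 0" and Y = "\<lambda>q j. A $$ (q, j)"])
  fix i j assume "i < n" "j < m"
  have "(\<Sum>q<n. (if i = q then 1 else 0) * A $$ (q, j)) = (\<Sum>q<n. if i = q then A $$ (q, j) else 0)"
    by (intro sum.cong) auto
  then show "A $$ (i, j) = (\<Sum>q<n. (if i = q then 1 else 0) * A $$ (q, j))"
    using \<open>i < n\<close> by simp
qed

subsection \<open>Operator norm\<close>

declare minus_carrier_mat [simp]

lemma vnorm_eq: "x \<in> carrier_vec m \<Longrightarrow> vnorm x = L2_set (\<lambda>i. cmod (x $ i)) {..<m}"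
  by (simp add: vnorm_def L2_set_def)

lemma vnorm_nonneg: "0 \<le> vnorm x"
  by (simp add: vnorm_def sum_nonneg)

lemma vnorm_sq: "x \<in> carrier_vec m \<Longrightarrow> (vnorm x)\<^sup>2 = (\<Sum>i<m. (cmod (x $ i))\<^sup>2)"
  by (simp add: vnorm_def sum_nonneg)

lemma entry_le_vnorm: "x \<in> carrier_vec m \<Longrightarrow> i < m \<Longrightarrow> cmod (x $ i) \<le> vnorm x"
  by (auto simp: vnorm_eq intro!: member_le_L2_set)

lemma vnorm_smult: "vnorm (c \<cdot>\<^sub>v x) = cmod c * vnorm x"
  by (simp add: vnorm_def norm_mult power_mult_distrib sum_distrib_left[symmetric] real_sqrt_mult)

lemma vnorm_add:
  assumes "x \<in> carrier_vec m" "y \<in> carrier_vec m"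
  shows "vnorm (x + y) \<le> vnorm x + vnorm y"
proof -
  have "vnorm (x + y) = L2_set (\<lambda>i. cmod (x $ i + y $ i)) {..<m}"
    using assms by (simp add: vnorm_eq[of "x + y" m] L2_set_def)
  also have "\<dots> \<le> L2_set (\<lambda>i. cmod (x $ i) + cmod (y $ i)) {..<m}"
    by (rule L2_set_mono) (auto intro: norm_triangle_ineq)
  also have "\<dots> \<le> vnorm x + vnorm y"
    using assms by (simp add: vnorm_eq L2_set_triangle_ineq)
  finally show ?thesis .
qed

lemma vnorm_le_sum:
  assumes "x \<in> carrier_vec m"
  shows "vnorm x \<le> (\<Sum>i<m. cmod (x $ i))"
  using assms by (simp add: vnorm_eq L2_set_le_sum)

lemma norm_sum_mult_le_vnorm:
  assumes "x \<in> carrier_vec m" "y \<in> carrier_vec m"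
  shows "cmod (\<Sum>i<m. cnj (x $ i) * y $ i) \<le> vnorm x * vnorm y"
proof -
  have "cmod (\<Sum>i<m. cnj (x $ i) * y $ i) \<le> (\<Sum>i<m. \<bar>cmod (x $ i)\<bar> * \<bar>cmod (y $ i)\<bar>)"
    by (rule order_trans[OF norm_sum]) (simp add: norm_mult)
  also have "\<dots> \<le> L2_set (\<lambda>i. cmod (x $ i)) {..<m} * L2_set (\<lambda>i. cmod (y $ i)) {..<m}"
    by (rule L2_set_mult_ineq)
  finally show ?thesis using assms by (simp add: vnorm_eq)
qed

lemma vnorm_mult_le_sum:
  assumes A: "A \<in> carrier_mat n m" and x: "x \<in> carrier_vec m"
  shows "vnorm (A *\<^sub>v x) \<le> (\<Sum>i<n. \<Sum>j<m. cmod (A $$ (i, j))) * vnorm x"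
proof -
  have "vnorm (A *\<^sub>v x) \<le> (\<Sum>i<n. cmod ((A *\<^sub>v x) $ i))"
    by (rule vnorm_le_sum[OF mult_mat_vec_carrier[OF A x]])
  also have "\<dots> \<le> (\<Sum>i<n. (\<Sum>j<m. cmod (A $$ (i, j))) * vnorm x)"
  proof (rule sum_mono)
    fix i assume "i \<in> {..<n}"
    then have "cmod ((A *\<^sub>v x) $ i) \<le> (\<Sum>j<m. cmod (A $$ (i, j) * x $ j))"
      using mat_vec_entry[OF A x, of i] norm_sum by simp
    also have "\<dots> \<le> (\<Sum>j<m. cmod (A $$ (i, j)) * vnorm x)"
      using entry_le_vnorm[OF x] by (intro sum_mono) (auto simp: norm_mult intro!: mult_left_mono)
    finally show "cmod ((A *\<^sub>v x) $ i) \<le> (\<Sum>j<m. cmod (A $$ (i, j))) * vnorm x"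
      by (simp add: sum_distrib_right)
  qed
  finally show ?thesis by (simp add: sum_distrib_right)
qed

lemma vnorm_zero: "vnorm (0\<^sub>v m) = 0"
  by (simp add: vnorm_def)

lemma mult_mat_zero_vec: "A \<in> carrier_mat n m \<Longrightarrow> A *\<^sub>v 0\<^sub>v m = 0\<^sub>v n"
  by (intro eq_vecI) (auto simp: scalar_prod_def)

lemma opnorm_bdd: "bdd_above {vnorm (A *\<^sub>v x) |x. x \<in> carrier_vec (dim_col A) \<and> vnorm x \<le> 1}"
proof -
  let ?C = "\<Sum>i<dim_row A. \<Sum>j<dim_col A. cmod (A $$ (i, j))"
  have A: "A \<in> carrier_mat (dim_row A) (dim_col A)" by simp
  have "vnorm (A *\<^sub>v x) \<le> ?C" if "x \<in> carrier_vec (dim_col A)" "vnorm x \<le> 1" for x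
    using vnorm_mult_le_sum[OF A that(1)] mult_left_mono[OF that(2), of ?C] by (simp add: sum_nonneg)
  then show ?thesis by (intro bdd_aboveI[of _ ?C]) auto
qed

lemma opnorm_nonneg: "0 \<le> opnorm A"
proof -
  have A: "A \<in> carrier_mat (dim_row A) (dim_col A)" by simp
  have "vnorm (A *\<^sub>v 0\<^sub>v (dim_col A)) \<le> opnorm A"
    unfolding opnorm_def using opnorm_bdd[of A] by (intro cSup_upper) (auto simp: vnorm_zero)
  then show ?thesis using mult_mat_zero_vec[OF A] by (simp add: vnorm_zero)
qed

lemma vnorm_mult_le_opnorm:
  assumes A: "A \<in> carrier_mat n m" and x: "x \<in> carrier_vec m"
  shows "vnorm (A *\<^sub>v x) \<le> opnorm A * vnorm x"
proof (cases "vnorm x = 0")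
  case True
  then have "vnorm (A *\<^sub>v x) \<le> 0"
    using vnorm_mult_le_sum[OF A x] by simp
  then show ?thesis using True by simp
next
  case False
  then have pos: "vnorm x > 0" using vnorm_nonneg[of x] by simp
  define c where "c = complex_of_real (1 / vnorm x)"
  have "A *\<^sub>v (c \<cdot>\<^sub>v x) = c \<cdot>\<^sub>v (A *\<^sub>v x)"
    using A x by (rule mult_mat_vec)
  moreover have "vnorm (A *\<^sub>v (c \<cdot>\<^sub>v x)) \<le> opnorm A"
    unfolding opnorm_def using opnorm_bdd[of A] A x pos
    by (intro cSup_upper) (auto simp: vnorm_smult c_def norm_divide)
  ultimately have "vnorm (A *\<^sub>v x) / vnorm x \<le> opnorm A"
    using pos by (simp add: vnorm_smult c_def norm_divide)
  then show ?thesis using pos by (simp add: pos_divide_le_eq)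
qed

lemma opnorm_leI:
  assumes A: "A \<in> carrier_mat n m" and c: "0 \<le> c"
    and le: "\<And>x. x \<in> carrier_vec m \<Longrightarrow> vnorm (A *\<^sub>v x) \<le> c * vnorm x"
  shows "opnorm A \<le> c"
  unfolding opnorm_def
proof (rule cSup_least)
  show "{vnorm (A *\<^sub>v x) |x. x \<in> carrier_vec (dim_col A) \<and> vnorm x \<le> 1} \<noteq> {}"
    by (auto intro!: exI[of _ "0\<^sub>v (dim_col A)"] simp: vnorm_zero)
  fix y assume "y \<in> {vnorm (A *\<^sub>v x) |x. x \<in> carrier_vec (dim_col A) \<and> vnorm x \<le> 1}"
  then obtain x where x: "x \<in> carrier_vec m" "vnorm x \<le> 1" "y = vnorm (A *\<^sub>v x)"
    using A by auto
  then show "y \<le> c"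
    using le[OF x(1)] mult_left_mono[OF x(2) c] by simp
qed

lemma opnorm_le_sum:
  assumes "A \<in> carrier_mat n m"
  shows "opnorm A \<le> (\<Sum>i<n. \<Sum>j<m. cmod (A $$ (i, j)))"
  using vnorm_mult_le_sum[OF assms] by (intro opnorm_leI[OF assms]) (auto simp: sum_nonneg)

lemma opnorm_add:
  assumes A: "A \<in> carrier_mat n m" and B: "B \<in> carrier_mat n m"
  shows "opnorm (A + B) \<le> opnorm A + opnorm B"
proof (rule opnorm_leI)
  show "A + B \<in> carrier_mat n m" using A B by simp
  fix x :: "complex Matrix.vec" assume x: "x \<in> carrier_vec m"
  have "vnorm ((A + B) *\<^sub>v x) = vnorm (A *\<^sub>v x + B *\<^sub>v x)"
    using add_mult_distrib_mat_vec[OF A B x] by simp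
  also have "\<dots> \<le> vnorm (A *\<^sub>v x) + vnorm (B *\<^sub>v x)"
    by (rule vnorm_add[OF mult_mat_vec_carrier[OF A x] mult_mat_vec_carrier[OF B x]])
  also have "\<dots> \<le> opnorm A * vnorm x + opnorm B * vnorm x"
    by (intro add_mono vnorm_mult_le_opnorm[OF A x] vnorm_mult_le_opnorm[OF B x])
  finally show "vnorm ((A + B) *\<^sub>v x) \<le> (opnorm A + opnorm B) * vnorm x"
    by (simp add: distrib_right)
qed (simp add: opnorm_nonneg)

lemma opnorm_mult:
  assumes A: "A \<in> carrier_mat n m" and B: "B \<in> carrier_mat m p"
  shows "opnorm (A * B) \<le> opnorm A * opnorm B"
proof (rule opnorm_leI)
  show "A * B \<in> carrier_mat n p" using A B by simp
  fix x :: "complex Matrix.vec" assume x: "x \<in> carrier_vec p"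
  have "vnorm ((A * B) *\<^sub>v x) = vnorm (A *\<^sub>v (B *\<^sub>v x))"
    using assoc_mult_mat_vec[OF A B x] by simp
  also have "\<dots> \<le> opnorm A * vnorm (B *\<^sub>v x)"
    using B x by (intro vnorm_mult_le_opnorm[OF A]) auto
  also have "\<dots> \<le> opnorm A * (opnorm B * vnorm x)"
    by (intro mult_left_mono vnorm_mult_le_opnorm[OF B x] opnorm_nonneg)
  finally show "vnorm ((A * B) *\<^sub>v x) \<le> opnorm A * opnorm B * vnorm x"
    by (simp add: mult.assoc)
qed (simp add: opnorm_nonneg)

lemma entry_le_opnorm:
  assumes A: "A \<in> carrier_mat n m" and ij: "i < n" "j < m"
  shows "cmod (A $$ (i, j)) \<le> opnorm A"
proof -
  have u: "vnorm (unit_vec m j) = 1"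
  proof -
    have "(vnorm (unit_vec m j))\<^sup>2 = (\<Sum>i<m. (cmod (unit_vec m j $ i))\<^sup>2)"
      by (rule vnorm_sq) simp
    also have "\<dots> = (\<Sum>i<m. if i = j then 1 else 0)"
      by (intro sum.cong) (auto simp: unit_vec_def)
    also have "\<dots> = (1::real)" using ij by (subst sum.delta) auto
    finally have "(vnorm (unit_vec m j))\<^sup>2 = 1" .
    then show ?thesis using vnorm_nonneg[of "unit_vec m j"] by (simp add: power2_eq_1_iff)
  qed
  have "(A *\<^sub>v unit_vec m j) $ i = A $$ (i, j)"
    using A ij by simp
  then have "cmod (A $$ (i, j)) \<le> vnorm (A *\<^sub>v unit_vec m j)"
    using entry_le_vnorm[of "A *\<^sub>v unit_vec m j" n i] A ij by simp
  also have "\<dots> \<le> opnorm A"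
    using vnorm_mult_le_opnorm[OF A, of "unit_vec m j"] u by simp
  finally show ?thesis .
qed

lemma opnorm_lipschitz:
  assumes A: "A \<in> carrier_mat n m" and B: "B \<in> carrier_mat n m"
  shows "opnorm A \<le> opnorm B + opnorm (A - B)"
proof -
  have "A = B + (A - B)" using A B by (intro eq_matI) auto
  then show ?thesis using opnorm_add[of B n m "A - B"] A B minus_carrier_mat[OF B] by metis
qed

subsection \<open>Singular values and the trace\<close>

lemma sval_bdd: "bdd_below {opnorm (A - B) |B. B \<in> carrier_mat (dim_row A) (dim_col A) \<and> mrank B \<le> j}"
  by (rule bdd_belowI[of _ 0]) (auto simp: opnorm_nonneg)

lemma sval_le:
  assumes "A \<in> carrier_mat n m" "B \<in> carrier_mat n m" "mrank B \<le> j"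
  shows "sval j A \<le> opnorm (A - B)"
  unfolding sval_def using assms by (intro cInf_lower sval_bdd) auto

lemma sval_ne: "{opnorm (A - B) |B. B \<in> carrier_mat (dim_row A) (dim_col A) \<and> mrank B \<le> j} \<noteq> {}"
  by (auto intro!: exI[of _ "0\<^sub>m (dim_row A) (dim_col A)"] simp: mrank_zero)

lemma sval_nonneg: "0 \<le> sval j A"
  unfolding sval_def by (rule cInf_greatest[OF sval_ne]) (auto simp: opnorm_nonneg)

lemma sval_approx:
  assumes A: "A \<in> carrier_mat n m" and e: "e > 0"
  obtains B where "B \<in> carrier_mat n m" "mrank B \<le> j" "opnorm (A - B) < sval j A + e"
proof -
  have "Inf {opnorm (A - B) |B. B \<in> carrier_mat (dim_row A) (dim_col A) \<and> mrank B \<le> j} < sval j A + e"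
    using e by (simp add: sval_def)
  then obtain y where "y \<in> {opnorm (A - B) |B. B \<in> carrier_mat (dim_row A) (dim_col A) \<and> mrank B \<le> j}"
    "y < sval j A + e"
    by (subst (asm) cInf_less_iff[OF sval_ne sval_bdd]) auto
  then show ?thesis using that A by auto
qed

lemma sval_eq_0:
  assumes A: "A \<in> carrier_mat n m" and "n \<le> j"
  shows "sval j A = 0"
proof -
  have "opnorm (A - A) \<le> 0"
    using opnorm_le_sum[of "A - A" n m] A by simp
  then show ?thesis
    using sval_le[OF A A, of j] mrank_le_rows[OF A] assms sval_nonneg[of j A] by simp
qed

lemma sval_lipschitz:
  assumes A: "A \<in> carrier_mat n m" and A': "A' \<in> carrier_mat n m"
  shows "sval j A \<le> sval j A' + opnorm (A - A')"
proof (rule field_le_epsilon)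
  fix e :: real assume "e > 0"
  then obtain B where B: "B \<in> carrier_mat n m" "mrank B \<le> j" "opnorm (A' - B) < sval j A' + e"
    using sval_approx[OF A'] by blast
  have "A - B = (A' - B) + (A - A')" using A A' B by (intro eq_matI) auto
  then have "opnorm (A - B) \<le> opnorm (A' - B) + opnorm (A - A')"
    using opnorm_add[of "A' - B" n m "A - A'"] A A' B by simp
  then show "sval j A \<le> sval j A' + opnorm (A - A') + e"
    using sval_le[OF A B(1,2)] B(3) by simp
qed

text \<open>An approximant \<open>B\<close> of rank at most j yields the approximant
  \<open>B F\<close> of the product, without increase of rank.\<close>

lemma sval_mult:
  assumes A: "A \<in> carrier_mat n m" and F: "F \<in> carrier_mat m p"
  shows "sval j (A * F) \<le> sval j A * opnorm F"
proof (rule field_le_epsilon)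
  fix e :: real assume e: "e > 0"
  define d where "d = e / (opnorm F + 1)"
  have d: "d > 0" using e opnorm_nonneg[of F] by (simp add: d_def)
  obtain B where B: "B \<in> carrier_mat n m" "mrank B \<le> j" "opnorm (A - B) < sval j A + d"
    using sval_approx[OF A d] by blast
  have "sval j (A * F) \<le> opnorm (A * F - B * F)"
    using A B F mrank_mult_le[OF B(1) F] by (intro sval_le[of _ n p]) auto
  also have "A * F - B * F = (A - B) * F"
    using minus_mult_distrib_mat[OF A B(1) F] by simp
  also have "opnorm ((A - B) * F) \<le> opnorm (A - B) * opnorm F"
    using A B F by (intro opnorm_mult[of _ n m]) auto
  also have "\<dots> \<le> (sval j A + d) * opnorm F"
    using B(3) by (intro mult_right_mono opnorm_nonneg) simp
  also have "\<dots> \<le> sval j A * opnorm F + e"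
    using e opnorm_nonneg[of F] by (simp add: d_def field_simps)
  finally show "sval j (A * F) \<le> sval j A * opnorm F + e" .
qed

lemma mtrace_mult:
  assumes "A \<in> carrier_mat n m" "B \<in> carrier_mat m n"
  shows "mtrace (A * B) = (\<Sum>i<n. \<Sum>q<m. A $$ (i, q) * B $$ (q, i))"
  using assms mat_mult_entry[OF assms] by (simp add: mtrace_def del: index_mult_mat(1))

text \<open>Subtracting the component along \<open>c\<close> is a contraction also if
  \<open>c\<close> is shorter than a unit vector. This freedom covers c = 0, which may occur in the
  trace estimate.\<close>

lemma vnorm_sub_projection_le:
  fixes c :: "nat \<Rightarrow> complex"
  assumes v: "v \<in> carrier_vec m" and c: "(\<Sum>i<m. (cmod (c i))\<^sup>2) \<le> 1"
  shows "vnorm (Matrix.vec m (\<lambda>i. v $ i - c i * (\<Sum>q<m. cnj (c q) * v $ q))) \<le> vnorm v"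
proof (rule power2_le_imp_le[OF _ vnorm_nonneg])
  let ?u = "Matrix.vec m (\<lambda>i. v $ i - c i * (\<Sum>q<m. cnj (c q) * v $ q))"
  define t where "t = (\<Sum>q<m. cnj (c q) * v $ q)"
  have "(vnorm ?u)\<^sup>2 = (\<Sum>i<m. (cmod (v $ i + (- t) * c i))\<^sup>2)"
    by (subst vnorm_sq[of _ m]) (auto simp: t_def mult.commute)
  also have "\<dots> = (\<Sum>i<m. (cmod (v $ i))\<^sup>2) + 2 * Re (cnj (- t) * (\<Sum>i<m. v $ i * cnj (c i)))
      + (cmod t)\<^sup>2 * (\<Sum>i<m. (cmod (c i))\<^sup>2)"
    unfolding norm_add_cmult_sq sum.distrib sum_distrib_left Re_sum by (simp only: norm_minus_cancel)
  also have "(\<Sum>i<m. v $ i * cnj (c i)) = t"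
    by (simp add: t_def mult.commute)
  also have "cnj (- t) * t = - of_real ((cmod t)\<^sup>2)"
    unfolding complex_norm_square by simp
  also have "(\<Sum>i<m. (cmod (v $ i))\<^sup>2) + 2 * Re (- of_real ((cmod t)\<^sup>2)) + (cmod t)\<^sup>2 * (\<Sum>i<m. (cmod (c i))\<^sup>2)
      \<le> (\<Sum>i<m. (cmod (v $ i))\<^sup>2)"
  proof -
    have "(cmod t)\<^sup>2 * (\<Sum>i<m. (cmod (c i))\<^sup>2) \<le> (cmod t)\<^sup>2 * 1"
      by (intro mult_left_mono c) simp
    moreover have "0 \<le> (cmod t)\<^sup>2" by simp
    moreover have "Re (- of_real ((cmod t)\<^sup>2)) = - ((cmod t)\<^sup>2)" by (simp del: of_real_power)
    ultimately show ?thesis by linarith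
  qed
  finally show "(vnorm ?u)\<^sup>2 \<le> (vnorm v)\<^sup>2"
    using v by (simp add: vnorm_sq)
qed

text \<open>A vector \<open>c\<close> in the range of \<open>B\<close> annihilated by a near-optimal rank \<open>l\<close> approximant of \<open>A\<close>
  satisfies \<open>\<parallel>A c\<parallel> \<le> s\<^sub>l(A) + \<epsilon>\<close>; compressing \<open>B\<close> to the orthogonal complement of \<open>c\<close> lowers its rank
  and changes the trace by \<open>c\<^sup>* B A c\<close>. No singular value decomposition is needed.\<close>
lemma trace_le_sval_sum_epsilon:
  fixes X Y :: "nat \<Rightarrow> nat \<Rightarrow> complex"
  assumes A: "A \<in> carrier_mat n m" and B: "B \<in> carrier_mat m n" and e: "e > 0"
    and J: "finite J" "card J = l"
    and XY: "\<And>i j. i < m \<Longrightarrow> j < n \<Longrightarrow> B $$ (i, j) = (\<Sum>p\<in>J. X i p * Y p j)"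
  shows "cmod (mtrace (A * B)) \<le> (\<Sum>j<l. sval j A + e) * opnorm B"
  using B J XY
proof (induction l arbitrary: B J X Y)
  case 0
  then have "B $$ (i, j) = 0" if "i < m" "j < n" for i j
    using that by simp
  then have "mtrace (A * B) = 0"
    unfolding mtrace_mult[OF A 0(1)] by simp
  then show ?case by simp
next
  case (Suc l)
  note B = Suc.prems(1) and J = Suc.prems(2,3) and XY = Suc.prems(4)
  obtain C where C: "C \<in> carrier_mat n m" "mrank C \<le> l" "opnorm (A - C) < sval l A + e"
    using sval_approx[OF A e] by blast
  obtain U V where UV: "\<And>i j. i < n \<Longrightarrow> j < m \<Longrightarrow> C $$ (i, j) = (\<Sum>q<l. U i q * V q j)"
    using mrank_factorization[OF C(1,2)] by blast
  \<comment> \<open>There are l equations and l + 1 indices in \<open>J\<close>: the image of the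
    solution under \<open>X\<close> is killed by \<open>V\<close>, hence by
    \<open>C\<close>.\<close>
  obtain a where a: "\<exists>p\<in>J. a p \<noteq> 0" "\<And>q. q < l \<Longrightarrow> (\<Sum>p\<in>J. (\<Sum>j<m. V q j * X j p) * a p) = 0"
    using exists_kernel_vector[OF J(1), of l "\<lambda>q p. \<Sum>j<m. V q j * X j p"] J(2) by auto
  define c' where "c' i = (\<Sum>p\<in>J. X i p * a p)" for i
  define s where "s = sqrt (\<Sum>i<m. (cmod (c' i))\<^sup>2)"
  \<comment> \<open>If \<open>c'\<close> is zero, then s = 0 and division makes \<open>c\<close>
    zero; \<open>c_sq\<close>, \<open>c_proj\<close> and \<open>Cc\<close> remain valid.\<close>
  define c where "c i = c' i / of_real s" for i
  define cv where "cv = Matrix.vec m c"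
  have cv: "cv \<in> carrier_vec m" and cv_nth: "\<And>q. q < m \<Longrightarrow> cv $ q = c q"
    by (simp_all add: cv_def)
  have s2: "s\<^sup>2 = (\<Sum>i<m. (cmod (c' i))\<^sup>2)" by (simp add: s_def sum_nonneg)
  have c_sq: "(\<Sum>i<m. (cmod (c i))\<^sup>2) \<le> 1"
  proof -
    have "(\<Sum>i<m. (cmod (c i))\<^sup>2) = (\<Sum>i<m. (cmod (c' i))\<^sup>2) / s\<^sup>2"
      by (simp add: c_def norm_divide power_divide sum_divide_distrib)
    then show ?thesis by (simp add: s2[symmetric])
  qed
  have cv_le: "vnorm cv \<le> 1"
  proof -
    have "(vnorm cv)\<^sup>2 = (\<Sum>i<m. (cmod (c i))\<^sup>2)"
      unfolding vnorm_sq[OF cv] by (simp add: cv_def)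
    then have "(vnorm cv)\<^sup>2 \<le> 1\<^sup>2" using c_sq by simp
    then show ?thesis by (rule power2_le_imp_le) simp
  qed
  have c_proj: "c' i = c i * (\<Sum>q<m. cnj (c q) * c' q)" if "i < m" for i
  proof (cases "s = 0")
    case True
    then have "\<forall>i<m. c' i = 0"
      using s2 by (auto simp: sum_nonneg_eq_0_iff)
    then show ?thesis using that by simp
  next
    case False
    have "(\<Sum>q<m. cnj (c q) * c' q) = of_real (s\<^sup>2) / of_real s"
      unfolding s2 of_real_sum complex_norm_square by (simp add: c_def sum_divide_distrib mult.commute)
    then show ?thesis using False by (simp add: c_def power2_eq_square)
  qed
  have Cc: "(\<Sum>j<m. C $$ (i, j) * c j) = 0" if "i < n" for i
  proof -
    have "(\<Sum>j<m. C $$ (i, j) * c' j) = (\<Sum>j<m. \<Sum>q<l. \<Sum>p\<in>J. U i q * (V q j * X j p * a p))"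
      using that by (intro sum.cong) (auto simp: UV c'_def sum_distrib_left sum_distrib_right mult_ac sum.swap[of _ J])
    also have "\<dots> = (\<Sum>q<l. \<Sum>p\<in>J. \<Sum>j<m. U i q * (V q j * X j p * a p))"
      by (subst sum.swap) (intro sum.cong refl sum.swap)
    also have "\<dots> = (\<Sum>q<l. U i q * (\<Sum>p\<in>J. (\<Sum>j<m. V q j * X j p) * a p))"
      by (simp add: sum_distrib_left sum_distrib_right)
    also have "\<dots> = 0" using a(2) by simp
    finally have "(\<Sum>j<m. C $$ (i, j) * c' j) / of_real s = 0" by simp
    then show ?thesis by (simp add: c_def sum_divide_distrib)
  qed
  have Ac: "vnorm (A *\<^sub>v cv) \<le> sval l A + e"
  proof -
    have "A *\<^sub>v cv = (A - C) *\<^sub>v cv"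
    proof (rule eq_vecI)
      fix i assume "i < dim_vec ((A - C) *\<^sub>v cv)"
      then have i: "i < n" using A C by simp
      have "((A - C) *\<^sub>v cv) $ i = (\<Sum>j<m. A $$ (i, j) * c j) - (\<Sum>j<m. C $$ (i, j) * c j)"
        using A C i mat_vec_entry[of "A - C" n m cv i] cv
        by (simp add: cv_nth left_diff_distrib sum_subtractf del: index_mult_mat_vec)
      then show "(A *\<^sub>v cv) $ i = ((A - C) *\<^sub>v cv) $ i"
        using Cc[OF i] mat_vec_entry[OF A cv i] by (simp add: cv_nth del: index_mult_mat_vec)
    qed (use A C in auto)
    also have "vnorm ((A - C) *\<^sub>v cv) \<le> opnorm (A - C) * vnorm cv"
      using C by (intro vnorm_mult_le_opnorm[of _ n m] cv) simp
    also have "\<dots> \<le> opnorm (A - C)"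
      using cv_le opnorm_nonneg by (simp add: mult_left_le)
    finally show ?thesis using C(3) by simp
  qed
  \<comment> \<open>\<open>r\<close> is the adjoint of \<open>c\<close> times \<open>B\<close>, so
    \<open>B'\<close> is \<open>B\<close> with the component of every column along \<open>c\<close>
    removed.\<close>
  define r where "r j = (\<Sum>q<m. cnj (c q) * B $$ (q, j))" for j
  define B' where "B' = Matrix.mat m n (\<lambda>(i, j). B $$ (i, j) - c i * r j)"
  have B': "B' \<in> carrier_mat m n" by (simp add: B'_def)
  have opB': "opnorm B' \<le> opnorm B"
  proof (rule opnorm_leI[OF B' opnorm_nonneg])
    fix x :: "complex Matrix.vec" assume x: "x \<in> carrier_vec n"
    let ?v = "B *\<^sub>v x"
    have v: "?v \<in> carrier_vec m" by (rule mult_mat_vec_carrier[OF B x])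
    have "B' *\<^sub>v x = Matrix.vec m (\<lambda>i. ?v $ i - c i * (\<Sum>q<m. cnj (c q) * ?v $ q))"
    proof (rule eq_vecI)
      fix i assume "i < dim_vec (Matrix.vec m (\<lambda>i. ?v $ i - c i * (\<Sum>q<m. cnj (c q) * ?v $ q)))"
      then have i: "i < m" by simp
      have "(\<Sum>q<m. cnj (c q) * ?v $ q) = (\<Sum>q<m. \<Sum>j<n. cnj (c q) * B $$ (q, j) * x $ j)"
        by (intro sum.cong) (auto simp: mat_vec_entry[OF B x] sum_distrib_left mult.assoc simp del: index_mult_mat_vec)
      also have "\<dots> = (\<Sum>j<n. r j * x $ j)"
        by (subst sum.swap) (simp add: r_def sum_distrib_right)
      finally have R: "(\<Sum>q<m. cnj (c q) * ?v $ q) = (\<Sum>j<n. r j * x $ j)" .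
      have "(B' *\<^sub>v x) $ i = (\<Sum>j<n. B $$ (i, j) * x $ j) - c i * (\<Sum>j<n. r j * x $ j)"
        unfolding mat_vec_entry[OF B' x i] using i
        by (simp add: B'_def left_diff_distrib sum_subtractf sum_distrib_left mult.assoc)
      then show "(B' *\<^sub>v x) $ i = Matrix.vec m (\<lambda>i. ?v $ i - c i * (\<Sum>q<m. cnj (c q) * ?v $ q)) $ i"
        using i R mat_vec_entry[OF B x i] by (simp del: index_mult_mat_vec)
    qed (use B' in auto)
    then have "vnorm (B' *\<^sub>v x) \<le> vnorm ?v"
      using vnorm_sub_projection_le[OF v c_sq] by simp
    also have "\<dots> \<le> opnorm B * vnorm x" by (rule vnorm_mult_le_opnorm[OF B x])
    finally show "vnorm (B' *\<^sub>v x) \<le> opnorm B * vnorm x" .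
  qed
  \<comment> \<open>\<open>X'\<close> annihilates \<open>a\<close>, so its column \<open>p0\<close>
    is a combination of the others and can be eliminated. Factorizations are indexed by a finite set
    \<open>J\<close> in order that such an index may simply be dropped.\<close>
  obtain p0 where p0: "p0 \<in> J" "a p0 \<noteq> 0" using a(1) by auto
  define X' where "X' i p = X i p - c i * (\<Sum>q<m. cnj (c q) * X q p)" for i p
  have X'a: "(\<Sum>p\<in>J. X' i p * a p) = 0" if "i < m" for i
  proof -
    have "(\<Sum>p\<in>J. (\<Sum>q<m. cnj (c q) * X q p) * a p) = (\<Sum>q<m. cnj (c q) * c' q)"
      unfolding c'_def sum_distrib_left sum_distrib_right by (subst sum.swap) (simp add: mult.assoc)
    then have "(\<Sum>p\<in>J. X' i p * a p) = c' i - c i * (\<Sum>q<m. cnj (c q) * c' q)"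
      by (simp add: X'_def c'_def left_diff_distrib sum_subtractf sum_distrib_left[symmetric] mult.assoc)
    then show ?thesis using c_proj[OF that] by simp
  qed
  have B'_X': "B' $$ (i, j) = (\<Sum>p\<in>J. X' i p * Y p j)" if "i < m" "j < n" for i j
  proof -
    have "r j = (\<Sum>q<m. \<Sum>p\<in>J. cnj (c q) * X q p * Y p j)"
      using that by (simp add: r_def XY sum_distrib_left mult.assoc)
    also have "\<dots> = (\<Sum>p\<in>J. (\<Sum>q<m. cnj (c q) * X q p) * Y p j)"
      by (subst sum.swap) (simp add: sum_distrib_right)
    finally show ?thesis
      using that
      by (simp add: B'_def X'_def XY left_diff_distrib sum_subtractf sum_distrib_left sum_distrib_right mult.assoc)
  qed
  have "cmod (mtrace (A * B')) \<le> (\<Sum>j<l. sval j A + e) * opnorm B'"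
  proof (rule Suc.IH[OF B'])
    show "finite (J - {p0})" "card (J - {p0}) = l" using J p0 by auto
    fix i j assume ij: "i < m" "j < n"
    have "X' i p0 * a p0 = - (\<Sum>p\<in>J - {p0}. X' i p * a p)"
      using X'a[OF ij(1)] sum.remove[OF J(1) p0(1), of "\<lambda>p. X' i p * a p"] by (simp add: eq_neg_iff_add_eq_0)
    then have "X' i p0 = - (\<Sum>p\<in>J - {p0}. X' i p * a p) / a p0"
      using p0(2) by (simp add: field_simps)
    then have X0: "X' i p0 * Y p0 j = - (\<Sum>p\<in>J - {p0}. X' i p * (a p / a p0 * Y p0 j))"
      by (simp add: sum_distrib_right sum_divide_distrib mult.assoc)
    have "B' $$ (i, j) = X' i p0 * Y p0 j + (\<Sum>p\<in>J - {p0}. X' i p * Y p j)"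
      unfolding B'_X'[OF ij] by (rule sum.remove[OF J(1) p0(1)])
    also have "\<dots> = (\<Sum>p\<in>J - {p0}. X' i p * (Y p j - a p / a p0 * Y p0 j))"
      unfolding X0 by (simp add: right_diff_distrib sum_subtractf)
    finally show "B' $$ (i, j) = (\<Sum>p\<in>J - {p0}. X' i p * (Y p j - a p / a p0 * Y p0 j))" .
  qed
  also have "\<dots> \<le> (\<Sum>j<l. sval j A + e) * opnorm B"
    using e sval_nonneg by (intro mult_left_mono opB' sum_nonneg add_nonneg_nonneg) auto
  finally have tr': "cmod (mtrace (A * B')) \<le> (\<Sum>j<l. sval j A + e) * opnorm B" .
  have "mtrace (A * B) = mtrace (A * B') + (\<Sum>i<n. \<Sum>q<m. A $$ (i, q) * (c q * r i))"
    unfolding mtrace_mult[OF A B] mtrace_mult[OF A B'] sum.distrib[symmetric]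
    by (intro sum.cong refl) (auto simp: B'_def algebra_simps)
  moreover have "(\<Sum>i<n. \<Sum>q<m. A $$ (i, q) * (c q * r i)) = (\<Sum>q<m. cnj (cv $ q) * (B *\<^sub>v (A *\<^sub>v cv)) $ q)"
  proof -
    have Acv: "A *\<^sub>v cv \<in> carrier_vec n" by (rule mult_mat_vec_carrier[OF A cv])
    have "(\<Sum>i<n. \<Sum>q<m. A $$ (i, q) * (c q * r i)) = (\<Sum>i<n. r i * (A *\<^sub>v cv) $ i)"
      by (intro sum.cong refl)
         (auto simp: mat_vec_entry[OF A cv] cv_nth sum_distrib_left mult_ac simp del: index_mult_mat_vec)
    also have "\<dots> = (\<Sum>i<n. \<Sum>q<m. cnj (c q) * (B $$ (q, i) * (A *\<^sub>v cv) $ i))"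
      by (simp only: r_def sum_distrib_right mult.assoc)
    also have "\<dots> = (\<Sum>q<m. \<Sum>i<n. cnj (c q) * (B $$ (q, i) * (A *\<^sub>v cv) $ i))"
      by (rule sum.swap)
    also have "\<dots> = (\<Sum>q<m. cnj (cv $ q) * (B *\<^sub>v (A *\<^sub>v cv)) $ q)"
      by (intro sum.cong refl)
         (auto simp: mat_vec_entry[OF B Acv] cv_nth sum_distrib_left simp del: index_mult_mat_vec)
    finally show ?thesis .
  qed
  moreover have "cmod (\<Sum>q<m. cnj (cv $ q) * (B *\<^sub>v (A *\<^sub>v cv)) $ q) \<le> (sval l A + e) * opnorm B"
  proof -
    have Acv: "A *\<^sub>v cv \<in> carrier_vec n" by (rule mult_mat_vec_carrier[OF A cv])
    have "cmod (\<Sum>q<m. cnj (cv $ q) * (B *\<^sub>v (A *\<^sub>v cv)) $ q) \<le> vnorm cv * vnorm (B *\<^sub>v (A *\<^sub>v cv))"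
      by (rule norm_sum_mult_le_vnorm[OF cv mult_mat_vec_carrier[OF B Acv]])
    also have "\<dots> \<le> 1 * vnorm (B *\<^sub>v (A *\<^sub>v cv))"
      by (intro mult_right_mono cv_le vnorm_nonneg)
    also have "\<dots> \<le> opnorm B * vnorm (A *\<^sub>v cv)"
      using vnorm_mult_le_opnorm[OF B Acv] by simp
    also have "\<dots> \<le> opnorm B * (sval l A + e)"
      by (intro mult_left_mono Ac opnorm_nonneg)
    finally show ?thesis by (simp add: mult.commute)
  qed
  ultimately have "cmod (mtrace (A * B)) \<le> (\<Sum>j<l. sval j A + e) * opnorm B + (sval l A + e) * opnorm B"
    using tr' by (smt (verit) norm_triangle_ineq)
  then show ?case by (simp add: distrib_right)
qed

theorem trace_le_sval_sum:
  assumes A: "A \<in> carrier_mat n m" and B: "B \<in> carrier_mat m n" and l: "mrank B \<le> l"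
  shows "cmod (mtrace (A * B)) \<le> (\<Sum>j<l. sval j A) * opnorm B"
proof (rule field_le_epsilon)
  fix d :: real assume d: "d > 0"
  define e where "e = d / (real l * opnorm B + 1)"
  have pos: "real l * opnorm B + 1 > 0" using opnorm_nonneg[of B] by (simp add: add_nonneg_pos)
  have e: "e > 0" using d pos by (simp add: e_def)
  obtain X Y where XY: "\<And>i j. i < m \<Longrightarrow> j < n \<Longrightarrow> B $$ (i, j) = (\<Sum>q<l. X i q * Y q j)"
    using mrank_factorization[OF B l] by blast
  have "cmod (mtrace (A * B)) \<le> (\<Sum>j<l. sval j A + e) * opnorm B"
    by (rule trace_le_sval_sum_epsilon[OF A B e, of "{..<l}"]) (use XY in auto)
  also have "\<dots> = (\<Sum>j<l. sval j A) * opnorm B + e * (real l * opnorm B)"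
    by (simp add: sum.distrib algebra_simps)
  also have "e * (real l * opnorm B) \<le> e * (real l * opnorm B + 1)"
    using e by simp
  also have "e * (real l * opnorm B + 1) = d"
    using pos by (simp add: e_def)
  finally show "cmod (mtrace (A * B)) \<le> (\<Sum>j<l. sval j A) * opnorm B + d" by simp
qed

section \<open>Trace norm\<close>

lemma tnorm_nonneg: "0 \<le> tnorm A"
  by (simp add: tnorm_def sum_nonneg sval_nonneg)

corollary trace_le_tnorm:
  assumes A: "A \<in> carrier_mat n m" and B: "B \<in> carrier_mat m n"
  shows "cmod (mtrace (A * B)) \<le> tnorm A * opnorm B"
proof -
  have "cmod (mtrace (A * B)) \<le> (\<Sum>j<m. sval j A) * opnorm B"
    by (rule trace_le_sval_sum[OF A B mrank_le_rows[OF B]])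
  also have "(\<Sum>j<m. sval j A) \<le> tnorm A"
    unfolding tnorm_def using A by (intro sum_mono2) (auto simp: sval_nonneg)
  finally show ?thesis by (simp add: mult_right_mono opnorm_nonneg)
qed

lemma tnorm_eq:
  assumes A: "A \<in> carrier_mat n m"
  shows "tnorm A = (\<Sum>j<n. sval j A)"
  unfolding tnorm_def using A sval_eq_0[OF A]
  by (intro sum.mono_neutral_right) auto

lemma tnorm_mult:
  assumes A: "A \<in> carrier_mat n m" and F: "F \<in> carrier_mat m p"
  shows "tnorm (A * F) \<le> tnorm A * opnorm F"
proof -
  have "A * F \<in> carrier_mat n p" using A F by simp
  then show ?thesis
    using sval_mult[OF A F] by (simp add: tnorm_eq[OF A] tnorm_eq sum_distrib_right sum_mono)
qed

lemma mat_fun_carrier: "mat_fun X n m F \<Longrightarrow> F z \<in> carrier_mat n m"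
  and mat_fun_entry: "mat_fun X n m F \<Longrightarrow> i < n \<Longrightarrow> j < m \<Longrightarrow> X (\<lambda>z. F z $$ (i, j))"
  by (auto simp: mat_fun_def)

lemma mat_fun_mono: "mat_fun X n m F \<Longrightarrow> (\<And>f. X f \<Longrightarrow> Z f) \<Longrightarrow> mat_fun Z n m F"
  by (auto simp: mat_fun_def)

subsection \<open>Measurability of matrix norms\<close>

text \<open>McShane's formula writes a Lipschitz function as a countable infimum.\<close>
lemma measurable_mat_lipschitz:
  fixes q :: "complex mat \<Rightarrow> real" and F :: "complex \<Rightarrow> complex mat"
  assumes F: "mat_fun (\<lambda>f. f \<in> borel_measurable borel) n m F"
    and q0: "\<And>A. A \<in> carrier_mat n m \<Longrightarrow> 0 \<le> q A"
    and lip: "\<And>A B. A \<in> carrier_mat n m \<Longrightarrow> B \<in> carrier_mat n m \<Longrightarrow>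
      q A \<le> q B + (\<Sum>i<n. \<Sum>j<m. cmod (A $$ (i, j) - B $$ (i, j)))"
  shows "(\<lambda>z. q (F z)) \<in> borel_measurable borel"
proof -
  obtain D :: "complex set" where D: "countable D" "\<And>X. open X \<Longrightarrow> X \<noteq> {} \<Longrightarrow> \<exists>d\<in>D. d \<in> X"
    using countable_dense_exists by metis
  \<comment> \<open>The infimum runs over the matrices with entries in the countable dense set
    \<open>D\<close>.\<close>
  define I where "I = PiE ({..<n} \<times> {..<m}) (\<lambda>_. D)"
  have I: "countable I"
    unfolding I_def using D(1) by (intro countable_PiE) auto
  define d where "d A f = (\<Sum>i<n. \<Sum>j<m. cmod (A $$ (i, j) - f (i, j)))" for A :: "complex mat" and f
  have lip1: "q A \<le> q (Matrix.mat n m f) + d A f" if "A \<in> carrier_mat n m" for A f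
    using lip[OF that, of "Matrix.mat n m f"] by (simp add: d_def)
  have lip2: "q (Matrix.mat n m f) \<le> q A + d A f" if "A \<in> carrier_mat n m" for A f
    using lip[of "Matrix.mat n m f" A] that by (simp add: d_def norm_minus_commute)
  have approx: "\<exists>f\<in>I. d A f \<le> e" if e: "e > 0" for A e
  proof -
    define \<epsilon> where "\<epsilon> = e / (real n * real m + 1)"
    have nm: "real n * real m + 1 > 0" by (simp add: add_nonneg_pos)
    then have "\<epsilon> > 0" using e by (simp add: \<epsilon>_def)
    then have "\<exists>d\<in>D. d \<in> ball w \<epsilon>" for w
      by (intro D(2)) auto
    then obtain g where g: "\<And>w. g w \<in> D" "\<And>w. g w \<in> ball w \<epsilon>" by metis
    define f where "f = restrict (\<lambda>p. g (A $$ p)) ({..<n} \<times> {..<m})"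
    have "f \<in> I" using g by (auto simp: f_def I_def)
    moreover have "d A f \<le> (\<Sum>i<n. \<Sum>j<m. \<epsilon>)"
      unfolding d_def
    proof (intro sum_mono)
      fix i j assume "i \<in> {..<n}" "j \<in> {..<m}"
      then show "cmod (A $$ (i, j) - f (i, j)) \<le> \<epsilon>"
        using g(2)[of "A $$ (i, j)"] by (simp add: f_def dist_norm)
    qed
    moreover have "(\<Sum>i<n. \<Sum>j<m. \<epsilon>) \<le> \<epsilon> * (real n * real m + 1)"
      using \<open>\<epsilon> > 0\<close> by (simp add: algebra_simps)
    moreover have "\<epsilon> * (real n * real m + 1) = e" using nm by (simp add: \<epsilon>_def)
    ultimately show ?thesis by (auto intro!: bexI[of _ f])
  qed
  have eq: "q A = (INF f\<in>I. q (Matrix.mat n m f) + d A f)" if A: "A \<in> carrier_mat n m" for A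
  proof (rule antisym)
    have "I \<noteq> {}" using approx[of 1] by auto
    then show "q A \<le> (INF f\<in>I. q (Matrix.mat n m f) + d A f)"
      using lip1[OF A] by (intro cINF_greatest) auto
    show "(INF f\<in>I. q (Matrix.mat n m f) + d A f) \<le> q A"
    proof (rule field_le_epsilon)
      fix e :: real assume "e > 0"
      then obtain f where f: "f \<in> I" "d A f \<le> e / 2" using approx[of "e / 2"] by auto
      have bdd: "bdd_below ((\<lambda>f. q (Matrix.mat n m f) + d A f) ` I)"
        by (rule bdd_belowI[of _ 0]) (auto simp: q0 d_def intro!: add_nonneg_nonneg sum_nonneg)
      have "(INF f\<in>I. q (Matrix.mat n m f) + d A f) \<le> q (Matrix.mat n m f) + d A f"
        by (rule cINF_lower[OF bdd f(1)])
      also have "\<dots> \<le> q A + d A f + d A f" using lip2[OF A, of f] by simp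
      finally show "(INF f\<in>I. q (Matrix.mat n m f) + d A f) \<le> q A + e" using f(2) by simp
    qed
  qed
  have "(\<lambda>z. INF f\<in>I. q (Matrix.mat n m f) + d (F z) f) \<in> borel_measurable borel"
    using I mat_fun_entry[OF F] unfolding d_def by (intro borel_measurable_cINF_real) auto
  then show ?thesis using eq[OF mat_fun_carrier[OF F]] by simp
qed

text \<open>Operator norms and singular values are extrema over uncountable families, so
  measurability is not inherited directly; it comes from Lipschitz dependence on the
  entries.\<close>

lemma measurable_opnorm:
  assumes F: "mat_fun (\<lambda>f. f \<in> borel_measurable borel) n m F"
  shows "(\<lambda>z. opnorm (F z)) \<in> borel_measurable borel"
proof (rule measurable_mat_lipschitz[OF F])
  fix A B :: "complex mat" assume A: "A \<in> carrier_mat n m" and B: "B \<in> carrier_mat n m"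
  show "opnorm A \<le> opnorm B + (\<Sum>i<n. \<Sum>j<m. cmod (A $$ (i, j) - B $$ (i, j)))"
    using opnorm_lipschitz[OF A B] opnorm_le_sum[OF minus_carrier_mat[OF B], of A] A B by simp
qed (auto simp: opnorm_nonneg)

lemma measurable_sval:
  assumes F: "mat_fun (\<lambda>f. f \<in> borel_measurable borel) n m F"
  shows "(\<lambda>z. sval l (F z)) \<in> borel_measurable borel"
proof (rule measurable_mat_lipschitz[OF F])
  fix A B :: "complex mat" assume A: "A \<in> carrier_mat n m" and B: "B \<in> carrier_mat n m"
  show "sval l A \<le> sval l B + (\<Sum>i<n. \<Sum>j<m. cmod (A $$ (i, j) - B $$ (i, j)))"
    using sval_lipschitz[OF A B, of l] opnorm_le_sum[OF minus_carrier_mat[OF B], of A] A B by simp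
qed (auto simp: sval_nonneg)

lemma measurable_tnorm:
  assumes F: "mat_fun (\<lambda>f. f \<in> borel_measurable borel) n m F"
  shows "(\<lambda>z. tnorm (F z)) \<in> borel_measurable borel"
  unfolding tnorm_eq[OF mat_fun_carrier[OF F]] by (intro borel_measurable_sum measurable_sval[OF F])

lemma mat_minus_zero: "A \<in> carrier_mat n m \<Longrightarrow> A - 0\<^sub>m n m = (A :: complex mat)"
  by (intro eq_matI) auto

lemma tnorm_le_opnorm:
  assumes A: "A \<in> carrier_mat n m"
  shows "tnorm A \<le> real n * opnorm A"
proof -
  have "sval j A \<le> opnorm A" for j
    using sval_le[OF A, of "0\<^sub>m n m" j] by (simp add: mrank_zero mat_minus_zero[OF A])
  then have "(\<Sum>j<n. sval j A) \<le> (\<Sum>j<n. opnorm A)" by (intro sum_mono)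
  then show ?thesis by (simp add: tnorm_eq[OF A])
qed

section \<open>Square integrability of the matrix norms\<close>

lemma integrable_opnorm_sq:
  assumes F: "mat_fun L2 n m F"
  shows "integrable circle_m (\<lambda>z. (opnorm (F z))\<^sup>2)"
proof -
  note e = mat_fun_entry[OF F] and c = mat_fun_carrier[OF F]
  have meas [measurable]: "(\<lambda>z. opnorm (F z)) \<in> borel_measurable borel"
    by (rule measurable_opnorm[OF mat_fun_mono[OF F L2_measurable]])
  have "L2 (\<lambda>z. of_real (cmod (F z $$ (i, j))))" if "i < n" "j < m" for i j
    by (rule L2_bound[OF e[OF that], where C = 1]) (use L2_measurable[OF e[OF that]] in auto)
  then have S: "L2 (\<lambda>z. \<Sum>i<n. \<Sum>j<m. of_real (cmod (F z $$ (i, j))))"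
    by (intro L2_sum) auto
  have "L2 (\<lambda>z. complex_of_real (opnorm (F z)))"
  proof (rule L2_bound[OF S, where C = 1])
    show "AE z in circle_m. cmod (complex_of_real (opnorm (F z))) \<le>
        1 * cmod (\<Sum>i<n. \<Sum>j<m. complex_of_real (cmod (F z $$ (i, j))))"
      using opnorm_le_sum[OF c] unfolding of_real_sum[symmetric]
      by (intro AE_I2) (simp add: opnorm_nonneg sum_nonneg del: of_real_sum)
  qed simp
  then show ?thesis by (simp add: L2_def opnorm_nonneg)
qed

lemma measurable_opnorm_mat_fun: "mat_fun L2 n m F \<Longrightarrow> (\<lambda>z. opnorm (F z)) \<in> borel_measurable borel"
  by (rule measurable_opnorm[OF mat_fun_mono[OF _ L2_measurable]])

lemma measurable_tnorm_mat_fun: "mat_fun L2 n m F \<Longrightarrow> (\<lambda>z. tnorm (F z)) \<in> borel_measurable borel"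
  by (rule measurable_tnorm[OF mat_fun_mono[OF _ L2_measurable]])

lemma integrable_tnorm_sq:
  assumes F: "mat_fun L2 n m F"
  shows "integrable circle_m (\<lambda>z. (tnorm (F z))\<^sup>2)"
proof (rule Bochner_Integration.integrable_bound)
  note [measurable] = measurable_tnorm_mat_fun[OF F]
  show "integrable circle_m (\<lambda>z. (real n)\<^sup>2 * (opnorm (F z))\<^sup>2)"
    using integrable_opnorm_sq[OF F] by simp
  show "AE z in circle_m. norm ((tnorm (F z))\<^sup>2) \<le> norm ((real n)\<^sup>2 * (opnorm (F z))\<^sup>2)"
  proof (rule AE_I2)
    fix z
    show "norm ((tnorm (F z))\<^sup>2) \<le> norm ((real n)\<^sup>2 * (opnorm (F z))\<^sup>2)"
      using power_mono[OF tnorm_le_opnorm[OF mat_fun_carrier[OF F, of z]] tnorm_nonneg, of 2]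
      by (simp add: power_mult_distrib)
  qed
qed (use measurable_tnorm_mat_fun[OF F] in measurable)

subsection \<open>Rank \<open>k\<close> factorization of functions in \<open>\<A>\<^sub>k\<close>\<close>

lemma sum_norm_sq_orthonormal:
  fixes \<phi> :: "nat \<Rightarrow> nat \<Rightarrow> complex"
  assumes "\<And>l l'. l < r \<Longrightarrow> l' < r \<Longrightarrow> (\<Sum>i<n. \<phi> l i * cnj (\<phi> l' i)) = (if l = l' then 1 else 0)"
  shows "(\<Sum>i<n. (cmod (\<Sum>l<r. x l * \<phi> l i))\<^sup>2) = (\<Sum>l<r. (cmod (x l))\<^sup>2)"
proof -
  have "complex_of_real (\<Sum>i<n. (cmod (\<Sum>l<r. x l * \<phi> l i))\<^sup>2) =
      (\<Sum>i<n. (\<Sum>l<r. x l * \<phi> l i) * cnj (\<Sum>l<r. x l * \<phi> l i))"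
    by (rule sum_mult_cnj[symmetric])
  also have "\<dots> = (\<Sum>i<n. \<Sum>l<r. \<Sum>l'<r. x l * cnj (x l') * (\<phi> l i * cnj (\<phi> l' i)))"
    by (intro sum.cong refl) (simp add: sum_product mult_ac)
  also have "\<dots> = (\<Sum>l<r. \<Sum>l'<r. \<Sum>i<n. x l * cnj (x l') * (\<phi> l i * cnj (\<phi> l' i)))"
    by (subst sum.swap) (intro sum.cong refl sum.swap)
  also have "\<dots> = (\<Sum>l<r. \<Sum>l'<r. if l = l' then x l * cnj (x l') else 0)"
    using assms by (intro sum.cong refl) (simp add: sum_distrib_left[symmetric])
  also have "\<dots> = (\<Sum>l<r. x l * cnj (x l))"
    by (simp add: sum.delta)
  also have "\<dots> = complex_of_real (\<Sum>l<r. (cmod (x l))\<^sup>2)"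
    by (rule sum_mult_cnj)
  finally show ?thesis by (simp only: of_real_eq_iff)
qed

lemma Bessel_inequality:
  fixes \<phi> :: "nat \<Rightarrow> nat \<Rightarrow> complex"
  assumes on: "\<And>l l'. l < r \<Longrightarrow> l' < r \<Longrightarrow> (\<Sum>i<n. \<phi> l i * cnj (\<phi> l' i)) = (if l = l' then 1 else 0)"
  shows "(\<Sum>l<r. (cmod (\<Sum>i<n. v i * cnj (\<phi> l i)))\<^sup>2) \<le> (\<Sum>i<n. (cmod (v i))\<^sup>2)"
proof -
  define b where "b l = (\<Sum>i<n. v i * cnj (\<phi> l i))" for l
  define s where "s i = (\<Sum>l<r. b l * \<phi> l i)" for i
  have "(\<Sum>i<n. v i * cnj (s i)) = (\<Sum>i<n. \<Sum>l<r. cnj (b l) * (v i * cnj (\<phi> l i)))"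
    by (simp add: s_def sum_distrib_left mult_ac)
  also have "\<dots> = (\<Sum>l<r. cnj (b l) * b l)"
    by (subst sum.swap) (simp add: b_def sum_distrib_left)
  also have "\<dots> = complex_of_real (\<Sum>l<r. (cmod (b l))\<^sup>2)"
    unfolding sum_mult_cnj[symmetric] by (simp add: mult.commute)
  finally have vs: "(\<Sum>i<n. v i * cnj (s i)) = complex_of_real (\<Sum>l<r. (cmod (b l))\<^sup>2)" .
  have ss: "(\<Sum>i<n. (cmod (s i))\<^sup>2) = (\<Sum>l<r. (cmod (b l))\<^sup>2)"
    unfolding s_def by (rule sum_norm_sq_orthonormal[OF on])
  have "0 \<le> (\<Sum>i<n. (cmod (v i + (-1) * s i))\<^sup>2)" by (simp add: sum_nonneg)
  also have "\<dots> = (\<Sum>i<n. (cmod (v i))\<^sup>2) + 2 * Re (cnj (-1) * (\<Sum>i<n. v i * cnj (s i)))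
      + (cmod (-1))\<^sup>2 * (\<Sum>i<n. (cmod (s i))\<^sup>2)"
    unfolding norm_add_cmult_sq sum.distrib sum_distrib_left Re_sum ..
  also have "\<dots> = (\<Sum>i<n. (cmod (v i))\<^sup>2) - (\<Sum>l<r. (cmod (b l))\<^sup>2)"
    unfolding vs ss by (simp del: of_real_sum of_real_power)
  finally show ?thesis by (simp add: b_def)
qed

lemma A_set_integrable_opnorm:
  assumes "\<Psi> \<in> A_set n k"
  shows "integrable circle_m (\<lambda>z. opnorm (\<Psi> z))" "(\<integral>z. opnorm (\<Psi> z) \<partial>circle_m) \<le> 1"
proof -
  have f: "mat_fun H1_0 n n \<Psi>" and le: "(\<integral>\<^sup>+z. ennreal (opnorm (\<Psi> z)) \<partial>circle_m) \<le> 1"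
    using assms by (auto simp: A_set_def L1_op_norm_def)
  have [measurable]: "(\<lambda>z. opnorm (\<Psi> z)) \<in> borel_measurable borel"
    by (rule measurable_opnorm[OF mat_fun_mono[OF f]]) (simp add: H1_0_def L1_measurable)
  show int: "integrable circle_m (\<lambda>z. opnorm (\<Psi> z))"
    by (rule integrableI_nonneg) (use le in \<open>auto simp: opnorm_nonneg intro: le_less_trans\<close>)
  have "ennreal (\<integral>z. opnorm (\<Psi> z) \<partial>circle_m) \<le> ennreal 1"
    using le int by (simp add: nn_integral_eq_integral opnorm_nonneg)
  then show "(\<integral>z. opnorm (\<Psi> z) \<partial>circle_m) \<le> 1"
    by (simp only: ennreal_le_iff)
qed

text \<open>Orthonormality enters both bounds. On the first r coordinates \<open>F\<close> is
  \<open>w\<close> times an isometry; \<open>G x\<close> lists coefficients of the vector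
  \<open>\<Psi> x / w\<close>, whose length is at most \<open>w\<close> times that of
  \<open>x\<close>. Zero columns and rows fill up from r to k.\<close>

theorem A_set_factorization:
  assumes \<Psi>: "\<Psi> \<in> A_set n k"
  obtains F G where "mat_fun H2 n k F" "mat_fun H2 k n G"
    "\<And>l j m. l < k \<Longrightarrow> j < n \<Longrightarrow> m \<le> 0 \<Longrightarrow> fourier_coeff (\<lambda>z. G z $$ (l, j)) m = 0"
    "AE z in circle_m. \<Psi> z = F z * G z"
    "AE z in circle_m. (opnorm (F z))\<^sup>2 \<le> opnorm (\<Psi> z)"
    "AE z in circle_m. (opnorm (G z))\<^sup>2 \<le> opnorm (\<Psi> z)"
proof -
  have f: "mat_fun H1_0 n n \<Psi>" and rk: "AE z in circle_m. mrank (\<Psi> z) \<le> k"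
    using \<Psi> by (auto simp: A_set_def)
  have car: "\<Psi> z \<in> carrier_mat n n" for z using mat_fun_carrier[OF f] .
  have ent: "L1 (\<lambda>z. \<Psi> z $$ (i, j))" "\<And>m. m \<le> 0 \<Longrightarrow> fourier_coeff (\<lambda>z. \<Psi> z $$ (i, j)) m = 0"
    if "i < n" "j < n" for i j
    using mat_fun_entry[OF f that] by (auto simp: H1_0_def)
  define w where "w z = sqrt (opnorm (\<Psi> z))" for z
  have w2: "(w z)\<^sup>2 = opnorm (\<Psi> z)" for z by (simp add: w_def opnorm_nonneg)
  have w0: "w z \<ge> 0" for z by (simp add: w_def opnorm_nonneg)
  have wm [measurable]: "w \<in> borel_measurable borel"
    unfolding w_def using borel_measurable_integrable[OF A_set_integrable_opnorm(1)[OF \<Psi>]] by measurable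
  \<comment> \<open>Division by z turns vanishing of the coefficients at all indices up to 0 into
    vanishing at the negative indices, as the locale requires.\<close>
  define P where "P i j z = \<Psi> z $$ (i, j) * z powi (-1)" for i j z
  interpret H1_matrix n n k P w
  proof
    show "L1 (P i j)" if "i < n" "j < n" for i j
      unfolding P_def by (rule L1_mult_powi[OF ent(1)[OF that]])
    show "fourier_coeff (P i j) m = 0" if "i < n" "j < n" "m < 0" for i j m
      unfolding P_def fourier_coeff_mult_powi[OF L1_measurable[OF ent(1)[OF that(1,2)]]]
      by (rule ent(2)) (use that in auto)
    show "L2 (\<lambda>z. complex_of_real (w z))"
      using A_set_integrable_opnorm(1)[OF \<Psi>] by (simp add: L2_def w2)
    show "AE z in circle_m. \<forall>i<n. \<forall>j<n. cmod (P i j z) \<le> (w z)\<^sup>2"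
      using AE_circle_norm_powi[of "-1"]
      by eventually_elim (auto simp: P_def w2 norm_mult intro: entry_le_opnorm[OF car])
    show "AE z in circle_m. \<exists>X Y. \<forall>i<n. \<forall>j<n. P i j z = (\<Sum>l<k. X i l * Y l j)"
      using rk
    proof eventually_elim
      case (elim z)
      then obtain X Y where "\<And>i j. i < n \<Longrightarrow> j < n \<Longrightarrow> \<Psi> z $$ (i, j) = (\<Sum>q<k. X i q * Y q j)"
        using mrank_factorization[OF car] by blast
      then show ?case
        by (intro exI[of _ X] exI[of _ "\<lambda>q j. Y q j * z powi (-1)"])
           (auto simp: P_def sum_distrib_right mult.assoc)
    qed
  qed
  obtain r \<phi> where r: "r \<le> k"
    and on: "AE z in circle_m. \<forall>l<r. \<forall>l'<r. (\<Sum>i<n. \<phi> l i z * cnj (\<phi> l' i z)) = (if l = l' then 1 else 0)"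
    and F2: "\<And>l i. l < r \<Longrightarrow> i < n \<Longrightarrow> H2 (\<lambda>z. of_real (w z) * \<phi> l i z)"
    and G2: "\<And>l j. l < r \<Longrightarrow> j < n \<Longrightarrow> H2 (\<lambda>z. \<Sum>i<n. P i j z / of_real (w z) * cnj (\<phi> l i z))"
    and fact: "AE z in circle_m. \<forall>i<n. \<forall>j<n. P i j z =
       (\<Sum>l<r. of_real (w z) * \<phi> l i z * (\<Sum>i<n. P i j z / of_real (w z) * cnj (\<phi> l i z)))"
    by (rule H1_factorization) blast
  define g where "g l j z = (\<Sum>i<n. P i j z / of_real (w z) * cnj (\<phi> l i z))" for l j z
  define F where "F z = Matrix.mat n k (\<lambda>(i, l). if l < r then of_real (w z) * \<phi> l i z else 0)" for z
  \<comment> \<open>The factor z removed from \<open>\<Psi>\<close> returns here and makes the mean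
    of \<open>G\<close> vanish.\<close>
  define G where "G z = Matrix.mat k n (\<lambda>(l, j). if l < r then g l j z * z powi 1 else 0)" for z
  have Fc: "F z \<in> carrier_mat n k" and Gc: "G z \<in> carrier_mat k n" for z
    by (simp_all add: F_def G_def)
  have H20: "H2 (\<lambda>_. 0)" by (simp add: H2_def fourier_coeff_def)
  have gm: "g l j \<in> borel_measurable borel" if "l < r" "j < n" for l j
    using L2_measurable[OF H2_L2[OF G2[OF that]]] unfolding g_def[abs_def] .
  have Gcoeff: "fourier_coeff (\<lambda>z. G z $$ (l, j)) m = 0" if "l < k" "j < n" "m \<le> 0" for l j m
  proof (cases "l < r")
    case True
    have "fourier_coeff (\<lambda>z. g l j z * z powi 1) m = fourier_coeff (g l j) (m - 1)"
      by (rule fourier_coeff_mult_powi[OF gm[OF True that(2)]])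
    also have "\<dots> = 0"
      using G2[OF True that(2)] that(3) unfolding g_def[abs_def] by (simp add: H2_def)
    finally show ?thesis using that True by (simp add: G_def)
  next
    case False
    then show ?thesis using that by (simp add: G_def fourier_coeff_def)
  qed
  show ?thesis
  proof (rule that)
    show "mat_fun H2 n k F"
      unfolding mat_fun_def
    proof (intro conjI allI impI Fc)
      fix i l assume "i < n" "l < k"
      then show "H2 (\<lambda>z. F z $$ (i, l))"
        using F2 H20 by (cases "l < r") (simp_all add: F_def)
    qed
    show "mat_fun H2 k n G"
      unfolding mat_fun_def
    proof (intro conjI allI impI Gc)
      fix l j assume lj: "l < k" "j < n"
      have "L2 (\<lambda>z. G z $$ (l, j))"
      proof (cases "l < r")
        case True
        then show ?thesis
          using L2_mult_powi[OF H2_L2[OF G2[OF True lj(2)]], of 1] lj by (simp add: G_def g_def)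
      next
        case False
        then show ?thesis using lj by (simp add: G_def)
      qed
      then show "H2 (\<lambda>z. G z $$ (l, j))"
        using Gcoeff[OF lj] by (simp add: H2_def)
    qed
    show "fourier_coeff (\<lambda>z. G z $$ (l, j)) m = 0" if "l < k" "j < n" "m \<le> 0" for l j m
      by (rule Gcoeff[OF that])
    show "AE z in circle_m. \<Psi> z = F z * G z"
      using fact AE_circle_nonzero
    proof eventually_elim
      case (elim z)
      show ?case
      proof (rule eq_matI)
        fix i j assume "i < dim_row (F z * G z)" "j < dim_col (F z * G z)"
        then have ij: "i < n" "j < n" by (simp_all add: F_def G_def)
        have "(F z * G z) $$ (i, j) = (\<Sum>l<k. F z $$ (i, l) * G z $$ (l, j))"
          by (rule mat_mult_entry[OF Fc Gc ij])
        also have "\<dots> = (\<Sum>l<r. F z $$ (i, l) * G z $$ (l, j))"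
          by (rule sum.mono_neutral_right) (use r ij in \<open>auto simp: F_def\<close>)
        also have "\<dots> = (\<Sum>l<r. of_real (w z) * \<phi> l i z * (g l j z * z powi 1))"
          using r ij by (intro sum.cong) (auto simp: F_def G_def)
        also have "\<dots> = (\<Sum>l<r. of_real (w z) * \<phi> l i z * g l j z) * z powi 1"
          by (simp only: sum_distrib_right mult.assoc)
        also have "(\<Sum>l<r. of_real (w z) * \<phi> l i z * g l j z) = P i j z"
          using elim(1) ij unfolding g_def by (blast intro: sym)
        also have "P i j z * z powi 1 = \<Psi> z $$ (i, j)"
          using elim(2) by (simp add: P_def power_int_minus)
        finally show "\<Psi> z $$ (i, j) = (F z * G z) $$ (i, j)" by simp
      qed (use car[of z] in \<open>auto simp: F_def G_def\<close>)
    qed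
    show "AE z in circle_m. (opnorm (F z))\<^sup>2 \<le> opnorm (\<Psi> z)"
      using on
    proof eventually_elim
      case (elim z)
      have "opnorm (F z) \<le> w z"
      proof (rule opnorm_leI[OF Fc w0])
        fix x :: "complex Matrix.vec" assume x: "x \<in> carrier_vec k"
        show "vnorm (F z *\<^sub>v x) \<le> w z * vnorm x"
        proof (rule power2_le_imp_le)
          have e: "(F z *\<^sub>v x) $ i = of_real (w z) * (\<Sum>l<r. x $ l * \<phi> l i z)" if i: "i < n" for i
          proof -
            have "(F z *\<^sub>v x) $ i = (\<Sum>l<r. F z $$ (i, l) * x $ l)"
              unfolding mat_vec_entry[OF Fc x i]
              by (rule sum.mono_neutral_right) (use r i in \<open>auto simp: F_def\<close>)
            then show ?thesis
              using i r by (simp add: F_def sum_distrib_left mult_ac)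
          qed
          have "(vnorm (F z *\<^sub>v x))\<^sup>2 = (w z)\<^sup>2 * (\<Sum>i<n. (cmod (\<Sum>l<r. x $ l * \<phi> l i z))\<^sup>2)"
            unfolding vnorm_sq[OF mult_mat_vec_carrier[OF Fc x]] sum_distrib_left
            by (intro sum.cong refl) (simp add: e norm_mult power_mult_distrib del: index_mult_mat_vec)
          also have "(\<Sum>i<n. (cmod (\<Sum>l<r. x $ l * \<phi> l i z))\<^sup>2) = (\<Sum>l<r. (cmod (x $ l))\<^sup>2)"
            by (rule sum_norm_sq_orthonormal) (use elim in auto)
          also have "\<dots> \<le> (vnorm x)\<^sup>2"
            unfolding vnorm_sq[OF x] by (rule sum_mono2) (use r in auto)
          finally show "(vnorm (F z *\<^sub>v x))\<^sup>2 \<le> (w z * vnorm x)\<^sup>2"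
            by (simp add: power_mult_distrib mult_left_mono)
        qed (simp add: w0 vnorm_nonneg)
      qed
      then show ?case
        using power_mono[of "opnorm (F z)" "w z" 2] opnorm_nonneg by (simp add: w2)
    qed
    show "AE z in circle_m. (opnorm (G z))\<^sup>2 \<le> opnorm (\<Psi> z)"
      using on AE_circle_norm
    proof eventually_elim
      case (elim z)
      have "opnorm (G z) \<le> w z"
      proof (rule opnorm_leI[OF Gc w0])
        fix x :: "complex Matrix.vec" assume x: "x \<in> carrier_vec n"
        define v where "v i = (\<Psi> z *\<^sub>v x) $ i / of_real (w z)" for i
        have "z \<noteq> 0" using elim(2) by auto
        have e: "(G z *\<^sub>v x) $ l = (\<Sum>i<n. v i * cnj (\<phi> l i z))" if l: "l < r" for l
        proof -
          have "P i j z * z powi 1 = \<Psi> z $$ (i, j)" for i j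
            using \<open>z \<noteq> 0\<close> by (simp add: P_def power_int_minus)
          then have PP: "P i j z / of_real (w z) * cnj (\<phi> l i z) * z powi 1 * x $ j =
              \<Psi> z $$ (i, j) * x $ j / of_real (w z) * cnj (\<phi> l i z)" for i j
            by (simp add: field_simps)
          have "(G z *\<^sub>v x) $ l = (\<Sum>j<n. \<Sum>i<n. P i j z / of_real (w z) * cnj (\<phi> l i z) * z powi 1 * x $ j)"
            using mat_vec_entry[OF Gc x, of l] l r by (simp add: G_def g_def sum_distrib_right del: index_mult_mat_vec)
          also have "\<dots> = (\<Sum>i<n. \<Sum>j<n. \<Psi> z $$ (i, j) * x $ j / of_real (w z) * cnj (\<phi> l i z))"
            unfolding PP by (rule sum.swap)
          also have "\<dots> = (\<Sum>i<n. v i * cnj (\<phi> l i z))"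
            by (intro sum.cong refl)
               (simp add: v_def mat_vec_entry[OF car x] sum_distrib_right sum_divide_distrib del: index_mult_mat_vec)
          finally show ?thesis .
        qed
        have e0: "(G z *\<^sub>v x) $ l = 0" if "l < k" "\<not> l < r" for l
          unfolding mat_vec_entry[OF Gc x that(1)] using that by (simp add: G_def)
        show "vnorm (G z *\<^sub>v x) \<le> w z * vnorm x"
        proof (rule power2_le_imp_le)
          have "(vnorm (G z *\<^sub>v x))\<^sup>2 = (\<Sum>l<k. (cmod ((G z *\<^sub>v x) $ l))\<^sup>2)"
            by (rule vnorm_sq[OF mult_mat_vec_carrier[OF Gc x]])
          also have "\<dots> = (\<Sum>l<r. (cmod ((G z *\<^sub>v x) $ l))\<^sup>2)"
            by (rule sum.mono_neutral_right) (use r e0 in auto)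
          also have "\<dots> = (\<Sum>l<r. (cmod (\<Sum>i<n. v i * cnj (\<phi> l i z)))\<^sup>2)"
            by (intro sum.cong refl) (simp add: e del: index_mult_mat_vec)
          also have "\<dots> \<le> (\<Sum>i<n. (cmod (v i))\<^sup>2)"
            by (rule Bessel_inequality) (use elim(1) in auto)
          also have "\<dots> = (vnorm (\<Psi> z *\<^sub>v x))\<^sup>2 / (w z)\<^sup>2"
            unfolding vnorm_sq[OF mult_mat_vec_carrier[OF car x]]
            by (simp add: v_def norm_divide power_divide sum_divide_distrib)
          also have "\<dots> \<le> (opnorm (\<Psi> z) * vnorm x)\<^sup>2 / (w z)\<^sup>2"
            by (intro divide_right_mono power_mono vnorm_mult_le_opnorm[OF car x] vnorm_nonneg) simp
          also have "\<dots> = (w z * vnorm x)\<^sup>2"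
            unfolding w2[symmetric] by (cases "w z = 0") (auto simp: power_mult_distrib power2_eq_square)
          finally show "(vnorm (G z *\<^sub>v x))\<^sup>2 \<le> (w z * vnorm x)\<^sup>2" .
        qed (simp add: w0 vnorm_nonneg)
      qed
      then show ?case
        using power_mono[of "opnorm (G z)" "w z" 2] opnorm_nonneg by (simp add: w2)
    qed
  qed
qed

subsection \<open>Duality\<close>

text \<open>Stated for abstract function classes so as to serve all combinations of bounded,
  \<open>H^\<infinity>\<close>, L^2 and \<open>H^2\<close> factors in use; only a scalar product
  rule and closure under finite sums are asked for.\<close>

lemma mat_fun_mult:
  assumes A: "mat_fun X n m A" and B: "mat_fun Y m k B"
    and XY: "\<And>f g. X f \<Longrightarrow> Y g \<Longrightarrow> Z (\<lambda>z. f z * g z)"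
    and Z: "\<And>I f. (\<And>q::nat. q \<in> I \<Longrightarrow> Z (f q)) \<Longrightarrow> Z (\<lambda>z. \<Sum>q\<in>I. f q z)"
  shows "mat_fun Z n k (\<lambda>z. A z * B z)"
  unfolding mat_fun_def
proof (intro conjI allI impI)
  note c = mat_fun_carrier[OF A] mat_fun_carrier[OF B]
  show "A z * B z \<in> carrier_mat n k" for z
    by (rule mult_carrier_mat[OF c])
  fix i j assume ij: "i < n" "j < k"
  have "Z (\<lambda>z. \<Sum>q<m. A z $$ (i, q) * B z $$ (q, j))"
    using ij mat_fun_entry[OF A] mat_fun_entry[OF B] by (intro Z XY) auto
  then show "Z (\<lambda>z. (A z * B z) $$ (i, j))"
    by (simp only: mat_mult_entry[OF c ij])
qed

lemma mat_fun_minus: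
  assumes A: "mat_fun X n m A" and B: "mat_fun X n m B"
    and X: "\<And>f g. X f \<Longrightarrow> X g \<Longrightarrow> X (\<lambda>z. f z - g z)"
  shows "mat_fun X n m (\<lambda>z. A z - B z)"
  unfolding mat_fun_def
proof (intro conjI allI impI)
  show "A z - B z \<in> carrier_mat n m" for z
    using mat_fun_carrier[OF B, of z] by simp
  fix i j assume ij: "i < n" "j < m"
  have "(A z - B z) $$ (i, j) = A z $$ (i, j) - B z $$ (i, j)" for z
    using mat_fun_carrier[OF B, of z] ij by simp
  then show "X (\<lambda>z. (A z - B z) $$ (i, j))"
    using X[OF mat_fun_entry[OF A ij] mat_fun_entry[OF B ij]] by simp
qed

lemma H2_sum: "(\<And>q. q \<in> I \<Longrightarrow> H2 (f q)) \<Longrightarrow> H2 (\<lambda>z. \<Sum>q\<in>I. f q z)"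
proof (induction I rule: infinite_finite_induct)
  case (insert q I)
  then have "H2 (f q)" "H2 (\<lambda>z. \<Sum>q\<in>I. f q z)" by auto
  then show ?case
    using insert.hyps by (simp add: H2_def L2_add fourier_coeff_add L2_imp_L1)
qed (simp_all add: H2_def fourier_coeff_def)

lemma Linf_diff:
  assumes f: "Linf f" and g: "Linf g"
  shows "Linf (\<lambda>z. f z - g z)"
proof -
  obtain C where C: "AE z in circle_m. cmod (f z) \<le> C" by (rule Linf_AE_bounded[OF f])
  obtain D where D: "AE z in circle_m. cmod (g z) \<le> D" by (rule Linf_AE_bounded[OF g])
  note [measurable] = Linf_measurable[OF f] Linf_measurable[OF g]
  have "AE z in circle_m. ereal (cmod (f z - g z)) \<le> ereal (C + D)"
    using C D
  proof eventually_elim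
    case (elim z)
    then show ?case using norm_triangle_ineq4[of "f z" "g z"] by simp
  qed
  then have "esssup circle_m (\<lambda>z. ereal (cmod (f z - g z))) \<le> ereal (C + D)"
    by (intro esssup_I) auto
  then show ?thesis
    unfolding Linf_def by (auto intro: le_less_trans)
qed

lemma mat_fun_Linf_L2: "mat_fun Linf n m F \<Longrightarrow> mat_fun L2 n m F"
  by (erule mat_fun_mono) (use Linf_mult_L2[of _ "\<lambda>_. 1"] in auto)

lemma mat_fun_H2_L2: "mat_fun H2 n m F \<Longrightarrow> mat_fun L2 n m F"
  by (erule mat_fun_mono) (rule H2_L2)

lemma mat_fun_Hinf_Linf: "mat_fun Hinf n m F \<Longrightarrow> mat_fun Linf n m F"
  by (erule mat_fun_mono) (simp add: Hinf_def)

lemma integrable_mtrace_mult: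
  assumes A: "\<And>z. A z \<in> carrier_mat n m" and B: "\<And>z. B z \<in> carrier_mat m n"
    and AB: "\<And>i q. i < n \<Longrightarrow> q < m \<Longrightarrow> L1 (\<lambda>z. A z $$ (i, q) * B z $$ (q, i))"
  shows "integrable circle_m (\<lambda>z. mtrace (A z * B z))"
    "(\<integral>z. mtrace (A z * B z) \<partial>circle_m) = (\<Sum>i<n. \<Sum>q<m. \<integral>z. A z $$ (i, q) * B z $$ (q, i) \<partial>circle_m)"
proof -
  have row: "integrable circle_m (\<lambda>z. \<Sum>q<m. A z $$ (i, q) * B z $$ (q, i))"
    "(\<integral>z. (\<Sum>q<m. A z $$ (i, q) * B z $$ (q, i)) \<partial>circle_m) = (\<Sum>q<m. \<integral>z. A z $$ (i, q) * B z $$ (q, i) \<partial>circle_m)"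
    if "i < n" for i
    using AB[OF that] by (auto simp: L1_def intro!: Bochner_Integration.integrable_sum Bochner_Integration.integral_sum)
  show "integrable circle_m (\<lambda>z. mtrace (A z * B z))"
    unfolding mtrace_mult[OF A B] by (rule Bochner_Integration.integrable_sum) (use row(1) in auto)
  show "(\<integral>z. mtrace (A z * B z) \<partial>circle_m) = (\<Sum>i<n. \<Sum>q<m. \<integral>z. A z $$ (i, q) * B z $$ (q, i) \<partial>circle_m)"
    unfolding mtrace_mult[OF A B] using row
    by (subst Bochner_Integration.integral_sum) auto
qed

lemma integral_mtrace_H2_0:
  assumes Q: "mat_fun H2 n k Q" and G: "mat_fun H2 k n G"
    and G0: "\<And>l j m. l < k \<Longrightarrow> j < n \<Longrightarrow> m \<le> 0 \<Longrightarrow> fourier_coeff (\<lambda>z. G z $$ (l, j)) m = 0"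
  shows "(\<integral>z. mtrace (Q z * G z) \<partial>circle_m) = 0"
proof -
  have "(\<integral>z. mtrace (Q z * G z) \<partial>circle_m) = (\<Sum>i<n. \<Sum>q<k. \<integral>z. Q z $$ (i, q) * G z $$ (q, i) \<partial>circle_m)"
    by (rule integrable_mtrace_mult(2)[OF mat_fun_carrier[OF Q] mat_fun_carrier[OF G]])
       (intro L1_mult_L2 H2_L2 mat_fun_entry[OF Q] mat_fun_entry[OF G])
  also have "\<dots> = 0"
  proof (intro sum.neutral ballI)
    fix i q assume "i \<in> {..<n}" "q \<in> {..<k}"
    then show "(\<integral>z. Q z $$ (i, q) * G z $$ (q, i) \<partial>circle_m) = 0"
      using G0 by (intro integral_H2_mult_H2_0 mat_fun_entry[OF Q] H2_L2 mat_fun_entry[OF G]) auto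
  qed
  finally show ?thesis .
qed

lemma A_set_L1: "\<Psi> \<in> A_set n k \<Longrightarrow> i < n \<Longrightarrow> j < n \<Longrightarrow> L1 (\<lambda>z. \<Psi> z $$ (i, j))"
  and A_set_carrier: "\<Psi> \<in> A_set n k \<Longrightarrow> \<Psi> z \<in> carrier_mat n n"
  by (auto simp: A_set_def mat_fun_def H1_0_def)

lemma integrable_mtrace_Linf_A_set:
  assumes \<Phi>: "mat_fun Linf n n \<Phi>" and \<Psi>: "\<Psi> \<in> A_set n k"
  shows "integrable circle_m (\<lambda>z. mtrace (\<Phi> z * \<Psi> z))"
  by (rule integrable_mtrace_mult(1)[OF mat_fun_carrier[OF \<Phi>] A_set_carrier[OF \<Psi>]])
     (intro Linf_mult_L1 mat_fun_entry[OF \<Phi>] A_set_L1[OF \<Psi>])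

lemma integral_mtrace_factorization:
  assumes \<Phi>: "mat_fun Linf n n \<Phi>" and \<Psi>: "\<Psi> \<in> A_set n k" and F: "mat_fun H2 n k F" and G: "mat_fun H2 k n G"
    and fact: "AE z in circle_m. \<Psi> z = F z * G z"
  shows "(\<integral>z. mtrace (\<Phi> z * \<Psi> z) \<partial>circle_m) = (\<integral>z. mtrace (\<Phi> z * F z * G z) \<partial>circle_m)"
proof (rule integral_cong_AE)
  have \<Phi>F: "mat_fun L2 n k (\<lambda>z. \<Phi> z * F z)"
    by (rule mat_fun_mult[OF \<Phi> F]) (auto intro: Linf_mult_L2 H2_L2 L2_sum)
  have "integrable circle_m (\<lambda>z. mtrace (\<Phi> z * F z * G z))"
    by (rule integrable_mtrace_mult(1)[OF mat_fun_carrier[OF \<Phi>F] mat_fun_carrier[OF G]])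
       (intro L1_mult_L2 H2_L2 mat_fun_entry[OF \<Phi>F] mat_fun_entry[OF G])
  then show "(\<lambda>z. mtrace (\<Phi> z * F z * G z)) \<in> borel_measurable circle_m"
    by (rule borel_measurable_integrable)
  show "AE z in circle_m. mtrace (\<Phi> z * \<Psi> z) = mtrace (\<Phi> z * F z * G z)"
    using fact
  proof eventually_elim
    case (elim z)
    then show ?case
      using assoc_mult_mat[OF mat_fun_carrier[OF \<Phi>] mat_fun_carrier[OF F] mat_fun_carrier[OF G], of z z z] by simp
  qed
qed (rule borel_measurable_integrable[OF integrable_mtrace_Linf_A_set[OF \<Phi> \<Psi>]])

text \<open>A product of \<open>H^\<infinity>\<close> and \<open>H^1\<close> functions is out of
  reach of \<open>integral_H2_mult_H2_0\<close>, which pairs two L^2 functions. With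
  \<open>\<Psi>\<close> factored, \<open>Q F\<close> stays in \<open>H^2\<close> and is paired with
  \<open>G\<close>.\<close>

lemma integral_mtrace_Hinf_A_set:
  assumes Q: "mat_fun Hinf n n Q" and \<Psi>: "\<Psi> \<in> A_set n k"
  shows "(\<integral>z. mtrace (Q z * \<Psi> z) \<partial>circle_m) = 0"
proof -
  obtain F G where F: "mat_fun H2 n k F" and G: "mat_fun H2 k n G"
    "\<And>l j m. l < k \<Longrightarrow> j < n \<Longrightarrow> m \<le> 0 \<Longrightarrow> fourier_coeff (\<lambda>z. G z $$ (l, j)) m = 0"
    and fact: "AE z in circle_m. \<Psi> z = F z * G z"
    by (rule A_set_factorization[OF \<Psi>]) blast
  have QF: "mat_fun H2 n k (\<lambda>z. Q z * F z)"
    by (rule mat_fun_mult[OF Q F Hinf_mult_H2 H2_sum])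
  have "(\<integral>z. mtrace (Q z * \<Psi> z) \<partial>circle_m) = (\<integral>z. mtrace (Q z * F z * G z) \<partial>circle_m)"
    by (rule integral_mtrace_factorization[OF mat_fun_Hinf_Linf[OF Q] \<Psi> F G(1) fact])
  also have "\<dots> = 0" by (rule integral_mtrace_H2_0[OF QF G])
  finally show ?thesis .
qed

lemma norm_integral_mtrace_le:
  assumes \<Phi>: "mat_fun Linf n n \<Phi>" and \<Psi>: "\<Psi> \<in> A_set n k" and T: "0 \<le> T"
    and le: "AE z in circle_m. cmod (mtrace (\<Phi> z * \<Psi> z)) \<le> T * opnorm (\<Psi> z)"
  shows "cmod (\<integral>z. mtrace (\<Phi> z * \<Psi> z) \<partial>circle_m) \<le> T"
proof -
  note int = A_set_integrable_opnorm[OF \<Psi>]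
  have "cmod (\<integral>z. mtrace (\<Phi> z * \<Psi> z) \<partial>circle_m) \<le> (\<integral>z. cmod (mtrace (\<Phi> z * \<Psi> z)) \<partial>circle_m)"
    by (rule integral_norm_bound)
  also have "\<dots> \<le> (\<integral>z. T * opnorm (\<Psi> z) \<partial>circle_m)"
    using int(1) integrable_mtrace_Linf_A_set[OF \<Phi> \<Psi>] le by (intro integral_mono_AE) auto
  also have "\<dots> = T * (\<integral>z. opnorm (\<Psi> z) \<partial>circle_m)" by simp
  also have "\<dots> \<le> T * 1" by (intro mult_left_mono int T)
  finally show ?thesis by simp
qed

subsection \<open>Superoptimal singular values of a very badly approximable function\<close>

lemma Omega_antimono: "i \<le> j \<Longrightarrow> Omega n \<Phi> j \<subseteq> Omega n \<Phi> i"
  by (induction j) (auto simp: le_Suc_eq argmin_set_def)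

text \<open>Each stage of the nested minimization fixes one essential supremum for all members of
  the later stages. Hence \<open>t_sv\<close> at the indices below n does not depend on the
  minimizer selected by \<open>SOME\<close>.\<close>

lemma ess_sval_eq_on_Omega:
  assumes "F \<in> Omega n \<Phi> m" "G \<in> Omega n \<Phi> m" "j \<le> m"
  shows "ess_sval j (\<lambda>z. \<Phi> z - F z) = ess_sval j (\<lambda>z. \<Phi> z - G z)"
proof -
  have "F \<in> Omega n \<Phi> j" "G \<in> Omega n \<Phi> j"
    using Omega_antimono[OF assms(3)] assms by auto
  then show ?thesis
    by (cases j) (auto simp: argmin_set_def intro!: antisym)
qed

lemma Omega_Hinf: "F \<in> Omega n \<Phi> j \<Longrightarrow> mat_fun Hinf n n F"
  using Omega_antimono[of 0 j n \<Phi>] by (auto simp: argmin_set_def)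

lemma mat_fun_zero: "X (\<lambda>_. 0) \<Longrightarrow> mat_fun X n m (\<lambda>_. 0\<^sub>m n m)"
  by (auto simp: mat_fun_def)

text \<open>Finiteness matters because \<open>real_of_ereal\<close> would turn an infinite value
  into 0.\<close>

lemma ess_sval_bounds:
  assumes \<Phi>: "mat_fun Linf n m \<Phi>"
  obtains t where "ess_sval j \<Phi> = ereal t" "t \<ge> 0" "AE z in circle_m. sval j (\<Phi> z) \<le> t"
proof -
  note c = mat_fun_carrier[OF \<Phi>] and e = mat_fun_entry[OF \<Phi>]
  have meas [measurable]: "(\<lambda>z. sval j (\<Phi> z)) \<in> borel_measurable borel"
    by (rule measurable_sval[OF mat_fun_mono[OF \<Phi> Linf_measurable]])
  have "\<forall>i q. \<exists>C. i < n \<longrightarrow> q < m \<longrightarrow> (AE z in circle_m. cmod (\<Phi> z $$ (i, q)) \<le> C)"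
    using Linf_AE_bounded[OF e] by metis
  then obtain C where C: "\<And>i q. i < n \<Longrightarrow> q < m \<Longrightarrow> AE z in circle_m. cmod (\<Phi> z $$ (i, q)) \<le> C i q"
    by metis
  have "AE z in circle_m. \<forall>i\<in>{..<n}. \<forall>q\<in>{..<m}. cmod (\<Phi> z $$ (i, q)) \<le> C i q"
    using C by (intro AE_finite_allI) auto
  then have "AE z in circle_m. ereal (sval j (\<Phi> z)) \<le> ereal (\<Sum>i<n. \<Sum>q<m. C i q)"
  proof eventually_elim
    case (elim z)
    have "sval j (\<Phi> z) \<le> opnorm (\<Phi> z)"
      using sval_le[OF c, of "0\<^sub>m n m" j z] mat_minus_zero[OF c] by (simp add: mrank_zero)
    also have "\<dots> \<le> (\<Sum>i<n. \<Sum>q<m. cmod (\<Phi> z $$ (i, q)))" by (rule opnorm_le_sum[OF c])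
    also have "\<dots> \<le> (\<Sum>i<n. \<Sum>q<m. C i q)" using elim by (intro sum_mono) auto
    finally show ?case by simp
  qed
  then have up: "ess_sval j \<Phi> \<le> ereal (\<Sum>i<n. \<Sum>q<m. C i q)"
    unfolding ess_sval_def by (intro esssup_I) auto
  have "esssup circle_m (\<lambda>_. 0::ereal) \<le> ess_sval j \<Phi>"
    unfolding ess_sval_def by (intro esssup_mono) (auto simp: sval_nonneg)
  then have lo: "0 \<le> ess_sval j \<Phi>"
    using esssup_const[of circle_m "0::ereal"] circle.emeasure_space_1 by simp
  obtain t where t: "ess_sval j \<Phi> = ereal t" "t \<ge> 0"
    using up lo by (cases "ess_sval j \<Phi>") auto
  have "AE z in circle_m. sval j (\<Phi> z) \<le> t"
    using esssup_AE[of "\<lambda>z. ereal (sval j (\<Phi> z))" circle_m] t(1) by (simp add: ess_sval_def)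
  with t that show ?thesis by blast
qed

lemma t_sv_very_badly_approximable:
  assumes \<Phi>: "mat_fun Linf n n \<Phi>" and vb: "very_badly_approximable n \<Phi>" and n: "n \<ge> 1" and j: "j \<le> n"
  shows "0 \<le> t_sv n \<Phi> j \<and> (AE z in circle_m. sval j (\<Phi> z) \<le> t_sv n \<Phi> j)"
proof -
  define F where "F = (SOME F. F \<in> Omega n \<Phi> (n - 1))"
  have zero: "(\<lambda>z. 0\<^sub>m n n) \<in> Omega n \<Phi> (n - 1)"
    using vb by (simp add: very_badly_approximable_def)
  then have F: "F \<in> Omega n \<Phi> (n - 1)"
    unfolding F_def by (rule someI[of "\<lambda>F. F \<in> Omega n \<Phi> (n - 1)"])
  have "ess_sval j (\<lambda>z. \<Phi> z - F z) = ess_sval j (\<lambda>z. \<Phi> z - 0\<^sub>m n n)"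
  \<comment> \<open>The stages end at n - 1, so index n is not covered by them; there both singular
    values vanish for reasons of rank.\<close>
  proof (cases "j = n")
    case True
    have "sval n (\<Phi> z - F z) = 0" "sval n (\<Phi> z - 0\<^sub>m n n) = 0" for z
      using mat_fun_carrier[OF Omega_Hinf[OF F], of z] by (auto intro!: sval_eq_0[of _ n n])
    then show ?thesis using True by (simp add: ess_sval_def)
  next
    case False
    then show ?thesis using j by (intro ess_sval_eq_on_Omega[OF F zero]) simp
  qed
  then have "ess_sval j (\<lambda>z. \<Phi> z - F z) = ess_sval j \<Phi>"
    using mat_minus_zero[OF mat_fun_carrier[OF \<Phi>]] by simp
  then have t: "t_sv n \<Phi> j = real_of_ereal (ess_sval j \<Phi>)"
    by (simp add: t_sv_def F_def)
  show ?thesis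
    by (rule ess_sval_bounds[OF \<Phi>, of j]) (simp add: t)
qed

section \<open>Bounds for the quotient norm \<open>hankel_k_val\<close>\<close>

lemma mtrace_minus_mult:
  assumes "A \<in> carrier_mat n m" "B \<in> carrier_mat n m" "C \<in> carrier_mat m n"
  shows "mtrace ((A - B) * C) = mtrace (A * C) - mtrace (B * C)"
  using assms mtrace_mult[OF minus_carrier_mat[OF assms(2)] assms(3), of A] mtrace_mult[OF assms(1,3)] mtrace_mult[OF assms(2,3)]
  by (simp add: left_diff_distrib sum_subtractf)

lemma L2_S1_norm_nonneg: "0 \<le> L2_S1_norm F"
  by (simp add: L2_S1_norm_def)

lemma hankel_k_val_bdd: "bdd_below {L2_S1_norm (\<lambda>z. \<Phi> z * F z - G z) |G. mat_fun H2 n k G}"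
  by (rule bdd_belowI[of _ 0]) (auto simp: L2_S1_norm_nonneg)

lemma mat_fun_H2_zero: "mat_fun H2 n m (\<lambda>_. 0\<^sub>m n m)"
  by (rule mat_fun_zero) (simp add: H2_def fourier_coeff_def)

text \<open>The competitor G = 0 suffices; pointwise, \<open>tnorm_mult\<close> splits off the
  operator norm of \<open>F\<close>.\<close>

lemma hankel_k_val_le:
  assumes \<Phi>: "mat_fun Linf n n \<Phi>" and F: "mat_fun H2 n k F"
    and S: "0 \<le> S" "AE z in circle_m. tnorm (\<Phi> z) \<le> S"
  shows "hankel_k_val n k \<Phi> F \<le> S * L2_op_norm F"
proof -
  note FL2 = mat_fun_H2_L2[OF F]
  have \<Phi>F: "mat_fun L2 n k (\<lambda>z. \<Phi> z * F z)" by (rule mat_fun_mult[OF \<Phi> FL2 Linf_mult_L2 L2_sum])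
  have "hankel_k_val n k \<Phi> F \<le> L2_S1_norm (\<lambda>z. \<Phi> z * F z - 0\<^sub>m n k)"
    unfolding hankel_k_val_def using mat_fun_H2_zero[of n k]
    by (intro cInf_lower hankel_k_val_bdd CollectI exI[of _ "\<lambda>_. 0\<^sub>m n k"]) simp
  also have "\<dots> = sqrt (\<integral>z. (tnorm (\<Phi> z * F z))\<^sup>2 \<partial>circle_m)"
    using mat_minus_zero[OF mat_fun_carrier[OF \<Phi>F]] by (simp add: L2_S1_norm_def)
  also have "\<dots> \<le> sqrt (\<integral>z. S\<^sup>2 * (opnorm (F z))\<^sup>2 \<partial>circle_m)"
  proof (rule real_sqrt_le_mono, rule integral_mono_AE)
    show "integrable circle_m (\<lambda>z. (tnorm (\<Phi> z * F z))\<^sup>2)" by (rule integrable_tnorm_sq[OF \<Phi>F])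
    show "integrable circle_m (\<lambda>z. S\<^sup>2 * (opnorm (F z))\<^sup>2)"
      using integrable_opnorm_sq[OF FL2] by simp
    show "AE z in circle_m. (tnorm (\<Phi> z * F z))\<^sup>2 \<le> S\<^sup>2 * (opnorm (F z))\<^sup>2"
      using S(2)
    proof eventually_elim
      case (elim z)
      have "tnorm (\<Phi> z * F z) \<le> tnorm (\<Phi> z) * opnorm (F z)"
        by (rule tnorm_mult[OF mat_fun_carrier[OF \<Phi>] mat_fun_carrier[OF F]])
      also have "\<dots> \<le> S * opnorm (F z)" by (intro mult_right_mono elim opnorm_nonneg)
      finally show ?case
        using power_mono[OF _ tnorm_nonneg, of "\<Phi> z * F z" "S * opnorm (F z)" 2] by (simp add: power_mult_distrib)
    qed
  qed
  also have "\<dots> = S * L2_op_norm F"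
    using S(1) by (simp add: L2_op_norm_def real_sqrt_mult)
  finally show ?thesis .
qed

lemma L2_op_norm_le_1:
  assumes \<Psi>: "\<Psi> \<in> A_set n k" and F: "mat_fun L2 m p F"
    and le: "AE z in circle_m. (opnorm (F z))\<^sup>2 \<le> opnorm (\<Psi> z)"
  shows "L2_op_norm F \<le> 1"
proof -
  have "(\<integral>z. (opnorm (F z))\<^sup>2 \<partial>circle_m) \<le> (\<integral>z. opnorm (\<Psi> z) \<partial>circle_m)"
    using le by (intro integral_mono_AE integrable_opnorm_sq[OF F] A_set_integrable_opnorm(1)[OF \<Psi>])
  also have "\<dots> \<le> 1" by (rule A_set_integrable_opnorm(2)[OF \<Psi>])
  finally show ?thesis by (simp add: L2_op_norm_def)
qed

text \<open>The factor \<open>F\<close> of an extremal \<open>\<Psi> = F G\<close> is a maximizing vector: \<open>G\<close> annihilates \<open>H\<^sup>2\<close> and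
  certifies that \<open>\<Phi> F\<close> has distance at least \<open>S\<close> from it.\<close>
lemma extremal_hankel_k_val:
  assumes \<Phi>: "mat_fun Linf n n \<Phi>" and \<Psi>: "\<Psi> \<in> A_set n k"
    and int: "(\<integral>z. mtrace (\<Phi> z * \<Psi> z) \<partial>circle_m) = complex_of_real S" and S: "0 \<le> S"
  obtains F where "mat_fun H2 n k F" "L2_op_norm F \<le> 1" "S \<le> hankel_k_val n k \<Phi> F"
proof -
  obtain F G where F: "mat_fun H2 n k F" and G: "mat_fun H2 k n G"
    "\<And>l j m. l < k \<Longrightarrow> j < n \<Longrightarrow> m \<le> 0 \<Longrightarrow> fourier_coeff (\<lambda>z. G z $$ (l, j)) m = 0"
    and fact: "AE z in circle_m. \<Psi> z = F z * G z"
    and leF: "AE z in circle_m. (opnorm (F z))\<^sup>2 \<le> opnorm (\<Psi> z)"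
    and leG: "AE z in circle_m. (opnorm (G z))\<^sup>2 \<le> opnorm (\<Psi> z)"
    by (rule A_set_factorization[OF \<Psi>]) blast
  note FL2 = mat_fun_H2_L2[OF F] and GL2 = mat_fun_H2_L2[OF G(1)]
  have \<Phi>F: "mat_fun L2 n k (\<lambda>z. \<Phi> z * F z)" by (rule mat_fun_mult[OF \<Phi> FL2 Linf_mult_L2 L2_sum])
  have tr_int: "integrable circle_m (\<lambda>z. mtrace (A z * G z))" if "mat_fun L2 n k A" for A
    by (rule integrable_mtrace_mult(1)[OF mat_fun_carrier[OF that] mat_fun_carrier[OF GL2]])
       (intro L1_mult_L2 mat_fun_entry[OF that] mat_fun_entry[OF GL2])
  have S_eq: "(\<integral>z. mtrace (\<Phi> z * F z * G z) \<partial>circle_m) = complex_of_real S"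
    using integral_mtrace_factorization[OF \<Phi> \<Psi> F G(1) fact] int by simp
  have "S \<le> L2_S1_norm (\<lambda>z. \<Phi> z * F z - G' z)" if G': "mat_fun H2 n k G'" for G'
  proof -
    note G'L2 = mat_fun_H2_L2[OF G']
    have D: "mat_fun L2 n k (\<lambda>z. \<Phi> z * F z - G' z)" by (rule mat_fun_minus[OF \<Phi>F G'L2 L2_diff])
    \<comment> \<open>Pairing with \<open>G\<close> does not see \<open>G'\<close>, so every
      representative of the coset of \<open>\<Phi> F\<close> pairs to \<open>S\<close>.\<close>
    have "(\<integral>z. mtrace ((\<Phi> z * F z - G' z) * G z) \<partial>circle_m) =
        (\<integral>z. mtrace (\<Phi> z * F z * G z) - mtrace (G' z * G z) \<partial>circle_m)"
      by (simp only: mtrace_minus_mult[OF mat_fun_carrier[OF \<Phi>F] mat_fun_carrier[OF G'] mat_fun_carrier[OF G(1)]])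
    also have "\<dots> = complex_of_real S"
      using tr_int[OF \<Phi>F] tr_int[OF G'L2] by (simp add: S_eq integral_mtrace_H2_0[OF G' G])
    finally have "S = cmod (\<integral>z. mtrace ((\<Phi> z * F z - G' z) * G z) \<partial>circle_m)" using S by simp
    also have "\<dots> \<le> (\<integral>z. cmod (mtrace ((\<Phi> z * F z - G' z) * G z)) \<partial>circle_m)"
      by (rule integral_norm_bound)
    also have "\<dots> \<le> (\<integral>z. \<bar>tnorm (\<Phi> z * F z - G' z) * opnorm (G z)\<bar> \<partial>circle_m)"
    proof (rule integral_mono)
      show "integrable circle_m (\<lambda>z. cmod (mtrace ((\<Phi> z * F z - G' z) * G z)))"
        using tr_int[OF D] by simp
      have "L1 (\<lambda>z. complex_of_real (tnorm (\<Phi> z * F z - G' z)) * complex_of_real (opnorm (G z)))"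
        using measurable_tnorm_mat_fun[OF D] measurable_opnorm_mat_fun[OF GL2]
          integrable_tnorm_sq[OF D] integrable_opnorm_sq[OF GL2]
        by (intro L1_mult_L2) (auto simp: L2_def)
      then have "integrable circle_m (\<lambda>z. norm (complex_of_real (tnorm (\<Phi> z * F z - G' z)) * complex_of_real (opnorm (G z))))"
        unfolding L1_def by (rule integrable_norm)
      then show "integrable circle_m (\<lambda>z. \<bar>tnorm (\<Phi> z * F z - G' z) * opnorm (G z)\<bar>)"
        by (simp add: norm_mult abs_mult)
      show "cmod (mtrace ((\<Phi> z * F z - G' z) * G z)) \<le> \<bar>tnorm (\<Phi> z * F z - G' z) * opnorm (G z)\<bar>" for z
        using trace_le_tnorm[OF mat_fun_carrier[OF D] mat_fun_carrier[OF GL2]] by (rule order_trans) simp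
    qed
    also have "\<dots> \<le> L2_S1_norm (\<lambda>z. \<Phi> z * F z - G' z) * L2_op_norm G"
      unfolding L2_S1_norm_def L2_op_norm_def
      using measurable_tnorm_mat_fun[OF D] measurable_opnorm_mat_fun[OF GL2]
        integrable_tnorm_sq[OF D] integrable_opnorm_sq[OF GL2]
      by (intro Cauchy_Schwarz_integral) auto
    also have "\<dots> \<le> L2_S1_norm (\<lambda>z. \<Phi> z * F z - G' z) * 1"
      by (intro mult_left_mono L2_op_norm_le_1[OF \<Psi> GL2 leG] L2_S1_norm_nonneg)
    finally show ?thesis by simp
  qed
  then have "S \<le> hankel_k_val n k \<Phi> F"
    unfolding hankel_k_val_def using mat_fun_H2_zero[of n k] by (intro cInf_greatest) auto
  then show ?thesis using that F L2_op_norm_le_1[OF \<Psi> FL2 leF] by blast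
qed

text \<open>Keeps the set under the supremum in \<open>sigma\<close> nonempty, also for rank bound
  0; the supremum of the empty set would carry no information.\<close>

lemma zero_in_A_set: "(\<lambda>_. 0\<^sub>m n n) \<in> A_set n k"
proof -
  have "opnorm (0\<^sub>m n n) = 0"
    using opnorm_le_sum[of "0\<^sub>m n n" n n] opnorm_nonneg[of "0\<^sub>m n n"] by simp
  then show ?thesis
    using mat_fun_zero[of H1_0 n n]
    by (simp add: A_set_def L1_op_norm_def mrank_zero H1_0_def L1_def fourier_coeff_def)
qed

theorem theorem4p10:
  fixes n k :: nat and \<Phi> \<Psi> :: "complex \<Rightarrow> complex mat"
  assumes "n > 1" and "1 \<le> k" and "k \<le> n"
    and "mat_fun Linf n n \<Phi>"
    and "admissible n \<Phi>"
    and "very_badly_approximable n \<Phi>"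
    and "\<Psi> \<in> A_set n k"
    and "(\<integral>\<zeta>. mtrace (\<Phi> \<zeta> * \<Psi> \<zeta>) \<partial>circle_m) = complex_of_real (\<Sum>j\<le>n. t_sv n \<Phi> j)"
    and "t_sv n \<Phi> (k - 1) > 0"
  shows "has_order n \<Phi> k \<and> Linf_S1_norm (\<lambda>\<zeta>. \<Phi> \<zeta> - 0\<^sub>m n n) = dist_S1 n \<Phi>"
proof -
  note \<Phi> = assms(4) and \<Psi> = assms(7)
  define t where "t = t_sv n \<Phi>"
  \<comment> \<open>\<open>T l\<close> collects the first l values, so the full sum up to
    \<open>t n\<close> is \<open>T (Suc n)\<close>.\<close>
  define T where "T l = (\<Sum>j<l. t j)" for l
  define S where "S = (\<Sum>j\<le>n. t j)"
  have tb: "0 \<le> t j" "AE z in circle_m. sval j (\<Phi> z) \<le> t j" if "j \<le> n" for j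
    using t_sv_very_badly_approximable[OF \<Phi> assms(6) _ that] assms(1) by (auto simp: t_def)
  have T_mono: "T l \<le> T l'" if "l \<le> l'" "l' \<le> Suc n" for l l'
    unfolding T_def using that tb(1) by (intro sum_mono2) auto
  have S_T: "S = T (Suc n)" by (simp add: S_def T_def lessThan_Suc_atMost)
  have "AE z in circle_m. \<forall>j\<in>{..n}. sval j (\<Phi> z) \<le> t j"
    using tb(2) by (intro AE_finite_allI) auto
  then have svT: "AE z in circle_m. \<forall>l\<le>n. (\<Sum>j<l. sval j (\<Phi> z)) \<le> T l"
    unfolding T_def by eventually_elim (auto intro!: sum_mono)
  have T_nonneg: "0 \<le> T l" if "l \<le> n" for l
    unfolding T_def using that tb(1) by (intro sum_nonneg) auto
  have tr_le: "cmod (\<integral>z. mtrace (\<Phi> z * \<Theta> z) \<partial>circle_m) \<le> T l" if \<Theta>: "\<Theta> \<in> A_set n l" and l: "l \<le> n" for \<Theta> l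
  proof (rule norm_integral_mtrace_le[OF \<Phi> \<Theta> T_nonneg[OF l]])
    have "AE z in circle_m. mrank (\<Theta> z) \<le> l" using \<Theta> by (simp add: A_set_def)
    with svT show "AE z in circle_m. cmod (mtrace (\<Phi> z * \<Theta> z)) \<le> T l * opnorm (\<Theta> z)"
    proof eventually_elim
      case (elim z)
      have "cmod (mtrace (\<Phi> z * \<Theta> z)) \<le> (\<Sum>j<l. sval j (\<Phi> z)) * opnorm (\<Theta> z)"
        by (rule trace_le_sval_sum[OF mat_fun_carrier[OF \<Phi>] A_set_carrier[OF \<Theta>] elim(2)])
      also have "\<dots> \<le> T l * opnorm (\<Theta> z)"
        using elim(1) l by (intro mult_right_mono opnorm_nonneg) auto
      finally show ?case .
    qed
  qed
  have int: "(\<integral>z. mtrace (\<Phi> z * \<Psi> z) \<partial>circle_m) = complex_of_real S"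
    using assms(8) by (simp add: S_def t_def)
  have S0: "0 \<le> S" unfolding S_def using tb(1) by (intro sum_nonneg) auto
  \<comment> \<open>\<open>S\<close> exceeds \<open>T k\<close> by nonnegative terms only, so this
    sandwich forces \<open>t k\<close>, ..., \<open>t n\<close> to vanish.\<close>
  have "S \<le> T k" using tr_le[OF \<Psi> assms(3)] int S0 by simp
  moreover have "T k \<le> S" unfolding S_T using assms(3) by (intro T_mono) auto
  ultimately have S_k: "S = T k" by simp
  \<comment> \<open>The term \<open>t (k - 1)\<close> is missing from every \<open>T l\<close> with
    l < k; its positivity creates the gap.\<close>
  have T_less: "T l < S" if "l < k" for l
  proof -
    have "T l \<le> T (k - 1)" using that assms(3) by (intro T_mono) auto
    also have "\<dots> < T (Suc (k - 1))" using assms(9) by (simp add: T_def t_def)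
    also have "T (Suc (k - 1)) = S" using assms(2) by (simp add: S_k)
    finally show ?thesis .
  qed
  have S_pos: "S > 0" using T_less[of 0] assms(2) by (simp add: T_def)
  have sigma_le: "sigma n l \<Phi> \<le> T l" if "l \<le> n" for l
    unfolding sigma_def using zero_in_A_set[of n l] tr_le that by (intro cSup_least) auto
  have sigma_k: "sigma n k \<Phi> = S"
  proof (rule antisym)
    show "sigma n k \<Phi> \<le> S" using sigma_le[OF assms(3)] S_k by simp
    have "cmod (\<integral>z. mtrace (\<Phi> z * \<Psi> z) \<partial>circle_m) \<le> sigma n k \<Phi>"
      unfolding sigma_def using \<Psi> tr_le assms(3) by (intro cSup_upper bdd_aboveI[of _ "T k"]) auto
    then show "S \<le> sigma n k \<Phi>" using int S0 by simp
  qed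
  have tn: "AE z in circle_m. tnorm (\<Phi> z) \<le> S"
    using svT
  proof eventually_elim
    case (elim z)
    then have "tnorm (\<Phi> z) \<le> T n" by (simp add: tnorm_eq[OF mat_fun_carrier[OF \<Phi>]])
    also have "\<dots> \<le> S" unfolding S_T by (intro T_mono) auto
    finally show ?case .
  qed
  have up: "Linf_S1_norm (\<lambda>z. \<Phi> z - 0\<^sub>m n n) \<le> ereal S"
  proof -
    have "(\<lambda>z. tnorm (\<Phi> z)) \<in> borel_measurable borel"
      by (rule measurable_tnorm_mat_fun[OF mat_fun_Linf_L2[OF \<Phi>]])
    then show ?thesis
      unfolding Linf_S1_norm_def mat_minus_zero[OF mat_fun_carrier[OF \<Phi>]]
      using tn by (intro esssup_I) auto
  qed
  \<comment> \<open>The norm is an extended real whose finiteness is not established separately; it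
    is compared through arbitrary real upper bounds \<open>b\<close>. Subtracting \<open>Q\<close>
    does not change the pairing with \<open>\<Psi>\<close>, so \<open>S\<close> is at most
    \<open>b\<close>.\<close>
  have low: "ereal S \<le> Linf_S1_norm (\<lambda>z. \<Phi> z - Q z)" if Q: "mat_fun Hinf n n Q" for Q
  proof (rule ereal_le_real)
    fix b assume b: "Linf_S1_norm (\<lambda>z. \<Phi> z - Q z) \<le> ereal b"
    have D: "mat_fun Linf n n (\<lambda>z. \<Phi> z - Q z)" by (rule mat_fun_minus[OF \<Phi> mat_fun_Hinf_Linf[OF Q] Linf_diff])
    have bae: "AE z in circle_m. tnorm (\<Phi> z - Q z) \<le> b"
      using esssup_AE[of "\<lambda>z. ereal (tnorm (\<Phi> z - Q z))" circle_m]
    proof eventually_elim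
      case (elim z)
      then have "ereal (tnorm (\<Phi> z - Q z)) \<le> ereal b"
        using b unfolding Linf_S1_norm_def by (rule order_trans)
      then show ?case by simp
    qed
    have "AE z in circle_m. 0 \<le> b"
      using bae by eventually_elim (rule order_trans[OF tnorm_nonneg])
    then have b0: "0 \<le> b" by simp
    have "(\<integral>z. mtrace ((\<Phi> z - Q z) * \<Psi> z) \<partial>circle_m) =
        (\<integral>z. mtrace (\<Phi> z * \<Psi> z) - mtrace (Q z * \<Psi> z) \<partial>circle_m)"
      by (simp only: mtrace_minus_mult[OF mat_fun_carrier[OF \<Phi>] mat_fun_carrier[OF Q] A_set_carrier[OF \<Psi>]])
    also have "\<dots> = complex_of_real S"
      using integrable_mtrace_Linf_A_set[OF \<Phi> \<Psi>] integrable_mtrace_Linf_A_set[OF mat_fun_Hinf_Linf[OF Q] \<Psi>]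
      by (simp add: int integral_mtrace_Hinf_A_set[OF Q \<Psi>])
    finally have "S = cmod (\<integral>z. mtrace ((\<Phi> z - Q z) * \<Psi> z) \<partial>circle_m)" using S0 by simp
    also have "\<dots> \<le> b"
    proof (rule norm_integral_mtrace_le[OF D \<Psi> b0])
      show "AE z in circle_m. cmod (mtrace ((\<Phi> z - Q z) * \<Psi> z)) \<le> b * opnorm (\<Psi> z)"
        using bae
      proof eventually_elim
        case (elim z)
        show ?case
          by (rule order_trans[OF trace_le_tnorm[OF mat_fun_carrier[OF D] A_set_carrier[OF \<Psi>]]])
             (intro mult_right_mono elim opnorm_nonneg)
      qed
    qed
    finally show "ereal S \<le> ereal b" by simp
  qed
  have zero_Hinf: "mat_fun Hinf n n (\<lambda>_. 0\<^sub>m n n)"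
  proof (rule mat_fun_zero)
    have "esssup circle_m (\<lambda>_. ereal 0) = ereal 0"
      by (rule esssup_const) (use circle.emeasure_space_1 in simp)
    then show "Hinf (\<lambda>_. 0)" by (simp add: Hinf_def Linf_def fourier_coeff_def)
  qed
  have dist: "dist_S1 n \<Phi> = ereal S"
  proof (rule antisym)
    have "dist_S1 n \<Phi> \<le> Linf_S1_norm (\<lambda>z. \<Phi> z - 0\<^sub>m n n)"
      unfolding dist_S1_def using zero_Hinf by (intro INF_lower2[of "\<lambda>_. 0\<^sub>m n n"]) auto
    then show "dist_S1 n \<Phi> \<le> ereal S" using up by (rule order_trans)
    show "ereal S \<le> dist_S1 n \<Phi>"
      unfolding dist_S1_def using low by (intro INF_greatest) auto
  qed
  have best: "Linf_S1_norm (\<lambda>z. \<Phi> z - 0\<^sub>m n n) = dist_S1 n \<Phi>"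
    unfolding dist by (rule antisym[OF up low[OF zero_Hinf]])
  obtain F where F: "mat_fun H2 n k F" "L2_op_norm F \<le> 1" "S \<le> hankel_k_val n k \<Phi> F"
    by (rule extremal_hankel_k_val[OF \<Phi> \<Psi> int S0])
  have val_le: "hankel_k_val n k \<Phi> F' \<le> S * L2_op_norm F'" if "mat_fun H2 n k F'" for F'
    by (rule hankel_k_val_le[OF \<Phi> that S0 tn])
  have val_le_S: "hankel_k_val n k \<Phi> F' \<le> S" if "mat_fun H2 n k F'" "L2_op_norm F' \<le> 1" for F'
    using order_trans[OF val_le[OF that(1)] mult_left_mono[OF that(2) S0]] by simp
  \<comment> \<open>\<open>S\<close> is at most the value at \<open>F\<close>, which is at most
    \<open>S\<close> times the norm of \<open>F\<close>. As S > 0 and the norm is at most 1, it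
    equals 1; in particular it is nonzero, as a maximizing vector requires.\<close>
  have F1: "L2_op_norm F = 1"
  proof -
    have "S * 1 \<le> S * L2_op_norm F" using order_trans[OF F(3) val_le[OF F(1)]] by simp
    then show ?thesis using S_pos F(2) by simp
  qed
  have valF: "hankel_k_val n k \<Phi> F = S"
    using F(3) val_le_S[OF F(1,2)] by simp
  have "hankel_k_norm n k \<Phi> = S"
  proof (rule antisym)
    show "hankel_k_norm n k \<Phi> \<le> S"
      unfolding hankel_k_norm_def using F val_le_S by (intro cSup_least) auto
    have "hankel_k_val n k \<Phi> F \<le> hankel_k_norm n k \<Phi>"
      unfolding hankel_k_norm_def using F val_le_S by (intro cSup_upper bdd_aboveI[of _ S]) auto
    then show "S \<le> hankel_k_norm n k \<Phi>" using valF by simp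
  qed
  then have "hankel_k_has_max_vec n k \<Phi>"
    unfolding hankel_k_has_max_vec_def using F(1) F1 valF by (intro exI[of _ F]) simp
  then have "order_prop n \<Phi> k"
    by (simp add: order_prop_def sigma_k dist)
  \<comment> \<open>Equality with the distance fails for every smaller l, including l = 0, because
    \<open>sigma n l \<Phi>\<close> is at most \<open>T l\<close>, which is below
    \<open>S\<close>.\<close>
  moreover have "\<not> order_prop n \<Phi> l" if "l < k" for l
    using sigma_le[of l] T_less[OF that] that assms(3) by (simp add: order_prop_def dist)
  ultimately show ?thesis
    using best by (simp add: has_order_def)
qed

end
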